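(* If $M$ is a closed homology $d$-manifold, then $\mu_{d-i}(M)=\mu_i(M)$ for all $0\leq i\leq d$.
   Context: All simplicial complexes are finite and abstract, and the empty set is a face (of dimension $-1$) of every simplicial complex. A field $\mathbb{F}$ is fixed and all homology is simplicial homology with coefficients in $\mathbb{F}$. $V(X)$ is the vertex set of $X$; for any set $A$, $X[A]=\{\alpha\in X:\alpha\subseteq A\}$. $f_0(X)$ is the number of vertices of $X$. For $x\in V(X)$, $\mathrm{lk}(x,X)=\{\alpha: x\notin\alpha,\ \alpha\sqcup\{x\}\in X\}$. Closed homology manifolds (over $\mathbb{F}$). A closed homology $d$-manifold is a pure $d$-dimensional simplicial complex in which the link of each non-empty face $\alpha$ has the $\mathbb{F}$-homology of a sphere of dimension $d-\#(\alpha)$ (where $\{\emptyset\}$ counts as the $(-1)$-sphere). Sigma- and mu-vectors. $\beta_i(X)=\dim_{\mathbb F}H_i(X)$ (unreduced). Reduced Betti numbers: $\tilde\beta_0(X)=\beta_0(X)-1$ (so $\tilde\beta_0(\{\emptyset\})=-1$) and $\tilde\beta_i(X)=\beta_i(X)$ for $i\ge1$. Put $\sigma_i(X)=\sum_{A\subseteq V(X)}\tilde\beta_i(X[A])\big/\binom{f_0(X)}{\#(A)}$ for $i\ge 0$ (the sum includes $A=\emptyset$). The mu-vector $(\mu_0,\dots,\mu_d)$ of a $d$-dimensional simplicial complex $X$ is $$\mu_0(X)=\sum_{x\in V(X)}\frac{1}{1+f_0(\mathrm{lk}(x,X))},\qquad \mu_i(X)=\sum_{x\in V(X)}\frac{\delta_{i1}+\sigma_{i-1}(\mathrm{lk}(x,X))}{1+f_0(\mathrm{lk}(x,X))}\quad(1\le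 i\le d),$$ where $\delta_{ij}$ is the Kronecker symbol. *)

theory Defs
  imports Complex_Main
    "HOL-Library.Function_Algebras"
    "HOL-Library.Set_Algebras"
    "Jordan_Normal_Form.Missing_VectorSpace"
    "Jordan_Normal_Form.VS_Connect"
begin

section \<open>Simplicial complexes\<close>

definition simplicial_complex :: "'v set set \<Rightarrow> bool" where
  "simplicial_complex X \<longleftrightarrow>
     finite X \<and> {} \<in> X \<and> (\<forall>\<alpha>\<in>X. finite \<alpha> \<and> (\<forall>\<beta>. \<beta> \<subseteq> \<alpha> \<longrightarrow> \<beta> \<in> X))"

definition vertex_set :: "'v set set \<Rightarrow> 'v set" where
  "vertex_set X = \<Union>X"

definition f0 :: "'v set set \<Rightarrow> nat" where
  "f0 X = card (vertex_set X)"

definition induced :: "'v set set \<Rightarrow> 'v set \<Rightarrow> 'v set set" where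
  "induced X A = {\<alpha>\<in>X. \<alpha> \<subseteq> A}"

definition link :: "'v set \<Rightarrow> 'v set set \<Rightarrow> 'v set set" where
  "link \<alpha> X = {\<beta>. \<alpha> \<inter> \<beta> = {} \<and> \<alpha> \<union> \<beta> \<in> X}"

definition pure_of_dim :: "nat \<Rightarrow> 'v set set \<Rightarrow> bool" where
  "pure_of_dim d X \<longleftrightarrow>
     (\<forall>\<alpha>\<in>X. (\<forall>\<beta>\<in>X. \<alpha> \<subseteq> \<beta> \<longrightarrow> \<beta> = \<alpha>) \<longrightarrow> card \<alpha> = Suc d)"


section \<open>Simplicial homology with coefficients in a field\<close>

text \<open>
  Orientation signs need a linear order of the vertices. We fix one linear order of the whole
  vertex type once and for all, so that a complex and its subcomplexes are oriented coherently;
  up to isomorphism the homology does not depend on this choice.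
\<close>

definition vertex_order :: "'v rel" where
  "vertex_order = (SOME r. linear_order_on UNIV r)"

lemma linear_order_vertex_order: "linear_order_on UNIV vertex_order"
proof -
  have "\<exists>r :: 'v rel. linear_order_on UNIV r"
    using well_order_on[of UNIV] by (auto simp: well_order_on_def)
  then show ?thesis
    unfolding vertex_order_def by (rule someI_ex)
qed

text \<open>
  A chain is the coefficient function of a formal linear combination of non-empty faces, each
  face being oriented by increasing vertices.
\<close>

definition chain_space :: "nat \<Rightarrow> 'v set set \<Rightarrow> ('v set \<Rightarrow> 'f::field) set" where
  "chain_space i X = {c. \<forall>\<alpha>. c \<alpha> \<noteq> 0 \<longrightarrow> \<alpha> \<in> X \<and> card \<alpha> = Suc i}"

text \<open>
  The usual boundary map: in \<open>\<partial>[v\<^sub>0,\<dots>,v\<^sub>i]\<close> with \<open>v\<^sub>0 < \<dots> < v\<^sub>i\<close> the face omitting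
  \<open>v = v\<^sub>j\<close> has the sign \<open>(-1) ^ j\<close>, where \<open>j\<close> is the number of remaining vertices below
  \<open>v\<close>. The coefficient at \<open>\<tau>\<close> thus collects the faces \<open>insert v \<tau>\<close>. The case
  \<open>\<tau> = {}\<close> is cut off because the homology is unreduced.
\<close>

definition boundary_map ::
    "'v set set \<Rightarrow> ('v set \<Rightarrow> 'f::field) \<Rightarrow> 'v set \<Rightarrow> 'f" where
  "boundary_map X c \<tau> =
     (if \<tau> = {} then 0
      else \<Sum>v\<in>vertex_set X - \<tau>. (-1) ^ card {u\<in>\<tau>. (u, v) \<in> vertex_order} * c (insert v \<tau>))"

definition cycles :: "nat \<Rightarrow> 'v set set \<Rightarrow> ('v set \<Rightarrow> 'f::field) set" where
  "cycles i X = {c \<in> chain_space i X. boundary_map X c = 0}"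

definition boundaries :: "nat \<Rightarrow> 'v set set \<Rightarrow> ('v set \<Rightarrow> 'f::field) set" where
  "boundaries i X = boundary_map X ` chain_space (Suc i) X"

text \<open>
  The quotient space \<open>cycles / boundaries\<close>, whose elements are cosets. Adding the boundaries in
  the scalar multiplication only matters for the scalar \<open>0\<close>. The fields \<open>mult\<close> and
  \<open>one\<close> of the record play no role in a module.
\<close>

definition homology :: "nat \<Rightarrow> 'v set set \<Rightarrow> ('f::field, ('v set \<Rightarrow> 'f) set) module" where
  "homology i X =
     \<lparr>carrier = (\<lambda>z. z +o boundaries i X) ` cycles i X,
      mult = undefined, one = undefined,
      zero = boundaries i X,
      add = (+),
      smult = (\<lambda>a C. (\<lambda>c \<alpha>. a * c \<alpha>) ` C + boundaries i X)\<rparr>"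

lemma boundary_map_add: "boundary_map X (b + c) = boundary_map X b + boundary_map X c"
  by (rule ext) (auto simp: boundary_map_def algebra_simps sum.distrib)

lemma boundary_map_scale: "boundary_map X (\<lambda>\<alpha>. a * c \<alpha>) = (\<lambda>\<alpha>. a * boundary_map X c \<alpha>)"
  by (rule ext) (auto simp: boundary_map_def algebra_simps sum_distrib_left)

lemma boundaries_add:
  assumes "b \<in> boundaries i X" "c \<in> boundaries i X"
  shows "b + c \<in> boundaries i X"
proof -
  obtain x y where xy: "x \<in> chain_space (Suc i) X" "b = boundary_map X x"
      "y \<in> chain_space (Suc i) X" "c = boundary_map X y"
    using assms by (auto simp: boundaries_def)
  have "x + y \<in> chain_space (Suc i) X"
    unfolding chain_space_def
  proof (intro CollectI allI impI)
    fix \<alpha> assume "(x + y) \<alpha> \<noteq> 0"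
    then have "x \<alpha> \<noteq> 0 \<or> y \<alpha> \<noteq> 0" by auto
    then show "\<alpha> \<in> X \<and> card \<alpha> = Suc (Suc i)" using xy(1,3) by (auto simp: chain_space_def)
  qed
  moreover have "b + c = boundary_map X (x + y)"
    using xy by (simp add: boundary_map_add)
  ultimately show ?thesis by (simp add: boundaries_def)
qed

lemma boundaries_scale:
  assumes "c \<in> boundaries i X"
  shows "(\<lambda>\<alpha>. a * c \<alpha>) \<in> boundaries i X"
proof -
  obtain e where e: "e \<in> chain_space (Suc i) X" "c = boundary_map X e"
    using assms by (auto simp: boundaries_def)
  have "(\<lambda>\<alpha>. a * e \<alpha>) \<in> chain_space (Suc i) X" using e by (auto simp: chain_space_def)
  moreover have "(\<lambda>\<alpha>. a * c \<alpha>) = boundary_map X (\<lambda>\<alpha>. a * e \<alpha>)"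
    using e(2) by (simp add: boundary_map_scale)
  ultimately show ?thesis by (simp add: boundaries_def)
qed

lemma boundaries_zero: "(0 :: 'v set \<Rightarrow> 'f::field) \<in> boundaries i X"
proof -
  have z: "(0 :: 'v set \<Rightarrow> 'f) \<in> chain_space (Suc i) X" "(0 :: 'v set \<Rightarrow> 'f) = boundary_map X 0"
    by (auto simp: chain_space_def boundary_map_def fun_eq_iff)
  show ?thesis unfolding boundaries_def by (rule image_eqI[where f = "boundary_map X", OF z(2) z(1)])
qed

lemma cycles_add:
  assumes "x \<in> cycles i X" "y \<in> cycles i X"
  shows "x + y \<in> cycles i X"
proof -
  have "x + y \<in> chain_space i X"
    unfolding chain_space_def
  proof (intro CollectI allI impI)
    fix \<alpha> assume "(x + y) \<alpha> \<noteq> 0"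
    then have "x \<alpha> \<noteq> 0 \<or> y \<alpha> \<noteq> 0" by auto
    then show "\<alpha> \<in> X \<and> card \<alpha> = Suc i" using assms by (auto simp: cycles_def chain_space_def)
  qed
  then show ?thesis using assms by (simp add: cycles_def boundary_map_add)
qed

lemma cycles_zero: "0 \<in> cycles i X"
  by (auto simp: cycles_def chain_space_def boundary_map_def fun_eq_iff)

lemma cycles_scale: "x \<in> cycles i X \<Longrightarrow> (\<lambda>\<alpha>. a * x \<alpha>) \<in> cycles i X"
  by (auto simp: cycles_def chain_space_def boundary_map_scale fun_eq_iff)

lemma coset_add: "(x +o boundaries i X) + (y +o boundaries i X) = (x + y) +o boundaries i X"
  (is "?L = ?R")
proof
  show "?L \<subseteq> ?R"
  proof
    fix u assume "u \<in> ?L"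
    then obtain b c where "b \<in> boundaries i X" "c \<in> boundaries i X" "u = (x + b) + (y + c)"
      by (auto simp: set_plus_def elt_set_plus_def)
    then show "u \<in> ?R"
      using boundaries_add[of b i X c] by (auto simp: elt_set_plus_def intro!: bexI[of _ "b + c"])
  qed
  show "?R \<subseteq> ?L"
  proof
    fix u assume "u \<in> ?R"
    then obtain b where b: "b \<in> boundaries i X" "u = (x + 0) + (y + b)"
      by (auto simp: elt_set_plus_def add.assoc)
    then show "u \<in> ?L" unfolding b(2)
      using boundaries_zero[of i X] by (intro set_plus_intro set_plus_intro2) auto
  qed
qed

lemma coset_scale:
  "(\<lambda>c \<alpha>. a * c \<alpha>) ` (x +o boundaries i X) + boundaries i X = (\<lambda>\<alpha>. a * x \<alpha>) +o boundaries i X"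
  (is "?L = ?R")
proof
  show "?L \<subseteq> ?R"
  proof
    fix u assume "u \<in> ?L"
    then obtain b c where bc: "b \<in> boundaries i X" "c \<in> boundaries i X"
        "u = (\<lambda>\<alpha>. a * (x + b) \<alpha>) + c"
      by (auto simp: set_plus_def elt_set_plus_def)
    have "u = (\<lambda>\<alpha>. a * x \<alpha>) + ((\<lambda>\<alpha>. a * b \<alpha>) + c)"
      unfolding bc(3) by (simp add: fun_eq_iff algebra_simps)
    then show "u \<in> ?R"
      using boundaries_add[OF boundaries_scale[OF bc(1), of a] bc(2)] by (simp add: set_plus_intro2)
  qed
  show "?R \<subseteq> ?L"
  proof
    fix u assume "u \<in> ?R"
    then obtain b where b: "b \<in> boundaries i X" "u = (\<lambda>\<alpha>. a * x \<alpha>) + b"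
      by (auto simp: elt_set_plus_def)
    have "x \<in> x +o boundaries i X"
      using set_plus_intro2[OF boundaries_zero, of x i X] by simp
    then show "u \<in> ?L" unfolding b(2)
      using b(1) by (intro set_plus_intro imageI)
  qed
qed

lemma vectorspace_homology:
  "vectorspace (class_ring :: 'f::field ring) (homology i X :: ('f, ('v set \<Rightarrow> 'f) set) module)"
proof -
  let ?H = "homology i X :: ('f, ('v set \<Rightarrow> 'f) set) module"
  let ?B = "boundaries i X :: ('v set \<Rightarrow> 'f) set"
  have car: "carrier ?H = (\<lambda>z. z +o ?B) ` cycles i X" and ze: "\<zero>\<^bsub>?H\<^esub> = 0 +o ?B"
    and ad: "\<And>C D. C \<oplus>\<^bsub>?H\<^esub> D = C + D"
    and sm: "\<And>a C. a \<odot>\<^bsub>?H\<^esub> C = (\<lambda>c \<alpha>. a * c \<alpha>) ` C + ?B"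
    by (simp_all add: homology_def)
  have ab: "abelian_group ?H"
  proof (rule abelian_groupI)
    fix C assume "C \<in> carrier ?H"
    then obtain x where x: "x \<in> cycles i X" "C = x +o ?B" by (auto simp: car)
    have "(\<lambda>\<alpha>. - 1 * x \<alpha>) + x = 0" by (simp add: fun_eq_iff)
    then show "\<exists>D\<in>carrier ?H. D \<oplus>\<^bsub>?H\<^esub> C = \<zero>\<^bsub>?H\<^esub>"
      unfolding car ad ze x(2)
      by (intro bexI[of _ "(\<lambda>\<alpha>. - 1 * x \<alpha>) +o ?B"] imageI cycles_scale[OF x(1)])
        (simp only: coset_add)
    show "\<zero>\<^bsub>?H\<^esub> \<oplus>\<^bsub>?H\<^esub> C = C"
      by (simp only: x(2) ad ze coset_add add_0)
  next
    show "\<zero>\<^bsub>?H\<^esub> \<in> carrier ?H"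
      unfolding car ze by (intro imageI cycles_zero)
  next
    fix C D assume "C \<in> carrier ?H" "D \<in> carrier ?H"
    then show "C \<oplus>\<^bsub>?H\<^esub> D \<in> carrier ?H"
      unfolding car ad by (auto simp only: coset_add intro!: imageI cycles_add)
  qed (simp_all only: ad ac_simps)
  have "module class_ring ?H"
  proof (rule moduleI[OF domain.axioms(1)[OF field.axioms(1)[OF class_field]] ab])
    fix a b :: 'f and C D
    assume "C \<in> carrier ?H" "D \<in> carrier ?H"
    then obtain x y where xy: "x \<in> cycles i X" "C = x +o ?B" "y \<in> cycles i X" "D = y +o ?B"
      by (auto simp: car)
    show "a \<odot>\<^bsub>?H\<^esub> (C \<oplus>\<^bsub>?H\<^esub> D) = a \<odot>\<^bsub>?H\<^esub> C \<oplus>\<^bsub>?H\<^esub> a \<odot>\<^bsub>?H\<^esub> D"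
      unfolding xy sm ad coset_add coset_scale
      by (rule arg_cong[of _ _ "\<lambda>z. z +o ?B"]) (simp add: fun_eq_iff algebra_simps)
  next
    fix a b :: 'f and C
    assume "C \<in> carrier ?H"
    then obtain x where x: "x \<in> cycles i X" "C = x +o ?B" by (auto simp: car)
    show "a \<odot>\<^bsub>?H\<^esub> C \<in> carrier ?H"
      unfolding x sm coset_scale car by (intro imageI cycles_scale x)
    show "(a \<oplus>\<^bsub>class_ring\<^esub> b) \<odot>\<^bsub>?H\<^esub> C = a \<odot>\<^bsub>?H\<^esub> C \<oplus>\<^bsub>?H\<^esub> b \<odot>\<^bsub>?H\<^esub> C"
      unfolding x sm ad coset_add coset_scale
      by (rule arg_cong[of _ _ "\<lambda>z. z +o ?B"]) (simp add: fun_eq_iff algebra_simps)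
    show "(a \<otimes>\<^bsub>class_ring\<^esub> b) \<odot>\<^bsub>?H\<^esub> C = a \<odot>\<^bsub>?H\<^esub> (b \<odot>\<^bsub>?H\<^esub> C)"
      unfolding x sm coset_scale
      by (rule arg_cong[of _ _ "\<lambda>z. z +o ?B"]) (simp add: fun_eq_iff algebra_simps)
    show "\<one>\<^bsub>class_ring\<^esub> \<odot>\<^bsub>?H\<^esub> C = C"
      unfolding x sm coset_scale
      by (rule arg_cong[of _ _ "\<lambda>z. z +o ?B"]) (simp add: fun_eq_iff)
  qed
  then show ?thesis by (simp add: vectorspace_def class_field)
qed

definition betti :: "'f::field itself \<Rightarrow> nat \<Rightarrow> 'v set set \<Rightarrow> nat" where
  "betti F i X =
     vectorspace.dim (class_ring :: 'f ring) (homology i X :: ('f, ('v set \<Rightarrow> 'f) set) module)"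

definition red_betti :: "'f::field itself \<Rightarrow> nat \<Rightarrow> 'v set set \<Rightarrow> int" where
  "red_betti F i X = int (betti F i X) - (if i = 0 then 1 else 0)"


section \<open>Closed homology manifolds\<close>

text \<open>
  For \<open>k = -1\<close> all Betti numbers vanish, as for the complex \<open>{{}}\<close>; for \<open>k = 0\<close> both
  summands contribute to \<open>i = 0\<close>, since the 0-sphere consists of two points.
\<close>

definition has_homology_of_sphere :: "'f::field itself \<Rightarrow> int \<Rightarrow> 'v set set \<Rightarrow> bool" where
  "has_homology_of_sphere F k X \<longleftrightarrow>
     (\<forall>i. betti F i X = (if i = 0 \<and> k \<ge> 0 then 1 else 0) + (if int i = k then 1 else 0))"

definition closed_homology_manifold :: "'f::field itself \<Rightarrow> nat \<Rightarrow> 'v set set \<Rightarrow> bool" where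
  "closed_homology_manifold F d M \<longleftrightarrow>
     simplicial_complex M \<and> pure_of_dim d M \<and>
     (\<forall>\<alpha>\<in>M. \<alpha> \<noteq> {} \<longrightarrow> has_homology_of_sphere F (int d - int (card \<alpha>)) (link \<alpha> M))"


section \<open>The sigma- and mu-vectors\<close>

definition sigma_vec :: "'f::field itself \<Rightarrow> nat \<Rightarrow> 'v set set \<Rightarrow> real" where
  "sigma_vec F i X =
     (\<Sum>A\<in>Pow (vertex_set X). of_int (red_betti F i (induced X A)) / of_nat (f0 X choose card A))"

definition mu_vec :: "'f::field itself \<Rightarrow> nat \<Rightarrow> 'v set set \<Rightarrow> real" where
  "mu_vec F i X =
     (if i = 0 then \<Sum>x\<in>vertex_set X. 1 / (1 + of_nat (f0 (link {x} X)))
      else \<Sum>x\<in>vertex_set X.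
             ((if i = 1 then 1 else 0) + sigma_vec F (i - 1) (link {x} X))
               / (1 + of_nat (f0 (link {x} X))))"

end

theory Submission
  imports Defs
begin

text \<open>
The identity already holds vertex by vertex: the contributions of a vertex \<open>x\<close> to
\<open>\<mu>\<^sub>i\<close> and to \<open>\<mu>\<^sub>d\<^sub>-\<^sub>i\<close> agree. Let \<open>L\<close> be the link of \<open>x\<close>, with vertex set \<open>V\<close>. Grade
reduced homology by the number of vertices of a face (so the empty face lives in degree 0), and
write \<open>h\<^sub>n\<close> for its dimensions. The Kronecker summand and the value \<open>-1\<close> at the empty complex in
the definition of the mu-vector are exactly what is needed for the contribution of \<open>x\<close> to be, up
to the common factor \<open>1 / (1 + |V|)\<close>, the sum of \<open>h\<^sub>i(L[A])\<close> over all \<open>A \<subseteq> V\<close> weighted by the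
inverse of \<open>|V|\<close> choose \<open>|A|\<close>, for every \<open>i \<ge> 0\<close> alike (\<open>mu_vec_eq\<close>). The weights do not change
when \<open>A\<close> is replaced by its complement, so everything follows from Alexander duality
\<open>h\<^sub>n(L[V - B]) = h\<^sub>d\<^sub>-\<^sub>n(L[B])\<close> (\<open>alexander_duality\<close>).

All the links of \<open>L\<close>, that of the empty face included, are homology spheres of the right
dimension. Duality is derived from this with a double complex. It is spanned by the
pairs \<open>(\<alpha>, \<tau>)\<close> with \<open>\<alpha> \<subseteq> \<tau> \<inter> B\<close> and \<open>\<tau> \<in> L\<close>; its differential is the boundary of \<open>\<tau>\<close> plus,
up to a sign, the coboundary of \<open>\<alpha>\<close>, and it is graded by \<open>|\<tau>| - |\<alpha>|\<close>.

For a fixed \<open>\<tau>\<close> the \<open>\<alpha>\<close>-direction is the augmented cochain complex of the full simplex on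
\<open>\<tau> \<inter> B\<close>, which is acyclic unless \<open>\<tau> \<inter> B\<close> is empty. Hence the inclusion of the chains of
\<open>L[V - B]\<close> as the pairs \<open>({}, \<tau>)\<close> induces an isomorphism in homology (\<open>column_comparison\<close>).

For a fixed \<open>\<alpha>\<close> the \<open>\<tau>\<close>-direction is the chain complex of the link of \<open>\<alpha>\<close>, up to a shift. Its
homology is one-dimensional and sits in the top degree, \<open>|\<tau>| = d\<close>. Moreover it is
spanned by the restriction of one single cycle \<open>z\<close>, the fundamental cycle of \<open>L\<close>, because \<open>z\<close>
vanishes on no facet (\<open>star_cycle_nonzero_facet\<close>, \<open>fundamental_cycle\<close>). Hence the cochains \<open>c\<close> of
\<open>L[B]\<close>, included as the functions \<open>c(\<alpha>) z(\<tau>)\<close>, also induce an isomorphism (\<open>row_comparison\<close>).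

Over a field the cohomology of \<open>L[B]\<close> has the same dimensions as its homology, since adjoint maps
have equal rank (\<open>rank_adjoint\<close>, \<open>cohomology_dim\<close>).
\<close>

section \<open>Dimensions of spaces of functions\<close>

abbreviation (input) scale :: "'f::field \<Rightarrow> ('x \<Rightarrow> 'f) \<Rightarrow> 'x \<Rightarrow> 'f" where
  "scale a u \<equiv> (\<lambda>x. a * u x)"

definition linear_subspace :: "('x \<Rightarrow> 'f::field) set \<Rightarrow> bool" where
  "linear_subspace W \<longleftrightarrow>
     0 \<in> W \<and> (\<forall>u\<in>W. \<forall>v\<in>W. u + v \<in> W) \<and> (\<forall>a. \<forall>u\<in>W. scale a u \<in> W)"

text \<open>
All spaces of chains below consist of functions that vanish outside a fixed finite set. Asking for
such a set, instead of for a finite generating set, makes the condition pass to subspaces for free.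
\<close>

definition fd_subspace :: "('x \<Rightarrow> 'f::field) set \<Rightarrow> bool" where
  "fd_subspace W \<longleftrightarrow> linear_subspace W \<and> (\<exists>S. finite S \<and> (\<forall>u\<in>W. \<forall>x. u x \<noteq> 0 \<longrightarrow> x \<in> S))"

definition linear_op :: "(('x \<Rightarrow> 'f::field) \<Rightarrow> ('y \<Rightarrow> 'f)) \<Rightarrow> bool" where
  "linear_op T \<longleftrightarrow> (\<forall>u v. T (u + v) = T u + T v) \<and> (\<forall>a u. T (scale a u) = scale a (T u))"

definition fun_space :: "('x \<Rightarrow> 'f::field) set \<Rightarrow> ('f, 'x \<Rightarrow> 'f) module" where
  "fun_space W = \<lparr>carrier = W, mult = undefined, one = undefined, zero = 0, add = (+), smult = scale\<rparr>"

definition fdim :: "('x \<Rightarrow> 'f::field) set \<Rightarrow> nat" where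
  "fdim W = vectorspace.dim (class_ring :: 'f ring) (fun_space W)"

lemma fun_space_simps [simp]:
  "carrier (fun_space W) = W" "zero (fun_space W) = 0" "add (fun_space W) = (+)"
  "smult (fun_space W) = scale" "fun_space W\<lparr>carrier := U\<rparr> = fun_space U"
  by (simp_all add: fun_space_def)

lemma linear_subspaceD:
  assumes "linear_subspace W"
  shows "0 \<in> W" "u \<in> W \<Longrightarrow> v \<in> W \<Longrightarrow> u + v \<in> W" "u \<in> W \<Longrightarrow> scale a u \<in> W"
  using assms by (auto simp: linear_subspace_def)

lemma linear_subspace_minus:
  assumes "linear_subspace W" "u \<in> W" "v \<in> W"
  shows "u - v \<in> W"
proof -
  have "u - v = u + scale (-1) v" by (auto simp: fun_eq_iff)
  then show ?thesis using assms linear_subspaceD by metis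
qed

lemma linear_opD:
  assumes "linear_op T"
  shows "T (u + v) = T u + T v" "T (scale a u) = scale a (T u)"
  using assms unfolding linear_op_def by blast+

lemma linear_op_zero: "linear_op T \<Longrightarrow> T 0 = 0"
  using linear_opD(2)[of T 0 0] by (simp add: fun_eq_iff zero_fun_def)

lemma linear_op_minus: "linear_op T \<Longrightarrow> T (u - v) = T u - T v"
  using linear_opD(1)[of T "u - v" v] by (simp add: fun_eq_iff)

lemma fd_subspace_linear: "fd_subspace W \<Longrightarrow> linear_subspace W"
  by (simp add: fd_subspace_def)

lemma fd_subspace_subset:
  "fd_subspace W \<Longrightarrow> linear_subspace U \<Longrightarrow> U \<subseteq> W \<Longrightarrow> fd_subspace U"
  by (auto simp: fd_subspace_def)

lemma linear_subspace_image:
  assumes "linear_op T" "linear_subspace W"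
  shows "linear_subspace (T ` W)"
  unfolding linear_subspace_def
proof (intro conjI ballI allI)
  show "0 \<in> T ` W"
    using linear_op_zero[OF assms(1)] linear_subspaceD(1)[OF assms(2)] by (metis imageI)
  fix u assume "u \<in> T ` W"
  then obtain u' where u: "u' \<in> W" "u = T u'" by auto
  show "scale a u \<in> T ` W" for a
    unfolding u(2) linear_opD(2)[OF assms(1), symmetric] using u(1) assms(2) linear_subspaceD(3) by blast
  fix v assume "v \<in> T ` W"
  then obtain v' where v: "v' \<in> W" "v = T v'" by auto
  show "u + v \<in> T ` W"
    unfolding u(2) v(2) linear_opD(1)[OF assms(1), symmetric]
    using u(1) v(1) assms(2) linear_subspaceD(2) by blast
qed

lemma linear_subspace_kernel:
  assumes "linear_op T" "linear_subspace W"
  shows "linear_subspace {u \<in> W. T u = 0}"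
  using assms linear_op_zero[OF assms(1)] linear_opD[OF assms(1)]
  by (auto simp: linear_subspace_def zero_fun_def)

lemma vectorspace_fun_space:
  assumes "linear_subspace (W :: ('x \<Rightarrow> 'f::field) set)"
  shows "vectorspace (class_ring :: 'f ring) (fun_space W)"
proof (rule vs_criteria[OF class_field])
  show "\<forall>v\<in>carrier (fun_space W). \<exists>w\<in>carrier (fun_space W). v \<oplus>\<^bsub>fun_space W\<^esub> w = \<zero>\<^bsub>fun_space W\<^esub>"
  proof
    fix v assume "v \<in> carrier (fun_space W)"
    then have "scale (-1) v \<in> W" using linear_subspaceD(3)[OF assms, of v "-1"] by simp
    then show "\<exists>w\<in>carrier (fun_space W). v \<oplus>\<^bsub>fun_space W\<^esub> w = \<zero>\<^bsub>fun_space W\<^esub>"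
      by (intro bexI[of _ "scale (-1) v"]) (auto simp: fun_eq_iff)
  qed
qed (use assms in \<open>auto simp: linear_subspace_def fun_eq_iff algebra_simps\<close>)

lemma subspace_fun_space:
  assumes "linear_subspace (W :: ('x \<Rightarrow> 'f::field) set)" "linear_subspace U" "U \<subseteq> W"
  shows "VectorSpace.subspace (class_ring :: 'f ring) U (fun_space W)"
proof -
  interpret vectorspace "class_ring :: 'f ring" "fun_space W" by (rule vectorspace_fun_space[OF assms(1)])
  show ?thesis
    unfolding subspace_def submodule_def
    using assms(2,3) vectorspace_axioms module_axioms by (auto simp: linear_subspace_def)
qed

text \<open>
Induction on the support: the functions of \<open>W\<close> that vanish at one point \<open>s\<close> are finitely generated
by induction, and one further function that does not vanish at \<open>s\<close> suffices to generate the rest.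
\<close>

lemma fin_dim_fun_space:
  assumes "fd_subspace (W :: ('x \<Rightarrow> 'f::field) set)"
  shows "vectorspace.fin_dim (class_ring :: 'f ring) (fun_space W)"
proof -
  obtain S where S: "finite S" "\<forall>u\<in>W. \<forall>x. u x \<noteq> 0 \<longrightarrow> x \<in> S" and lin: "linear_subspace W"
    using assms by (auto simp: fd_subspace_def)
  from S lin show ?thesis
  proof (induction S arbitrary: W rule: finite_induct)
    case empty
    interpret vectorspace "class_ring :: 'f ring" "fun_space W"
      by (rule vectorspace_fun_space[OF empty.prems(2)])
    have "W = {0}" using empty linear_subspaceD(1)[OF empty.prems(2)] by (auto simp: fun_eq_iff)
    then have "gen_set {}" using span_empty by simp
    then show ?case unfolding fin_dim_def by blast
  next
    case (insert s S)
    interpret vectorspace "class_ring :: 'f ring" "fun_space W"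
      by (rule vectorspace_fun_space[OF insert.prems(2)])
    let ?U = "{u \<in> W. u s = 0}"
    have linU: "linear_subspace ?U" using insert.prems(2) by (auto simp: linear_subspace_def)
    have "vectorspace.fin_dim (class_ring :: 'f ring) (fun_space ?U)"
      by (rule insert.IH) (use insert.prems linU in auto)
    then obtain A where A: "finite A" "A \<subseteq> ?U" "LinearCombinations.module.span class_ring (fun_space ?U) A = ?U"
      unfolding vectorspace.fin_dim_def[OF vectorspace_fun_space[OF linU]] by auto
    have sub: "submodule class_ring ?U (fun_space W)"
      using subspace_fun_space[OF insert.prems(2) linU] by (auto simp: subspace_def)
    have spanA: "span A = ?U"
      using span_li_not_depend(1)[OF A(2) sub] A(3) by simp
    show ?case
    proof (cases "?U = W")
      case True
      then show ?thesis unfolding fin_dim_def using A spanA by (intro exI[of _ A]) auto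
    next
      case False
      then obtain w where w: "w \<in> W" "w s \<noteq> 0" by auto
      let ?A = "insert w A"
      have AW: "?A \<subseteq> carrier (fun_space W)" using A w by auto
      have sp: "submodule class_ring (span ?A) (fun_space W)" by (rule span_is_submodule[OF AW])
      have "u \<in> span ?A" if u: "u \<in> W" for u
      proof -
        let ?a = "u s / w s"
        have "scale (- ?a) w + u \<in> ?U"
          using linear_subspaceD(2)[OF insert.prems(2) linear_subspaceD(3)[OF insert.prems(2) w(1), of "- ?a"] u] w(2)
          by simp
        then have 1: "scale (- ?a) w + u \<in> span ?A"
          using spanA span_is_monotone[of A ?A] by blast
        have "w \<in> span ?A" using in_own_span[OF AW] by auto
        then have 2: "scale ?a w \<in> span ?A"
          using submodule.smult_closed[OF sp, of ?a w] by simp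
        have "scale ?a w + (scale (- ?a) w + u) = u" by (auto simp: fun_eq_iff)
        then show ?thesis
          using sp 1 2 unfolding submodule_def by (metis fun_space_simps(3))
      qed
      moreover have "span ?A \<subseteq> W" using submodule.subset[OF sp] by simp
      ultimately show ?thesis
        unfolding fin_dim_def using A w by (intro exI[of _ ?A]) auto
    qed
  qed
qed

text \<open>
The target may be any vector space, so that this applies both to maps between spaces of functions
and to the projection of the cycles onto homology, whose elements are cosets.
\<close>

lemma linear_map_rank_nullity:
  assumes W: "fd_subspace (W :: ('x \<Rightarrow> 'f::field) set)"
    and V: "vectorspace (class_ring :: 'f ring) V"
    and hom: "T \<in> LinearCombinations.module_hom (class_ring :: 'f ring) (fun_space W) V"
    and surj: "T ` W = carrier V"
  shows "vectorspace.dim (class_ring :: 'f ring) V + fdim {u \<in> W. T u = \<zero>\<^bsub>V\<^esub>} = fdim W"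
proof -
  have vW: "vectorspace (class_ring :: 'f ring) (fun_space W)"
    by (rule vectorspace_fun_space[OF fd_subspace_linear[OF W]])
  interpret linear_map "class_ring :: 'f ring" "fun_space W" V T
    using V vW hom by (auto simp: linear_map_def mod_hom_def mod_hom_axioms_def vectorspace.axioms)
  have im: "imT = carrier V" using surj by (simp add: im_def)
  have ker: "kerT = {u \<in> W. T u = \<zero>\<^bsub>V\<^esub>}" by (simp add: ker_def)
  show ?thesis
    using rank_nullity[OF fin_dim_fun_space[OF W]] by (simp add: im ker fdim_def)
qed

lemma rank_nullity_fun:
  assumes W: "fd_subspace W" and T: "linear_op T"
  shows "fdim (T ` W) + fdim {u \<in> W. T u = 0} = fdim W"
proof -
  have lin: "linear_subspace (T ` W)"
    by (rule linear_subspace_image[OF T fd_subspace_linear[OF W]])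
  show ?thesis
    using linear_map_rank_nullity[OF W vectorspace_fun_space[OF lin], of T] linear_opD[OF T]
    by (auto simp: LinearCombinations.module_hom_def fdim_def)
qed


text \<open>
Rank-nullity for the identity.
\<close>

lemma fdim_zero: "fdim {0 :: 'x \<Rightarrow> 'f::field} = 0"
proof -
  have fd: "fd_subspace {0 :: 'x \<Rightarrow> 'f}"
    by (auto simp: fd_subspace_def linear_subspace_def fun_eq_iff)
  have "linear_op (\<lambda>u :: 'x \<Rightarrow> 'f. u)" by (simp add: linear_op_def)
  from rank_nullity_fun[OF fd this] show ?thesis by simp
qed

lemma fdim_inj_image:
  assumes "fd_subspace W" "linear_op T" "\<And>u. u \<in> W \<Longrightarrow> T u = 0 \<Longrightarrow> u = 0"
  shows "fdim (T ` W) = fdim W"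
proof -
  have "{u \<in> W. T u = 0} = {0}"
    using assms(3) linear_op_zero[OF assms(2)] linear_subspaceD(1)[OF fd_subspace_linear[OF assms(1)]] by auto
  then show ?thesis using rank_nullity_fun[OF assms(1,2)] by (simp add: fdim_zero)
qed

lemma
  assumes W: "fd_subspace (W :: ('x \<Rightarrow> 'f::field) set)" and U: "linear_subspace U" "U \<subseteq> W"
  shows fdim_mono: "fdim U \<le> fdim W"
    and fdim_eq_imp_eq: "fdim U = fdim W \<Longrightarrow> U = W"
proof -
  have fdU: "fd_subspace U" by (rule fd_subspace_subset[OF W U])
  interpret W: vectorspace "class_ring :: 'f ring" "fun_space W"
    by (rule vectorspace_fun_space[OF fd_subspace_linear[OF W]])
  interpret U: vectorspace "class_ring :: 'f ring" "fun_space U"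
    by (rule vectorspace_fun_space[OF U(1)])
  have sub: "submodule class_ring U (fun_space W)"
    using subspace_fun_space[OF fd_subspace_linear[OF W] U] by (auto simp: subspace_def)
  obtain b where b: "finite b" "U.basis b"
    using U.finite_basis_exists[OF fin_dim_fun_space[OF fdU]] by auto
  have bU: "b \<subseteq> U" "U.lin_indpt b" "U.span b = U" using b(2) by (auto simp: U.basis_def)
  have li: "W.lin_indpt b" using W.span_li_not_depend(2)[OF bU(1) sub] bU(2) by simp
  have card: "card b = fdim U" using U.dim_basis[OF b] by (simp add: fdim_def)
  show "fdim U \<le> fdim W"
    using W.li_le_dim(2)[OF fin_dim_fun_space[OF W] _ li] bU(1) U(2) card by (auto simp: fdim_def)
  assume eq: "fdim U = fdim W"
  have "W.basis b"
    by (rule W.dim_li_is_basis[OF fin_dim_fun_space[OF W] b(1) _ li])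
      (use bU(1) U(2) card eq in \<open>auto simp: fdim_def\<close>)
  then have "W.span b = W" by (simp add: W.basis_def)
  then show "U = W" using W.span_li_not_depend(1)[OF bU(1) sub] bU(3) by simp
qed

lemma fdim_line:
  assumes "finite {x. w x \<noteq> 0}" "w \<noteq> (0 :: 'x \<Rightarrow> 'f::field)"
  shows "fd_subspace (range (\<lambda>a. scale a w))" "fdim (range (\<lambda>a. scale a w)) = 1"
proof -
  let ?L = "range (\<lambda>a. scale a w)"
  have lin: "linear_subspace ?L"
    unfolding linear_subspace_def
  proof (intro conjI ballI allI)
    show "0 \<in> ?L" by (rule range_eqI[of _ _ 0]) (simp add: fun_eq_iff)
    fix u assume "u \<in> ?L"
    then obtain a where a: "u = scale a w" by auto
    show "scale c u \<in> ?L" for c by (rule range_eqI[of _ _ "c * a"]) (simp add: a fun_eq_iff)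
    fix v assume "v \<in> ?L"
    then obtain b where b: "v = scale b w" by auto
    show "u + v \<in> ?L" by (rule range_eqI[of _ _ "a + b"]) (simp add: a b fun_eq_iff algebra_simps)
  qed
  show "fd_subspace ?L"
    unfolding fd_subspace_def using lin assms(1) by (intro conjI exI[of _ "{x. w x \<noteq> 0}"]) auto
  interpret vectorspace "class_ring :: 'f ring" "fun_space ?L" by (rule vectorspace_fun_space[OF lin])
  have wL: "w \<in> ?L" by (rule range_eqI[of _ _ 1]) simp
  have sp: "submodule class_ring (span {w}) (fun_space ?L)"
    by (rule span_is_submodule) (use wL in auto)
  have "w \<in> span {w}" using in_own_span[of "{w}"] wL by auto
  then have "scale a w \<in> span {w}" for a using submodule.smult_closed[OF sp, of a w] by simp
  then have "gen_set {w}" using submodule.subset[OF sp] by auto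
  then show "fdim ?L = 1" unfolding fdim_def by (rule dim1I) (use assms(2) wL in auto)
qed

lemma fdim_one_multiple:
  assumes W: "fd_subspace W" "fdim W = 1" and w: "w \<in> W" "w \<noteq> 0" and u: "u \<in> W"
  obtains a where "u = scale a w"
proof -
  let ?L = "range (\<lambda>a. scale a w)"
  have fin: "finite {x. w x \<noteq> 0}"
    using W(1) w(1) unfolding fd_subspace_def by (metis (mono_tags, lifting) finite_subset mem_Collect_eq subsetI)
  have sub: "?L \<subseteq> W" using linear_subspaceD(3)[OF fd_subspace_linear[OF W(1)] w(1)] by auto
  have "?L = W"
    using fdim_eq_imp_eq[OF W(1) fd_subspace_linear[OF fdim_line(1)[OF fin w(2)]] sub]
      fdim_line(2)[OF fin w(2)] W(2) by simp
  then show thesis using u that by auto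
qed

text \<open>
The last property says that \<open>b\<close> spans \<open>U\<close>, expressed without linear combinations. In this form it
turns any linear condition that holds on \<open>b\<close> into one that holds on \<open>U\<close>.
\<close>

lemma exists_generators:
  assumes "fd_subspace (U :: ('x \<Rightarrow> 'f::field) set)"
  obtains b where "finite b" "b \<subseteq> U" "card b = fdim U"
    "\<And>W. linear_subspace W \<Longrightarrow> b \<subseteq> W \<Longrightarrow> U \<subseteq> W"
proof -
  note lin = fd_subspace_linear[OF assms]
  interpret vectorspace "class_ring :: 'f ring" "fun_space U" by (rule vectorspace_fun_space[OF lin])
  obtain b where b: "finite b" "basis b"
    using finite_basis_exists[OF fin_dim_fun_space[OF assms]] by auto
  have bU: "b \<subseteq> U" "span b = U" using b(2) by (auto simp: basis_def)
  have "U \<subseteq> W" if W: "linear_subspace W" "b \<subseteq> W" for W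
  proof -
    have "linear_subspace (W \<inter> U)" using W(1) lin by (auto simp: linear_subspace_def)
    then have "submodule class_ring (W \<inter> U) (fun_space U)"
      using subspace_fun_space[OF lin] by (auto simp: subspace_def)
    then have "span b \<subseteq> W \<inter> U" using span_is_subset[of b "W \<inter> U"] W(2) bU(1) by blast
    then show ?thesis using bU(2) by auto
  qed
  moreover have "card b = fdim U" using dim_basis[OF b] by (simp add: fdim_def)
  ultimately show thesis using that b(1) bU(1) by blast
qed

definition supported_on :: "'x set \<Rightarrow> ('x \<Rightarrow> 'f::field) set" where
  "supported_on S = {u. \<forall>x. u x \<noteq> 0 \<longrightarrow> x \<in> S}"

lemma fd_subspace_supported_on: "finite S \<Longrightarrow> fd_subspace (supported_on S)"
  unfolding fd_subspace_def
proof (intro conjI)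
  show "linear_subspace (supported_on S)"
    by (auto simp: linear_subspace_def supported_on_def zero_fun_def) (metis add_0)
qed (auto simp: supported_on_def)

lemma fdim_supported_on_le:
  assumes "finite S"
  shows "fdim (supported_on S :: ('x \<Rightarrow> 'f::field) set) \<le> card S"
  using assms
proof (induction S rule: finite_induct)
  case empty
  have "supported_on {} = {0 :: 'x \<Rightarrow> 'f}" by (auto simp: supported_on_def fun_eq_iff)
  then show ?case by (simp add: fdim_zero)
next
  case (insert s S)
  let ?W = "supported_on (insert s S) :: ('x \<Rightarrow> 'f) set"
  let ?w = "\<lambda>x. if x = s then 1 else 0 :: 'f"
  define T where "T = (\<lambda>u :: 'x \<Rightarrow> 'f. scale (u s) ?w)"
  have T: "linear_op T" by (auto simp: T_def linear_op_def fun_eq_iff)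
  have fd: "fd_subspace ?W" by (rule fd_subspace_supported_on) (use insert in auto)
  have w: "finite {x. ?w x \<noteq> 0}" "?w \<noteq> 0" by (auto simp: fun_eq_iff)
  have "fdim (T ` ?W) \<le> fdim (range (\<lambda>a. scale a ?w))"
    by (rule fdim_mono[OF fdim_line(1)[OF w] linear_subspace_image[OF T fd_subspace_linear[OF fd]]])
      (auto simp: T_def)
  moreover have "{u \<in> ?W. T u = 0} = supported_on S"
    using insert.hyps by (auto simp: T_def supported_on_def fun_eq_iff split: if_splits)
  ultimately show ?case
    using rank_nullity_fun[OF fd T] fdim_line(2)[OF w] insert by simp
qed

text \<open>
The kernel of \<open>f\<close> is the orthogonal complement of the image of its adjoint \<open>g\<close>, hence it is cut out
by as many linear equations as that image has basis vectors. So the kernel of \<open>f\<close> has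
codimension at most the rank of \<open>g\<close>, and its codimension is the rank of \<open>f\<close>.
\<close>

lemma rank_le_of_adjoint:
  fixes f :: "('s \<Rightarrow> 'f::field) \<Rightarrow> ('t \<Rightarrow> 'f)" and g :: "('t \<Rightarrow> 'f) \<Rightarrow> ('s \<Rightarrow> 'f)"
  assumes fin: "finite S" "finite T" and lin: "linear_op f" "linear_op g"
    and f: "f ` supported_on S \<subseteq> supported_on T" and g: "g ` supported_on T \<subseteq> supported_on S"
    and adj: "\<And>x y. x \<in> supported_on S \<Longrightarrow> y \<in> supported_on T \<Longrightarrow>
      (\<Sum>t\<in>T. f x t * y t) = (\<Sum>s\<in>S. x s * g y s)"
  shows "fdim (f ` supported_on S) \<le> fdim (g ` supported_on T)"
proof -
  let ?X = "supported_on S" and ?Y = "supported_on T"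
  note fdX = fd_subspace_supported_on[OF fin(1)] and fdY = fd_subspace_supported_on[OF fin(2)]
  have linU: "linear_subspace (g ` ?Y)"
    by (rule linear_subspace_image[OF lin(2) fd_subspace_linear[OF fdY]])
  have fdU: "fd_subspace (g ` ?Y)"
    by (rule fd_subspace_subset[OF fdX linU g])
  obtain b where b: "finite b" "b \<subseteq> g ` ?Y" "card b = fdim (g ` ?Y)"
    "\<And>W. linear_subspace W \<Longrightarrow> b \<subseteq> W \<Longrightarrow> g ` ?Y \<subseteq> W"
    using exists_generators[OF fdU] by blast
  \<comment> \<open>The equations, collected into one linear map whose values are functions on the basis \<open>b\<close>.\<close>
  define h where "h x = (\<lambda>u. if u \<in> b then \<Sum>s\<in>S. x s * u s else 0)" for x
  have linh: "linear_op h"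
    by (auto simp: linear_op_def h_def fun_eq_iff algebra_simps sum.distrib sum_distrib_left)
  have "fdim (h ` ?X) \<le> fdim (supported_on b :: (('s \<Rightarrow> 'f) \<Rightarrow> 'f) set)"
    by (rule fdim_mono[OF fd_subspace_supported_on[OF b(1)]
          linear_subspace_image[OF linh fd_subspace_linear[OF fdX]]])
      (auto simp: h_def supported_on_def split: if_splits)
  also have "\<dots> \<le> fdim (g ` ?Y)" using fdim_supported_on_le[OF b(1)] b(3) by metis
  finally have le: "fdim (h ` ?X) \<le> fdim (g ` ?Y)" .
  have "{x \<in> ?X. h x = 0} = {x \<in> ?X. f x = 0}"
  proof (intro Collect_cong conj_cong refl iffI)
    fix x assume x: "x \<in> ?X" and "h x = 0"
    let ?P = "{u. (\<Sum>s\<in>S. x s * u s) = 0}"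
    have "linear_subspace ?P"
      by (auto simp: linear_subspace_def algebra_simps sum.distrib mult.left_commute sum_distrib_left[symmetric])
    moreover have "b \<subseteq> ?P"
    proof
      fix u assume "u \<in> b"
      then have "h x u = (\<Sum>s\<in>S. x s * u s)" by (simp add: h_def)
      then show "u \<in> ?P" using \<open>h x = 0\<close> by simp
    qed
    ultimately have perp: "g ` ?Y \<subseteq> ?P" by (rule b(4))
    show "f x = 0"
    proof (rule ext)
      fix t
      show "f x t = 0 t"
      proof (cases "t \<in> T")
        case True
        let ?y = "\<lambda>t'. if t' = t then 1 else 0 :: 'f"
        have y: "?y \<in> ?Y" using True by (auto simp: supported_on_def)
        have "f x t = (\<Sum>t'\<in>T. f x t' * ?y t')" using True fin(2) by (simp add: if_distrib cong: if_cong)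
        also have "\<dots> = 0" using adj[OF x y] perp y by auto
        finally show ?thesis by simp
      next
        case False
        then show ?thesis using f x by (auto simp: supported_on_def)
      qed
    qed
  next
    fix x assume x: "x \<in> ?X" and fx: "f x = 0"
    show "h x = 0"
    proof (rule ext)
      fix u
      show "h x u = 0 u"
      proof (cases "u \<in> b")
        case True
        then obtain y where "y \<in> ?Y" "u = g y" using b(2) by auto
        then show ?thesis using adj[OF x, of y] fx by (simp add: h_def)
      qed (simp add: h_def)
    qed
  qed
  then show ?thesis
    using rank_nullity_fun[OF fdX linh] rank_nullity_fun[OF fdX lin(1)] le by simp
qed

lemma rank_adjoint:
  fixes f :: "('s \<Rightarrow> 'f::field) \<Rightarrow> ('t \<Rightarrow> 'f)" and g :: "('t \<Rightarrow> 'f) \<Rightarrow> ('s \<Rightarrow> 'f)"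
  assumes fin: "finite S" "finite T" and lin: "linear_op f" "linear_op g"
    and f: "f ` supported_on S \<subseteq> supported_on T" and g: "g ` supported_on T \<subseteq> supported_on S"
    and adj: "\<And>x y. x \<in> supported_on S \<Longrightarrow> y \<in> supported_on T \<Longrightarrow>
      (\<Sum>t\<in>T. f x t * y t) = (\<Sum>s\<in>S. x s * g y s)"
  shows "fdim (f ` supported_on S) = fdim (g ` supported_on T)"
proof (rule antisym)
  show "fdim (g ` supported_on T) \<le> fdim (f ` supported_on S)"
    by (rule rank_le_of_adjoint[OF fin(2,1) lin(2,1) g f]) (subst (1 2) mult.commute, simp add: adj)
qed (rule rank_le_of_adjoint[OF assms])

lemma fdim_sum_space:
  assumes U: "fd_subspace U" and W: "fd_subspace W"
  defines "P \<equiv> {h. (\<lambda>x. h (Inl x)) \<in> U \<and> (\<lambda>y. h (Inr y)) \<in> W}"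
  shows "fd_subspace P" "fdim P = fdim U + fdim W"
proof -
  obtain S S' where S: "finite S" "\<forall>u\<in>U. \<forall>x. u x \<noteq> 0 \<longrightarrow> x \<in> S"
    and S': "finite S'" "\<forall>u\<in>W. \<forall>x. u x \<noteq> 0 \<longrightarrow> x \<in> S'"
    using U W unfolding fd_subspace_def by blast
  note lU = fd_subspace_linear[OF U] and lW = fd_subspace_linear[OF W]
  let ?p = "\<lambda>h x. h (Inl x)" and ?q = "\<lambda>h y. h (Inr y)"
  have linp: "linear_op ?p" and linq: "linear_op ?q" by (auto simp: linear_op_def fun_eq_iff)
  have z: "(\<lambda>x. 0) \<in> U" "(\<lambda>x. 0) \<in> W"
    using linear_subspaceD(1)[OF lU] linear_subspaceD(1)[OF lW] by (simp_all add: zero_fun_def)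
  have linP: "linear_subspace P"
    unfolding linear_subspace_def
  proof (intro conjI ballI allI)
    show "0 \<in> P" using z by (simp add: P_def)
    fix u assume u: "u \<in> P"
    show "scale a u \<in> P" for a
      using u linear_subspaceD(3)[OF lU, of "?p u" a] linear_subspaceD(3)[OF lW, of "?q u" a] by (simp add: P_def)
    fix v assume "v \<in> P"
    then show "u + v \<in> P"
      using u linear_subspaceD(2)[OF lU, of "?p u" "?p v"] linear_subspaceD(2)[OF lW, of "?q u" "?q v"]
      by (simp add: P_def plus_fun_def)
  qed
  show fdP: "fd_subspace P"
    unfolding fd_subspace_def
  proof (intro conjI linP exI[of _ "Inl ` S \<union> Inr ` S'"] ballI allI impI)
    fix u x assume "u \<in> P" "u x \<noteq> 0"
    then show "x \<in> Inl ` S \<union> Inr ` S'" using S(2) S'(2) by (cases x) (auto simp: P_def)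
  qed (use S S' in auto)
  have imp: "?p ` P = U"
  proof
    show "U \<subseteq> ?p ` P"
    proof
      fix u assume "u \<in> U"
      then have "case_sum u (\<lambda>_. 0) \<in> P" using z by (simp add: P_def)
      then show "u \<in> ?p ` P" by (rule rev_image_eqI) simp
    qed
  qed (auto simp: P_def)
  let ?K = "{h \<in> P. ?p h = 0}"
  have fdK: "fd_subspace ?K"
    by (rule fd_subspace_subset[OF fdP linear_subspace_kernel[OF linp linP]]) auto
  have imq: "?q ` ?K = W"
  proof
    show "W \<subseteq> ?q ` ?K"
    proof
      fix u assume "u \<in> W"
      then have "case_sum (\<lambda>_. 0) u \<in> ?K" using z by (simp add: P_def fun_eq_iff)
      then show "u \<in> ?q ` ?K" by (rule rev_image_eqI) simp
    qed
  qed (auto simp: P_def)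
  have "fdim (?q ` ?K) = fdim ?K"
  proof (rule fdim_inj_image[OF fdK linq])
    fix u assume "u \<in> ?K" "?q u = 0"
    then show "u = 0" by (auto simp: fun_eq_iff split: sum.splits) (metis sum.exhaust)
  qed
  then show "fdim P = fdim U + fdim W" using rank_nullity_fun[OF fdP linp] imp imq by simp
qed

text \<open>
The map \<open>f\<close> induces a surjection of \<open>Z\<close> onto \<open>Z' / D(Y)\<close> with the kernel displayed, so this is
rank-nullity for it, with the quotient eliminated: one computes the dimension of the kernel of
\<open>(z, y) \<mapsto> f z + D y\<close> on the direct sum of \<open>Z\<close> and \<open>Y\<close> in two ways. It serves to compare the
homologies of two complexes without forming the quotient spaces.
\<close>

lemma fdim_quotient_eq:
  assumes Z: "fd_subspace Z" and Y: "fd_subspace Y"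
    and f: "linear_op f" and D: "linear_op D"
    and into: "f ` Z \<subseteq> Z'" "D ` Y \<subseteq> Z'" and Z': "linear_subspace Z'"
    and onto: "\<And>x. x \<in> Z' \<Longrightarrow> \<exists>y\<in>Y. \<exists>z\<in>Z. x - D y = f z"
  shows "fdim Z + fdim (D ` Y) = fdim Z' + fdim {z \<in> Z. f z \<in> D ` Y}"
proof -
  define P where "P = {h. (\<lambda>x. h (Inl x)) \<in> Z \<and> (\<lambda>y. h (Inr y)) \<in> Y}"
  define T where "T h = f (\<lambda>x. h (Inl x)) + D (\<lambda>y. h (Inr y))" for h
  let ?p = "\<lambda>h x. h (Inl x)" and ?q = "\<lambda>h y. h (Inr y)"
  note fdP = fdim_sum_space[OF Z Y, folded P_def]
  note lZ = fd_subspace_linear[OF Z] and lY = fd_subspace_linear[OF Y]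
  have linp: "linear_op ?p" and linq: "linear_op ?q" by (auto simp: linear_op_def fun_eq_iff)
  have linT: "linear_op T"
    unfolding linear_op_def
  proof (intro conjI allI)
    show "T (u + v) = T u + T v" for u v
      using linear_opD(1)[OF f, of "?p u" "?p v"] linear_opD(1)[OF D, of "?q u" "?q v"]
      by (simp add: T_def plus_fun_def algebra_simps)
    show "T (scale a u) = scale a (T u)" for a u
      using linear_opD(2)[OF f, of a "?p u"] linear_opD(2)[OF D, of a "?q u"]
      by (simp add: T_def plus_fun_def algebra_simps)
  qed
  have im: "T ` P = Z'"
  proof
    show "T ` P \<subseteq> Z'" using into linear_subspaceD(2)[OF Z'] by (auto simp: T_def P_def image_subset_iff)
    show "Z' \<subseteq> T ` P"
    proof
      fix x assume "x \<in> Z'"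
      then obtain y z where yz: "y \<in> Y" "z \<in> Z" "x - D y = f z" using onto by blast
      have "x = f z + D y" using yz(3) by (metis diff_add_cancel)
      then have "x = T (case_sum z y)" by (simp add: T_def)
      moreover have "case_sum z y \<in> P" using yz by (simp add: P_def)
      ultimately show "x \<in> T ` P" by blast
    qed
  qed
  let ?K = "{h \<in> P. T h = 0}"
  have linK: "linear_subspace ?K" by (rule linear_subspace_kernel[OF linT fd_subspace_linear[OF fdP(1)]])
  have fdK: "fd_subspace ?K" by (rule fd_subspace_subset[OF fdP(1) linK]) auto
  have imK: "?p ` ?K = {z \<in> Z. f z \<in> D ` Y}"
  proof
    show "?p ` ?K \<subseteq> {z \<in> Z. f z \<in> D ` Y}"
    proof
      fix z assume "z \<in> ?p ` ?K"
      then obtain h where h: "h \<in> P" "T h = 0" "z = ?p h" by auto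
      have "f z = scale (-1) (D (?q h))"
        using h(2) unfolding h(3) T_def by (simp add: fun_eq_iff add_eq_0_iff2)
      then have "f z = D (scale (-1) (?q h))" using linear_opD(2)[OF D] by metis
      moreover have "scale (-1) (?q h) \<in> Y" using h(1) linear_subspaceD(3)[OF lY, of "?q h" "-1"] by (simp add: P_def)
      ultimately show "z \<in> {z \<in> Z. f z \<in> D ` Y}" using h by (auto simp: P_def)
    qed
    show "{z \<in> Z. f z \<in> D ` Y} \<subseteq> ?p ` ?K"
    proof
      fix z assume "z \<in> {z \<in> Z. f z \<in> D ` Y}"
      then obtain y where y: "z \<in> Z" "y \<in> Y" "f z = D y" by auto
      let ?h = "case_sum z (scale (-1) y)"
      have "?h \<in> P" using y linear_subspaceD(3)[OF lY, of y "-1"] by (simp add: P_def)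
      moreover have "T ?h = 0"
        using linear_opD(2)[OF D, of "-1" y] y(3) by (simp add: T_def fun_eq_iff)
      ultimately show "z \<in> ?p ` ?K" by (intro image_eqI[of _ _ ?h]) auto
    qed
  qed
  let ?N = "{h \<in> ?K. ?p h = 0}"
  have fdN: "fd_subspace ?N"
    by (rule fd_subspace_subset[OF fdK linear_subspace_kernel[OF linp linK]]) auto
  have "fdim (?q ` ?N) = fdim ?N"
  proof (rule fdim_inj_image[OF fdN linq])
    fix u assume "u \<in> ?N" "?q u = 0"
    then show "u = 0" by (auto simp: fun_eq_iff split: sum.splits) (metis sum.exhaust)
  qed
  moreover have "?q ` ?N = {y \<in> Y. D y = 0}"
  proof
    show "?q ` ?N \<subseteq> {y \<in> Y. D y = 0}"
      using linear_op_zero[OF f] by (auto simp: P_def T_def)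
    show "{y \<in> Y. D y = 0} \<subseteq> ?q ` ?N"
    proof
      fix y assume y: "y \<in> {y \<in> Y. D y = 0}"
      let ?h = "case_sum 0 y"
      have "?h \<in> ?N"
        using y linear_subspaceD(1)[OF lZ] linear_op_zero[OF f]
        by (simp add: P_def T_def fun_eq_iff zero_fun_def)
      then show "y \<in> ?q ` ?N" by (rule rev_image_eqI) simp
    qed
  qed
  ultimately show ?thesis
    using rank_nullity_fun[OF fdP(1) linT] rank_nullity_fun[OF fdK linp]
      rank_nullity_fun[OF Y D] fdP(2) im imK by simp
qed

section \<open>Signs and boundary operators\<close>

definition vsign :: "'v \<Rightarrow> 'v set \<Rightarrow> 'f::field" where
  "vsign v \<tau> = (-1) ^ card {u\<in>\<tau>. (u, v) \<in> vertex_order}"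

lemma vertex_order_asym: "v \<noteq> w \<Longrightarrow> (v, w) \<in> vertex_order \<longleftrightarrow> (w, v) \<notin> vertex_order"
proof -
  assume "v \<noteq> w"
  moreover have "total_on UNIV (vertex_order :: 'a rel)" "antisym (vertex_order :: 'a rel)"
    using linear_order_vertex_order[where ?'a = 'a] by (simp_all add: linear_order_on_def partial_order_on_def)
  ultimately show ?thesis by (metis UNIV_I antisymD total_on_def)
qed

lemma vsign_square [simp]: "vsign v \<tau> * vsign v \<tau> = 1"
  by (simp add: vsign_def flip: power_mult_distrib)

lemma vsign_square_left [simp]: "vsign v \<tau> * (vsign v \<tau> * a) = a"
  by (simp flip: mult.assoc)

lemma vsign_nonzero [simp]: "vsign v \<tau> \<noteq> 0"
  by (simp add: vsign_def)

lemma vsign_Un: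
  assumes "finite \<sigma>" "finite \<tau>" "\<sigma> \<inter> \<tau> = {}"
  shows "vsign v (\<sigma> \<union> \<tau>) = vsign v \<sigma> * vsign v \<tau>"
proof -
  have "{u\<in>\<sigma>\<union>\<tau>. (u, v) \<in> vertex_order} = {u\<in>\<sigma>. (u, v) \<in> vertex_order} \<union> {u\<in>\<tau>. (u, v) \<in> vertex_order}"
    by auto
  moreover have "card \<dots> = card {u\<in>\<sigma>. (u, v) \<in> vertex_order} + card {u\<in>\<tau>. (u, v) \<in> vertex_order}"
    by (rule card_Un_disjoint) (use assms in auto)
  ultimately show ?thesis by (simp add: vsign_def power_add)
qed

lemma vsign_insert:
  assumes "finite \<tau>" "w \<notin> \<tau>"
  shows "vsign v (insert w \<tau>) = (if (w, v) \<in> vertex_order then - vsign v \<tau> else vsign v \<tau>)"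
proof -
  have "{u. u = w \<and> (u, v) \<in> vertex_order} = (if (w, v) \<in> vertex_order then {w} else {})" by auto
  then have "vsign v {w} = (if (w, v) \<in> vertex_order then -1 else 1 :: 'b)"
    by (simp add: vsign_def)
  then show ?thesis using vsign_Un[of "{w}" \<tau> v, where ?'b = 'b] assms by simp
qed

text \<open>
Exactly one of the two vertices precedes the other, so exactly one of the two longer sets
contributes an additional sign. All identities of the kind \<open>\<partial> \<partial> = 0\<close> rest on this.
\<close>

lemma vsign_swap:
  assumes "finite \<tau>" "v \<notin> \<tau>" "w \<notin> \<tau>" "v \<noteq> w"
  shows "vsign v \<tau> * vsign w (insert v \<tau>) = - (vsign w \<tau> * vsign v (insert w \<tau>))"
  unfolding vsign_insert[OF assms(1,2)] vsign_insert[OF assms(1,3)] using vertex_order_asym[OF assms(4)]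
  by (auto simp: mult.commute)

text \<open>
The induction cancels the terms pairwise. Reindexing would only show that the sum equals its
negative, which is no information in characteristic 2.
\<close>

lemma sum_antisymmetric:
  fixes h :: "'a \<Rightarrow> 'a \<Rightarrow> 'b::ab_group_add"
  assumes "finite A" "\<And>v w. v \<in> A \<Longrightarrow> w \<in> A \<Longrightarrow> v \<noteq> w \<Longrightarrow> h v w = - h w v"
  shows "(\<Sum>v\<in>A. \<Sum>w\<in>A - {v}. h v w) = 0"
  using assms
proof (induction A rule: finite_induct)
  case (insert x A)
  have IH: "(\<Sum>v\<in>A. \<Sum>w\<in>A - {v}. h v w) = 0"
    by (rule insert.IH, rule insert.prems) auto
  have "(\<Sum>w\<in>insert x A - {v}. h v w) = h v x + (\<Sum>w\<in>A - {v}. h v w)" if "v \<in> A" for v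
  proof -
    have "insert x A - {v} = insert x (A - {v})" using that insert.hyps by auto
    then show ?thesis using insert.hyps by simp
  qed
  moreover have "insert x A - {x} = A" using insert.hyps by auto
  ultimately have "(\<Sum>v\<in>insert x A. \<Sum>w\<in>insert x A - {v}. h v w)
      = (\<Sum>w\<in>A. h x w) + (\<Sum>v\<in>A. h v x + (\<Sum>w\<in>A - {v}. h v w))"
    using insert.hyps by simp
  also have "\<dots> = (\<Sum>v\<in>A. h x v + h v x)"
    using IH by (simp add: sum.distrib)
  also have "\<dots> = 0"
  proof (rule sum.neutral, rule ballI)
    fix v assume "v \<in> A"
    then have "h x v = - h v x" using insert.hyps by (intro insert.prems) auto
    then show "h x v + h v x = 0" by simp
  qed
  finally show ?case .
qed simp

text \<open>
Unlike \<open>boundary_map\<close> this boundary is not cut off at the empty face, so it includes the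
augmentation. The vertex set is a parameter, which allows subcomplexes and links to be treated with the
boundary of the ambient complex.
\<close>

definition bdry :: "'v set \<Rightarrow> ('v set \<Rightarrow> 'f::field) \<Rightarrow> 'v set \<Rightarrow> 'f" where
  "bdry V c \<tau> = (\<Sum>v\<in>V - \<tau>. vsign v \<tau> * c (insert v \<tau>))"

text \<open>
The coboundary in the full simplex on all vertices; the one of a subcomplex keeps only its values on
the faces of that subcomplex.
\<close>

definition cobdry :: "('v set \<Rightarrow> 'f::field) \<Rightarrow> 'v set \<Rightarrow> 'f" where
  "cobdry c \<tau> = (\<Sum>v\<in>\<tau>. vsign v (\<tau> - {v}) * c (\<tau> - {v}))"

lemma linear_op_bdry: "linear_op (bdry V)"
  by (auto simp: linear_op_def bdry_def fun_eq_iff algebra_simps sum.distrib sum_distrib_left)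

lemma cobdry_add: "cobdry (\<lambda>\<alpha>. b \<alpha> + c \<alpha>) \<tau> = cobdry b \<tau> + cobdry c \<tau>"
  and cobdry_scale: "cobdry (scale a c) \<tau> = a * cobdry c \<tau>"
  by (auto simp: cobdry_def algebra_simps sum.distrib sum_distrib_left)

lemma bdry_bdry:
  assumes "finite V" "finite \<tau>"
  shows "bdry V (bdry V c) \<tau> = 0"
proof -
  have "bdry V (bdry V c) \<tau> = (\<Sum>v\<in>V - \<tau>. \<Sum>w\<in>(V - \<tau>) - {v}.
      vsign v \<tau> * vsign w (insert v \<tau>) * c (insert v (insert w \<tau>)))"
    unfolding bdry_def sum_distrib_left
    by (intro sum.cong refl) (auto simp: mult.assoc insert_commute)
  also have "\<dots> = 0"
  proof (rule sum_antisymmetric)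
    fix v w assume "v \<in> V - \<tau>" "w \<in> V - \<tau>" "v \<noteq> w"
    then have "vsign v \<tau> * vsign w (insert v \<tau>) = - (vsign w \<tau> * vsign v (insert w \<tau>) :: 'b)"
      by (intro vsign_swap assms) auto
    then show "vsign v \<tau> * vsign w (insert v \<tau>) * c (insert v (insert w \<tau>)) =
      - (vsign w \<tau> * vsign v (insert w \<tau>) * c (insert w (insert v \<tau>)))"
      by (simp add: insert_commute)
  qed (use assms in auto)
  finally show ?thesis .
qed

lemma cobdry_cobdry:
  assumes "finite \<tau>"
  shows "cobdry (cobdry c) \<tau> = 0"
proof -
  have "cobdry (cobdry c) \<tau> = (\<Sum>v\<in>\<tau>. \<Sum>w\<in>\<tau> - {v}.
      vsign v (\<tau> - {v}) * vsign w (\<tau> - {v} - {w}) * c (\<tau> - {v} - {w}))"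
    unfolding cobdry_def sum_distrib_left by (simp add: mult.assoc)
  also have "\<dots> = 0"
  proof (rule sum_antisymmetric)
    fix v w assume vw: "v \<in> \<tau>" "w \<in> \<tau>" "v \<noteq> w"
    have *: "\<tau> - {v} = insert w (\<tau> - {v} - {w})" "\<tau> - {w} = insert v (\<tau> - {v} - {w})"
      "\<tau> - {w} - {v} = \<tau> - {v} - {w}" using vw by auto
    have "vsign v (\<tau> - {v} - {w}) * vsign w (insert v (\<tau> - {v} - {w}))
        = - (vsign w (\<tau> - {v} - {w}) * vsign v (insert w (\<tau> - {v} - {w})) :: 'b)"
      by (intro vsign_swap) (use assms vw in auto)
    then have "vsign v (\<tau> - {v}) * vsign w (\<tau> - {v} - {w}) = - (vsign w (\<tau> - {w}) * vsign v (\<tau> - {w} - {v}) :: 'b)"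
      unfolding *(3) *(1)[symmetric] *(2)[symmetric] by (simp add: mult.commute)
    then show "vsign v (\<tau> - {v}) * vsign w (\<tau> - {v} - {w}) * c (\<tau> - {v} - {w}) =
      - (vsign w (\<tau> - {w}) * vsign v (\<tau> - {w} - {v}) * c (\<tau> - {w} - {v}))"
      unfolding *(3) by simp
  qed (use assms in auto)
  finally show ?thesis .
qed

section \<open>Reduced homology\<close>

text \<open>
Chains, cycles and homology are indexed by the number of vertices of the faces, one more than the
dimension. The augmented chain complex then starts in degree 0, with the empty face.
\<close>

definition faces :: "nat \<Rightarrow> 'v set set \<Rightarrow> 'v set set" where
  "faces n X = {\<alpha>\<in>X. card \<alpha> = n}"

abbreviation rchains :: "nat \<Rightarrow> 'v set set \<Rightarrow> ('v set \<Rightarrow> 'f::field) set" where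
  "rchains n X \<equiv> supported_on (faces n X)"

definition rcycles :: "nat \<Rightarrow> 'v set set \<Rightarrow> ('v set \<Rightarrow> 'f::field) set" where
  "rcycles n X = {c \<in> rchains n X. bdry (vertex_set X) c = 0}"

definition rboundaries :: "nat \<Rightarrow> 'v set set \<Rightarrow> ('v set \<Rightarrow> 'f::field) set" where
  "rboundaries n X = bdry (vertex_set X) ` rchains (Suc n) X"

definition rbetti :: "'f::field itself \<Rightarrow> nat \<Rightarrow> 'v set set \<Rightarrow> int" where
  "rbetti F n X = int (fdim (rcycles n X :: ('v set \<Rightarrow> 'f) set)) - int (fdim (rboundaries n X :: ('v set \<Rightarrow> 'f) set))"

lemma simplicial_complexD:
  assumes "simplicial_complex X"
  shows "finite X" "{} \<in> X" "\<alpha> \<in> X \<Longrightarrow> finite \<alpha>" "\<alpha> \<in> X \<Longrightarrow> \<beta> \<subseteq> \<alpha> \<Longrightarrow> \<beta> \<in> X"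
    "finite (vertex_set X)" "\<alpha> \<in> X \<Longrightarrow> \<alpha> \<subseteq> vertex_set X" "v \<in> vertex_set X \<longleftrightarrow> {v} \<in> X"
  using assms unfolding simplicial_complex_def vertex_set_def by auto

lemma finite_faces: "simplicial_complex X \<Longrightarrow> finite (faces n X)"
  by (simp add: faces_def simplicial_complexD)

lemma rchainsD: "c \<in> rchains n X \<Longrightarrow> c \<alpha> \<noteq> 0 \<Longrightarrow> \<alpha> \<in> X \<and> card \<alpha> = n"
  by (simp add: supported_on_def faces_def)

lemma rchainsI: "(\<And>\<alpha>. c \<alpha> \<noteq> 0 \<Longrightarrow> \<alpha> \<in> X \<and> card \<alpha> = n) \<Longrightarrow> c \<in> rchains n X"
  by (simp add: supported_on_def faces_def)

lemma fd_subspace_rchains: "simplicial_complex X \<Longrightarrow> fd_subspace (rchains n X)"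
  by (intro fd_subspace_supported_on finite_faces)

lemma bdry_nonzeroD:
  assumes "bdry V c \<tau> \<noteq> 0"
  obtains v where "v \<in> V" "v \<notin> \<tau>" "c (insert v \<tau>) \<noteq> 0"
proof -
  have "\<exists>v\<in>V - \<tau>. vsign v \<tau> * c (insert v \<tau>) \<noteq> 0"
    using assms unfolding bdry_def by (meson sum.neutral)
  then show thesis using that by auto
qed

lemma bdry_rchains:
  assumes X: "simplicial_complex X" and c: "c \<in> rchains (Suc n) X"
  shows "bdry V c \<in> rchains n X"
proof (rule rchainsI)
  fix \<tau> assume "bdry V c \<tau> \<noteq> 0"
  then obtain v where v: "v \<notin> \<tau>" "c (insert v \<tau>) \<noteq> 0" by (rule bdry_nonzeroD)
  then have *: "insert v \<tau> \<in> X" "card (insert v \<tau>) = Suc n" using rchainsD[OF c] by auto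
  then have "finite \<tau>" "\<tau> \<in> X" using simplicial_complexD(3)[OF X *(1)] simplicial_complexD(4)[OF X *(1), of \<tau>] by auto
  then show "\<tau> \<in> X \<and> card \<tau> = n" using * v by auto
qed

lemma bdry_vertex_set:
  assumes "simplicial_complex X" "c \<in> rchains n X" "vertex_set X \<subseteq> V" "finite V"
  shows "bdry (vertex_set X) c = bdry V c"
proof (rule ext)
  fix \<tau>
  have "c (insert v \<tau>) = 0" if "v \<notin> vertex_set X" for v
    using that simplicial_complexD(6)[OF assms(1), of "insert v \<tau>"] rchainsD[OF assms(2)] by blast
  then show "bdry (vertex_set X) c \<tau> = bdry V c \<tau>"
    unfolding bdry_def using assms by (intro sum.mono_neutral_left) auto
qed

lemma rboundaries_subset_rcycles:
  assumes X: "simplicial_complex X"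
  shows "rboundaries n X \<subseteq> rcycles n X"
proof
  fix b assume "b \<in> rboundaries n X"
  then obtain c where c: "c \<in> rchains (Suc n) X" "b = bdry (vertex_set X) c" by (auto simp: rboundaries_def)
  have "bdry (vertex_set X) b \<tau> = 0" for \<tau>
  proof (cases "finite \<tau>")
    case True
    then show ?thesis using bdry_bdry simplicial_complexD(5)[OF X] c(2) by blast
  next
    case False
    then have "b (insert v \<tau>) = 0" for v
      using rchainsD[OF bdry_rchains[OF X c(1)], of "vertex_set X" "insert v \<tau>"]
        simplicial_complexD(3)[OF X, of "insert v \<tau>"] c(2) by auto
    then show ?thesis by (simp add: bdry_def)
  qed
  then show "b \<in> rcycles n X"
    using bdry_rchains[OF X c(1)] c(2) by (auto simp: rcycles_def)
qed

lemma fd_subspace_rcycles: "simplicial_complex X \<Longrightarrow> fd_subspace (rcycles n X)"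
  unfolding rcycles_def
  by (rule fd_subspace_subset[OF fd_subspace_rchains linear_subspace_kernel[OF linear_op_bdry
        fd_subspace_linear[OF fd_subspace_rchains]]]) auto

lemma linear_subspace_rboundaries: "simplicial_complex X \<Longrightarrow> linear_subspace (rboundaries n X)"
  unfolding rboundaries_def by (intro linear_subspace_image linear_op_bdry fd_subspace_linear fd_subspace_rchains)

lemma fdim_rcycles:
  assumes "simplicial_complex X"
  shows "fdim (bdry (vertex_set X) ` rchains n X :: ('v set \<Rightarrow> 'f::field) set)
    + fdim (rcycles n X :: ('v set \<Rightarrow> 'f) set) = fdim (rchains n X :: ('v set \<Rightarrow> 'f) set)"
  using rank_nullity_fun[OF fd_subspace_rchains[OF assms] linear_op_bdry] unfolding rcycles_def by blast

lemma rchains_0: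
  assumes "simplicial_complex (X :: 'v set set)"
  shows "fdim (rchains 0 X :: ('v set \<Rightarrow> 'f::field) set) = 1"
    and "rcycles 0 X = (rchains 0 X :: ('v set \<Rightarrow> 'f) set)"
proof -
  have faces: "faces 0 X = {{}}"
    using simplicial_complexD(2,3)[OF assms] by (auto simp: faces_def)
  let ?w = "\<lambda>\<alpha>. if \<alpha> = {} then 1 else 0 :: 'f"
  have "rchains 0 X = range (\<lambda>a. scale a ?w)"
  proof
    show "rchains 0 X \<subseteq> range (\<lambda>a. scale a ?w)"
    proof
      fix c :: "'v set \<Rightarrow> 'f" assume "c \<in> rchains 0 X"
      then have "c = scale (c {}) ?w" by (auto simp: faces supported_on_def fun_eq_iff)
      then show "c \<in> range (\<lambda>a. scale a ?w)" by blast
    qed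
  qed (auto simp: faces supported_on_def split: if_splits)
  moreover have "fdim (range (\<lambda>a. scale a ?w)) = 1"
    by (rule fdim_line) (auto simp: fun_eq_iff)
  ultimately show "fdim (rchains 0 X :: ('v set \<Rightarrow> 'f) set) = 1" by simp
  show "rcycles 0 X = (rchains 0 X :: ('v set \<Rightarrow> 'f) set)"
  proof -
    have "bdry (vertex_set X) c = 0" if c: "c \<in> rchains 0 X" for c :: "'v set \<Rightarrow> 'f"
    proof -
      have "c (insert v \<tau>) = 0" for v \<tau>
        using c by (auto simp: faces supported_on_def)
      then show ?thesis by (simp add: bdry_def fun_eq_iff)
    qed
    then show ?thesis by (auto simp: rcycles_def)
  qed
qed

text \<open>
As soon as there is a vertex, its boundary is a nonzero multiple of the empty face.
\<close>

lemma rbetti_0: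
  assumes X: "simplicial_complex X"
  shows "rbetti F 0 X = (if vertex_set X = {} then 1 else 0)"
proof (cases "vertex_set X = {}")
  case True
  have "bdry (vertex_set X) c = 0" for c :: "'a set \<Rightarrow> 'b" by (simp add: True bdry_def fun_eq_iff)
  then have "rboundaries 0 X = {0 :: 'a set \<Rightarrow> 'b}"
    using linear_subspaceD(1)[OF fd_subspace_linear[OF fd_subspace_rchains[OF X]], of "Suc 0"]
    by (auto simp: rboundaries_def)
  then show ?thesis by (simp add: rbetti_def rchains_0[OF X] fdim_zero True)
next
  case False
  then obtain v where v: "v \<in> vertex_set X" by auto
  then have vX: "{v} \<in> X" using simplicial_complexD(7)[OF X] by auto
  let ?e = "\<lambda>\<alpha>. if \<alpha> = {v} then 1 else 0 :: 'b"
  let ?w = "bdry (vertex_set X) ?e"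
  have e: "?e \<in> rchains (Suc 0) X" using vX by (auto intro!: rchainsI split: if_splits)
  have w: "?w \<in> rchains 0 X" by (rule bdry_rchains[OF X e])
  have "vsign u {} * ?e (insert u {}) = (if u = v then vsign v {} else 0)" for u by auto
  then have "?w {} = vsign v {}"
    unfolding bdry_def using v simplicial_complexD(5)[OF X] by (simp add: sum.delta)
  then have w0: "?w \<noteq> 0" using vsign_nonzero by (auto simp: fun_eq_iff intro!: exI[of _ "{}"])
  have "rchains 0 X \<subseteq> (rboundaries 0 X :: ('a set \<Rightarrow> 'b) set)"
  proof
    fix c :: "'a set \<Rightarrow> 'b" assume "c \<in> rchains 0 X"
    then obtain a where a: "c = scale a ?w"
      using fdim_one_multiple[OF fd_subspace_rchains[OF X] rchains_0(1)[OF X] w w0] by blast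
    have "c = bdry (vertex_set X) (scale a ?e)"
      unfolding a by (rule linear_opD(2)[OF linear_op_bdry, symmetric])
    then show "c \<in> rboundaries 0 X"
      unfolding rboundaries_def using linear_subspaceD(3)[OF fd_subspace_linear[OF fd_subspace_rchains[OF X]] e] by blast
  qed
  then have "rboundaries 0 X = (rcycles 0 X :: ('a set \<Rightarrow> 'b) set)"
    using rboundaries_subset_rcycles[OF X, of 0] unfolding rchains_0(2)[OF X] by (rule antisym[rotated])
  then show ?thesis using False by (simp add: rbetti_def)
qed

lemma rbetti_zeroD:
  fixes F :: "'f::field itself"
  assumes "simplicial_complex X" "rbetti F n X = 0"
  shows "rcycles n X = (rboundaries n X :: ('v set \<Rightarrow> 'f) set)"
proof (rule sym, rule fdim_eq_imp_eq[OF fd_subspace_rcycles[OF assms(1)] linear_subspace_rboundaries[OF assms(1)]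
      rboundaries_subset_rcycles[OF assms(1)]])
  show "fdim (rboundaries n X :: ('v set \<Rightarrow> 'f) set) = fdim (rcycles n X :: ('v set \<Rightarrow> 'f) set)"
    using assms(2) by (simp add: rbetti_def)
qed

lemma boundary_map_eq: "boundary_map X c \<tau> = (if \<tau> = {} then 0 else bdry (vertex_set X) c \<tau>)"
  by (simp add: boundary_map_def bdry_def vsign_def)

lemma chain_space_eq: "chain_space i X = rchains (Suc i) X"
  by (simp add: chain_space_def supported_on_def faces_def)

lemma boundary_map_rchains:
  assumes "c \<in> rchains (Suc (Suc i)) X"
  shows "boundary_map X c = bdry (vertex_set X) c"
proof -
  have "c (insert v {}) = 0" for v using rchainsD[OF assms, of "{v}"] by auto
  then show ?thesis by (auto simp: boundary_map_eq fun_eq_iff bdry_def)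
qed

lemma boundaries_eq: "boundaries i X = rboundaries (Suc i) X"
  unfolding boundaries_def rboundaries_def chain_space_eq by (rule image_cong) (simp_all add: boundary_map_rchains)

lemma cycles_Suc_eq: "cycles (Suc i) X = rcycles (Suc (Suc i)) X"
  unfolding cycles_def rcycles_def chain_space_eq by (auto simp: boundary_map_rchains)

lemma cycles_0_eq:
  assumes "simplicial_complex X"
  shows "cycles 0 X = rchains (Suc 0) X"
proof -
  have "boundary_map X c = 0" if c: "c \<in> rchains (Suc 0) X" for c :: "'a set \<Rightarrow> 'b"
  proof (rule ext)
    fix \<tau>
    show "boundary_map X c \<tau> = 0 \<tau>"
      using rchainsD[OF bdry_rchains[OF assms c, of "vertex_set X"], of \<tau>] simplicial_complexD(3)[OF assms, of \<tau>]
      by (auto simp: boundary_map_eq)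
  qed
  then show ?thesis by (auto simp: cycles_def chain_space_eq)
qed

lemma coset_eq_self_iff:
  assumes "z +o boundaries i X = boundaries i X"
  shows "z \<in> boundaries i X"
  using set_plus_intro2[OF boundaries_zero[of i X], of z] assms by simp

text \<open>
Rank-nullity for the projection of the cycles onto homology, whose kernel is the space of boundaries.
\<close>

lemma betti_eq:
  fixes F :: "'f::field itself"
  assumes X: "simplicial_complex X" and cyc: "fd_subspace (cycles i X :: ('v set \<Rightarrow> 'f) set)"
    and sub: "boundaries i X \<subseteq> (cycles i X :: ('v set \<Rightarrow> 'f) set)"
  shows "betti F i X + fdim (boundaries i X :: ('v set \<Rightarrow> 'f) set) = fdim (cycles i X :: ('v set \<Rightarrow> 'f) set)"
proof -
  let ?B = "boundaries i X :: ('v set \<Rightarrow> 'f) set"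
  let ?Z = "cycles i X :: ('v set \<Rightarrow> 'f) set"
  let ?T = "\<lambda>z. z +o ?B"
  have hom: "?T \<in> LinearCombinations.module_hom class_ring (fun_space ?Z) (homology i X)"
    unfolding LinearCombinations.module_hom_def
    by (simp add: homology_def coset_add coset_scale)
  have "{z \<in> ?Z. ?T z = \<zero>\<^bsub>homology i X\<^esub>} = ?B"
  proof
    show "?B \<subseteq> {z \<in> ?Z. ?T z = \<zero>\<^bsub>homology i X\<^esub>}"
    proof
      fix b assume b: "b \<in> ?B"
      have "b +o ?B = ?B"
      proof
        show "b +o ?B \<subseteq> ?B" using b boundaries_add by (auto simp: elt_set_plus_def)
        show "?B \<subseteq> b +o ?B"
        proof
          fix c assume c: "c \<in> ?B"
          have "c = b + (scale (-1) b + c)" by (simp add: fun_eq_iff)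
          moreover have "scale (-1) b + c \<in> ?B" by (intro boundaries_add boundaries_scale b c)
          ultimately show "c \<in> b +o ?B" unfolding elt_set_plus_def by blast
        qed
      qed
      then show "b \<in> {z \<in> ?Z. ?T z = \<zero>\<^bsub>homology i X\<^esub>}" using b sub by (auto simp: homology_def)
    qed
  qed (auto simp: homology_def dest: coset_eq_self_iff)
  moreover have "?T ` ?Z = carrier (homology i X)" by (simp add: homology_def)
  ultimately show ?thesis
    using linear_map_rank_nullity[OF cyc vectorspace_homology hom] by (simp add: betti_def)
qed

text \<open>
In dimension 0 the unreduced cycles are all the chains on vertices, whereas the reduced ones form the
kernel of the augmentation. The augmentation has rank 1, or rank 0 if there is no vertex at all.
\<close>

lemma rbetti_betti:
  fixes F :: "'f::field itself"
  assumes X: "simplicial_complex X"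
  shows "rbetti F (Suc i) X = int (betti F i X) - (if i = 0 then 1 - rbetti F 0 X else 0)"
proof (cases i)
  case (Suc j)
  have "betti F i X + fdim (rboundaries (Suc i) X :: ('a set \<Rightarrow> 'f) set) = fdim (rcycles (Suc i) X :: ('a set \<Rightarrow> 'f) set)"
    using betti_eq[OF X, of i] fd_subspace_rcycles[OF X] rboundaries_subset_rcycles[OF X]
    unfolding Suc cycles_Suc_eq boundaries_eq by blast
  then show ?thesis unfolding rbetti_def Suc by simp
next
  case 0
  have "rboundaries (Suc 0) X \<subseteq> (rchains (Suc 0) X :: ('a set \<Rightarrow> 'f) set)"
    using rboundaries_subset_rcycles[OF X, of "Suc 0"] by (auto simp: rcycles_def)
  then have "betti F 0 X + fdim (rboundaries (Suc 0) X :: ('a set \<Rightarrow> 'f) set) = fdim (rchains (Suc 0) X :: ('a set \<Rightarrow> 'f) set)"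
    using betti_eq[OF X, of 0] fd_subspace_rchains[OF X]
    unfolding cycles_0_eq[OF X] boundaries_eq by blast
  moreover have "fdim (rboundaries 0 X :: ('a set \<Rightarrow> 'f) set) + fdim (rcycles (Suc 0) X :: ('a set \<Rightarrow> 'f) set)
      = fdim (rchains (Suc 0) X :: ('a set \<Rightarrow> 'f) set)"
    using fdim_rcycles[OF X, of "Suc 0"] by (simp add: rboundaries_def)
  moreover have "fdim (rcycles 0 X :: ('a set \<Rightarrow> 'f) set) = 1" by (simp add: rchains_0[OF X])
  ultimately show ?thesis unfolding rbetti_def 0 by simp
qed

section \<open>Cohomology\<close>

definition coboundary :: "'v set set \<Rightarrow> ('v set \<Rightarrow> 'f::field) \<Rightarrow> 'v set \<Rightarrow> 'f" where
  "coboundary X c \<tau> = (if \<tau> \<in> X then cobdry c \<tau> else 0)"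

lemma linear_op_coboundary: "linear_op (coboundary X)"
  by (auto simp: linear_op_def coboundary_def fun_eq_iff cobdry_scale plus_fun_def cobdry_add)

lemma coboundary_rchains:
  assumes X: "simplicial_complex X" and c: "c \<in> rchains n X"
  shows "coboundary X c \<in> rchains (Suc n) X"
proof (rule rchainsI)
  fix \<tau> assume nz: "coboundary X c \<tau> \<noteq> 0"
  then have \<tau>: "\<tau> \<in> X" "cobdry c \<tau> \<noteq> 0" by (auto simp: coboundary_def split: if_splits)
  have "\<exists>v\<in>\<tau>. vsign v (\<tau> - {v}) * c (\<tau> - {v}) \<noteq> 0"
    using \<tau>(2) unfolding cobdry_def by (meson sum.neutral)
  then obtain v where "v \<in> \<tau>" "c (\<tau> - {v}) \<noteq> 0" by auto
  then have "v \<in> \<tau>" "card (\<tau> - {v}) = n" using rchainsD[OF c] by auto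
  then show "\<tau> \<in> X \<and> card \<tau> = Suc n"
    using \<tau>(1) simplicial_complexD(3)[OF X \<tau>(1)] by (metis card_Suc_Diff1)
qed

text \<open>
Both sides run over all the pairs of a face \<open>\<tau>\<close> with \<open>n + 1\<close> vertices and a vertex \<open>v\<close> of \<open>\<tau>\<close>; on
the left such a pair is recorded as \<open>(\<tau> - {v}, v)\<close>.
\<close>

lemma bdry_coboundary_adjoint:
  assumes X: "simplicial_complex X" and x: "x \<in> rchains (Suc n) X"
  shows "(\<Sum>\<sigma>\<in>faces n X. bdry (vertex_set X) x \<sigma> * y \<sigma>) = (\<Sum>\<tau>\<in>faces (Suc n) X. x \<tau> * coboundary X y \<tau>)"
proof -
  let ?V = "vertex_set X"
  note fin = simplicial_complexD(5)[OF X] finite_faces[OF X] simplicial_complexD(3)[OF X]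
  define A where "A = (SIGMA \<sigma>:faces n X. ?V - \<sigma>)"
  define B where "B = (SIGMA \<tau>:faces (Suc n) X. \<tau>)"
  have finA: "finite A" using fin by (simp add: A_def)
  have "(\<Sum>\<sigma>\<in>faces n X. bdry ?V x \<sigma> * y \<sigma>)
      = (\<Sum>\<sigma>\<in>faces n X. \<Sum>v\<in>?V - \<sigma>. vsign v \<sigma> * x (insert v \<sigma>) * y \<sigma>)"
    by (simp add: bdry_def sum_distrib_right)
  also have "\<dots> = (\<Sum>(\<sigma>, v)\<in>A. vsign v \<sigma> * x (insert v \<sigma>) * y \<sigma>)"
    unfolding A_def by (rule sum.Sigma) (use fin in auto)
  also have "\<dots> = (\<Sum>(\<sigma>, v)\<in>{p\<in>A. insert (snd p) (fst p) \<in> X}. vsign v \<sigma> * x (insert v \<sigma>) * y \<sigma>)"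
    using finA rchainsD[OF x] by (intro sum.mono_neutral_right) auto
  also have "\<dots> = (\<Sum>(\<tau>, v)\<in>B. x \<tau> * (vsign v (\<tau> - {v}) * y (\<tau> - {v})))"
  proof (rule sum.reindex_bij_witness[where i = "\<lambda>(\<tau>, v). (\<tau> - {v}, v)" and j = "\<lambda>(\<sigma>, v). (insert v \<sigma>, v)"])
    fix p assume "p \<in> {p\<in>A. insert (snd p) (fst p) \<in> X}"
    then obtain \<sigma> v where p: "p = (\<sigma>, v)" "\<sigma> \<in> X" "card \<sigma> = n" "v \<in> ?V" "v \<notin> \<sigma>" "insert v \<sigma> \<in> X"
      by (auto simp: A_def faces_def)
    have "finite \<sigma>" using fin(3) p(2) by auto
    then show "(case (case p of (\<sigma>, v) \<Rightarrow> (insert v \<sigma>, v)) of (\<tau>, v) \<Rightarrow> (\<tau> - {v}, v)) = p"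
      "(case p of (\<sigma>, v) \<Rightarrow> (insert v \<sigma>, v)) \<in> B"
      "(case (case p of (\<sigma>, v) \<Rightarrow> (insert v \<sigma>, v)) of (\<tau>, v) \<Rightarrow> x \<tau> * (vsign v (\<tau> - {v}) * y (\<tau> - {v})))
        = (case p of (\<sigma>, v) \<Rightarrow> vsign v \<sigma> * x (insert v \<sigma>) * y \<sigma>)"
      using p by (auto simp: B_def faces_def)
  next
    fix p assume "p \<in> B"
    then obtain \<tau> v where p: "p = (\<tau>, v)" "\<tau> \<in> X" "card \<tau> = Suc n" "v \<in> \<tau>" by (auto simp: B_def faces_def)
    have "v \<in> ?V" "\<tau> - {v} \<in> X" "finite \<tau>"
      using simplicial_complexD(3,6)[OF X p(2)] simplicial_complexD(4)[OF X p(2), of "\<tau> - {v}"] p(4) by auto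
    then show "(case (case p of (\<tau>, v) \<Rightarrow> (\<tau> - {v}, v)) of (\<sigma>, v) \<Rightarrow> (insert v \<sigma>, v)) = p"
      "(case p of (\<tau>, v) \<Rightarrow> (\<tau> - {v}, v)) \<in> {p\<in>A. insert (snd p) (fst p) \<in> X}"
      using p by (auto simp: A_def faces_def insert_absorb)
  qed
  also have "\<dots> = (\<Sum>\<tau>\<in>faces (Suc n) X. \<Sum>v\<in>\<tau>. x \<tau> * (vsign v (\<tau> - {v}) * y (\<tau> - {v})))"
    unfolding B_def by (rule sum.Sigma[symmetric]) (use fin in \<open>auto simp: faces_def\<close>)
  also have "\<dots> = (\<Sum>\<tau>\<in>faces (Suc n) X. x \<tau> * coboundary X y \<tau>)"
    by (intro sum.cong refl) (simp add: coboundary_def cobdry_def faces_def sum_distrib_left)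
  finally show ?thesis .
qed

lemma fdim_coboundary_image:
  assumes X: "simplicial_complex X"
  shows "fdim (coboundary X ` rchains n X :: ('v set \<Rightarrow> 'f::field) set) = fdim (rboundaries n X :: ('v set \<Rightarrow> 'f) set)"
  unfolding rboundaries_def
  by (rule rank_adjoint[symmetric, OF finite_faces[OF X] finite_faces[OF X] linear_op_bdry linear_op_coboundary])
    (use bdry_rchains[OF X] coboundary_rchains[OF X] bdry_coboundary_adjoint[OF X] in auto)

text \<open>
The left-hand side is the dimension of cohomology. The case distinction replaces the coboundaries from
the missing degree \<open>-1\<close>.
\<close>

lemma cohomology_dim:
  fixes F :: "'f::field itself"
  assumes X: "simplicial_complex X"
  shows "int (fdim {c \<in> rchains n X. coboundary X c = (0 :: 'v set \<Rightarrow> 'f)})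
    - int (if n = 0 then 0 else fdim (coboundary X ` rchains (n - 1) X :: ('v set \<Rightarrow> 'f) set)) = rbetti F n X"
proof -
  have 1: "fdim (coboundary X ` rchains n X :: ('v set \<Rightarrow> 'f) set) + fdim {c \<in> rchains n X. coboundary X c = (0 :: 'v set \<Rightarrow> 'f)}
      = fdim (rchains n X :: ('v set \<Rightarrow> 'f) set)"
    by (rule rank_nullity_fun[OF fd_subspace_rchains[OF X] linear_op_coboundary])
  show ?thesis
  proof (cases n)
    case 0
    then show ?thesis using 1 fdim_coboundary_image[OF X, of n, where ?'f = 'f] rchains_0(1)[OF X, where ?'f = 'f] by (simp add: rbetti_def rchains_0[OF X])
  next
    case (Suc m)
    then show ?thesis
      using 1 fdim_coboundary_image[OF X, of n, where ?'f = 'f] fdim_coboundary_image[OF X, of m, where ?'f = 'f]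
        fdim_rcycles[OF X, of n, where ?'f = 'f]
      by (simp add: rbetti_def rboundaries_def)
  qed
qed

section \<open>Links\<close>

lemma simplicial_complex_link:
  assumes X: "simplicial_complex X" and \<alpha>: "\<alpha> \<in> X"
  shows "simplicial_complex (link \<alpha> X)"
  unfolding simplicial_complex_def
proof (intro conjI ballI allI impI)
  have "link \<alpha> X \<subseteq> X" using simplicial_complexD(4)[OF X] by (auto simp: link_def)
  then show "finite (link \<alpha> X)" using simplicial_complexD(1)[OF X] finite_subset by auto
  show "{} \<in> link \<alpha> X" using \<alpha> by (simp add: link_def)
  fix \<beta> assume \<beta>: "\<beta> \<in> link \<alpha> X"
  show "finite \<beta>" using \<beta> simplicial_complexD(3)[OF X, of "\<alpha> \<union> \<beta>"] by (simp add: link_def)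
  fix \<gamma> assume "\<gamma> \<subseteq> \<beta>"
  then show "\<gamma> \<in> link \<alpha> X"
    using \<beta> simplicial_complexD(4)[OF X, of "\<alpha> \<union> \<beta>" "\<alpha> \<union> \<gamma>"] by (auto simp: link_def)
qed

lemma vertex_set_link: "vertex_set (link \<alpha> X) \<subseteq> vertex_set X"
  by (auto simp: vertex_set_def link_def)

lemma simplicial_complex_induced:
  assumes "simplicial_complex X"
  shows "simplicial_complex (induced X A)"
  using assms unfolding simplicial_complex_def induced_def by auto

lemma vertex_set_induced:
  assumes "simplicial_complex X"
  shows "vertex_set (induced X A) = vertex_set X \<inter> A"
  using simplicial_complexD(7)[OF assms] by (auto simp: vertex_set_def induced_def)

text \<open>
The faces containing \<open>\<alpha>\<close> correspond to the faces of the link of \<open>\<alpha>\<close>, but the sign of a vertex in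
\<open>\<alpha> \<union> \<gamma>\<close> differs from its sign in \<open>\<gamma>\<close> by a factor that depends on \<open>\<alpha>\<close>. The product of these factors
over \<open>\<gamma>\<close> is the twist that makes the correspondence commute with the boundaries (\<open>bdry_to_link\<close>).
\<close>

definition link_sign :: "'v set \<Rightarrow> 'v set \<Rightarrow> 'f::field" where
  "link_sign \<alpha> \<gamma> = (\<Prod>w\<in>\<gamma>. vsign w \<alpha>)"

definition to_link :: "'v set \<Rightarrow> ('v set \<Rightarrow> 'f::field) \<Rightarrow> 'v set \<Rightarrow> 'f" where
  "to_link \<alpha> f \<gamma> = (if \<alpha> \<inter> \<gamma> = {} \<and> finite \<gamma> then link_sign \<alpha> \<gamma> * f (\<gamma> \<union> \<alpha>) else 0)"

definition from_link :: "'v set \<Rightarrow> ('v set \<Rightarrow> 'f::field) \<Rightarrow> 'v set \<Rightarrow> 'f" where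
  "from_link \<alpha> h \<tau> = (if \<alpha> \<subseteq> \<tau> then link_sign \<alpha> (\<tau> - \<alpha>) * h (\<tau> - \<alpha>) else 0)"

lemma link_sign_square_left [simp]: "link_sign \<alpha> \<gamma> * (link_sign \<alpha> \<gamma> * a) = (a :: 'f::field)"
proof -
  have "link_sign \<alpha> \<gamma> * link_sign \<alpha> \<gamma> = (1 :: 'f)" by (simp add: link_sign_def flip: prod.distrib)
  then show ?thesis by (simp flip: mult.assoc)
qed

lemma link_sign_nonzero [simp]: "link_sign \<alpha> \<gamma> \<noteq> (0 :: 'f::field)"
  using link_sign_square_left[of \<alpha> \<gamma> "1 :: 'f"] by fastforce

lemma bdry_to_link:
  assumes "finite V" "finite \<alpha>"
  shows "bdry V (to_link \<alpha> f) = to_link \<alpha> (bdry V f)"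
proof (rule ext)
  fix \<gamma>
  show "bdry V (to_link \<alpha> f) \<gamma> = to_link \<alpha> (bdry V f) \<gamma>"
  proof (cases "\<alpha> \<inter> \<gamma> = {} \<and> finite \<gamma>")
    case False
    then have "to_link \<alpha> f (insert v \<gamma>) = 0" for v by (auto simp: to_link_def)
    then have "bdry V (to_link \<alpha> f) \<gamma> = 0" by (simp add: bdry_def)
    then show ?thesis using False by (auto simp: to_link_def)
  next
    case True
    have "bdry V (to_link \<alpha> f) \<gamma> = (\<Sum>v\<in>V - \<gamma> - \<alpha>. vsign v \<gamma> * to_link \<alpha> f (insert v \<gamma>))"
      unfolding bdry_def using assms(1) by (intro sum.mono_neutral_right) (auto simp: to_link_def)
    also have "\<dots> = (\<Sum>v\<in>V - (\<gamma> \<union> \<alpha>). link_sign \<alpha> \<gamma> * (vsign v (\<gamma> \<union> \<alpha>) * f (insert v (\<gamma> \<union> \<alpha>))))"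
    proof (rule sum.cong)
      fix v assume v: "v \<in> V - (\<gamma> \<union> \<alpha>)"
      have "link_sign \<alpha> (insert v \<gamma>) = vsign v \<alpha> * (link_sign \<alpha> \<gamma> :: 'b)"
        using True v by (simp add: link_sign_def)
      moreover have "vsign v (\<gamma> \<union> \<alpha>) = vsign v \<gamma> * (vsign v \<alpha> :: 'b)"
        by (rule vsign_Un) (use True assms in auto)
      ultimately show "vsign v \<gamma> * to_link \<alpha> f (insert v \<gamma>)
          = link_sign \<alpha> \<gamma> * (vsign v (\<gamma> \<union> \<alpha>) * f (insert v (\<gamma> \<union> \<alpha>)))"
        using True v by (simp add: to_link_def)
    qed auto
    also have "\<dots> = to_link \<alpha> (bdry V f) \<gamma>"
      using True by (simp add: to_link_def bdry_def sum_distrib_left)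
    finally show ?thesis .
  qed
qed

lemma to_link_from_link:
  assumes "h \<in> rchains n (link \<alpha> X)" "simplicial_complex X"
  shows "to_link \<alpha> (from_link \<alpha> h) = h"
proof (rule ext)
  fix \<gamma>
  have *: "h \<gamma> \<noteq> 0 \<Longrightarrow> \<alpha> \<inter> \<gamma> = {} \<and> finite \<gamma>"
    using rchainsD[OF assms(1), of \<gamma>] simplicial_complexD(3)[OF assms(2), of "\<alpha> \<union> \<gamma>"] by (auto simp: link_def)
  have "\<alpha> \<inter> \<gamma> = {} \<Longrightarrow> \<gamma> \<union> \<alpha> - \<alpha> = \<gamma>" by auto
  then show "to_link \<alpha> (from_link \<alpha> h) \<gamma> = h \<gamma>"
    using * by (auto simp: to_link_def from_link_def)
qed

lemma to_link_eqD:
  assumes "to_link \<alpha> f = to_link \<alpha> g" "\<alpha> \<subseteq> \<tau>" "finite \<tau>"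
  shows "f \<tau> = g \<tau>"
proof -
  have "\<tau> - \<alpha> \<union> \<alpha> = \<tau>" using assms(2) by auto
  then show ?thesis
    using fun_cong[OF assms(1), of "\<tau> - \<alpha>"] assms(3) by (simp add: to_link_def Diff_Int_distrib)
qed

section \<open>Homology spheres and their fundamental cycles\<close>

text \<open>
The condition includes the empty face, whose link is \<open>L\<close> itself. In the grading by
numbers of vertices a sphere of dimension \<open>d - 1 - |\<alpha>|\<close> has its homology in degree \<open>d - |\<alpha>|\<close>.
\<close>

locale homology_sphere =
  fixes F :: "'f::field itself" and d :: nat and L :: "'v set set"
  assumes complex: "simplicial_complex L"
    and rbetti_link: "\<alpha> \<in> L \<Longrightarrow> rbetti F n (link \<alpha> L) = (if n + card \<alpha> = d then 1 else 0)"
begin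

abbreviation V :: "'v set" where "V \<equiv> vertex_set L"

lemma finite_V: "finite V"
  by (rule simplicial_complexD(5)[OF complex])

lemma finite_face: "\<alpha> \<in> L \<Longrightarrow> finite \<alpha>"
  by (rule simplicial_complexD(3)[OF complex])

lemma face_subset: "\<alpha> \<in> L \<Longrightarrow> \<beta> \<subseteq> \<alpha> \<Longrightarrow> \<beta> \<in> L"
  by (rule simplicial_complexD(4)[OF complex])

text \<open>
The link of a maximal face is \<open>{{}}\<close>, with homology in degree 0, so the face has exactly \<open>d\<close> vertices.
\<close>

lemma facet_above:
  assumes "\<alpha> \<in> L"
  obtains G where "G \<in> L" "\<alpha> \<subseteq> G" "card G = d"
proof -
  obtain G where G: "G \<in> L" "\<alpha> \<subseteq> G" "\<And>\<beta>. \<beta> \<in> L \<Longrightarrow> G \<subseteq> \<beta> \<Longrightarrow> G = \<beta>"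
    using finite_has_maximal2[OF simplicial_complexD(1)[OF complex] assms] by metis
  have "\<beta> = {}" if "\<beta> \<in> link G L" for \<beta>
    using that G(3)[of "G \<union> \<beta>"] by (auto simp: link_def)
  then have "vertex_set (link G L) = {}" by (auto simp: vertex_set_def)
  then have "rbetti F 0 (link G L) = 1" using rbetti_0[OF simplicial_complex_link[OF complex G(1)], of F] by simp
  then have "card G = d" using rbetti_link[OF G(1), of 0] by (simp split: if_splits)
  then show thesis using that G by blast
qed

lemma card_face_le: "\<alpha> \<in> L \<Longrightarrow> card \<alpha> \<le> d"
  by (metis facet_above finite_face card_mono)

text \<open>
The chains on the faces that contain \<open>\<alpha>\<close>, and the cycles among them when all other faces are
ignored. These are the relative chains and cycles of \<open>L\<close> modulo the complement of the open star of \<open>\<alpha>\<close>.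
\<close>

definition star_chains :: "nat \<Rightarrow> 'v set \<Rightarrow> ('v set \<Rightarrow> 'f) set" where
  "star_chains n \<alpha> = supported_on {\<tau>\<in>faces n L. \<alpha> \<subseteq> \<tau>}"

definition star_cycle :: "'v set \<Rightarrow> ('v set \<Rightarrow> 'f) \<Rightarrow> bool" where
  "star_cycle \<alpha> f \<longleftrightarrow> (\<forall>\<tau>. \<alpha> \<subseteq> \<tau> \<longrightarrow> finite \<tau> \<longrightarrow> bdry V f \<tau> = 0)"

lemma star_chainsD:
  "f \<in> star_chains n \<alpha> \<Longrightarrow> f \<tau> \<noteq> 0 \<Longrightarrow> \<tau> \<in> L \<and> card \<tau> = n \<and> \<alpha> \<subseteq> \<tau>"
  by (auto simp: star_chains_def supported_on_def faces_def)

lemma star_chainsI: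
  "(\<And>\<tau>. f \<tau> \<noteq> 0 \<Longrightarrow> \<tau> \<in> L \<and> card \<tau> = n \<and> \<alpha> \<subseteq> \<tau>) \<Longrightarrow> f \<in> star_chains n \<alpha>"
  by (auto simp: star_chains_def supported_on_def faces_def)

lemma to_link_star:
  assumes \<alpha>: "\<alpha> \<in> L" and f: "f \<in> star_chains n \<alpha>" "star_cycle \<alpha> f"
  shows "to_link \<alpha> f \<in> rcycles (n - card \<alpha>) (link \<alpha> L)"
proof -
  have *: "to_link \<alpha> f \<in> rchains (n - card \<alpha>) (link \<alpha> L)"
  proof (rule rchainsI)
    fix \<gamma> assume "to_link \<alpha> f \<gamma> \<noteq> 0"
    then have \<gamma>: "\<alpha> \<inter> \<gamma> = {}" "finite \<gamma>" "f (\<gamma> \<union> \<alpha>) \<noteq> 0" by (auto simp: to_link_def split: if_splits)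
    have "\<alpha> \<union> \<gamma> \<in> L" "card (\<gamma> \<union> \<alpha>) = n" using star_chainsD[OF f(1) \<gamma>(3)] by (auto simp: Un_commute)
    then show "\<gamma> \<in> link \<alpha> L \<and> card \<gamma> = n - card \<alpha>"
      using \<gamma> finite_face[OF \<alpha>] card_Un_disjoint[of \<gamma> \<alpha>] by (simp add: link_def Int_commute)
  qed
  have "bdry V (to_link \<alpha> f) = 0"
    unfolding bdry_to_link[OF finite_V finite_face[OF \<alpha>]]
    using f(2) finite_face[OF \<alpha>] by (auto simp: fun_eq_iff to_link_def star_cycle_def)
  then show ?thesis
    using * bdry_vertex_set[OF simplicial_complex_link[OF complex \<alpha>] * vertex_set_link finite_V]
    by (simp add: rcycles_def)
qed

text \<open>
Outside the top degree the link of \<open>\<alpha>\<close> has no reduced homology; \<open>to_link\<close> carries this over to the star.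
\<close>

lemma star_exact:
  assumes \<alpha>: "\<alpha> \<in> L" and f: "f \<in> star_chains n \<alpha>" "star_cycle \<alpha> f" and n: "n \<noteq> d"
  obtains g where "g \<in> star_chains (Suc n) \<alpha>" "\<And>\<tau>. \<alpha> \<subseteq> \<tau> \<Longrightarrow> finite \<tau> \<Longrightarrow> f \<tau> = bdry V g \<tau>"
proof (cases "card \<alpha> \<le> n")
  case False
  have "f \<tau> = 0" for \<tau>
    using star_chainsD[OF f(1), of \<tau>] False card_mono[OF finite_face, of \<tau> \<alpha>] by auto
  then have "f = 0" by (simp add: fun_eq_iff)
  moreover have "0 \<in> star_chains (Suc n) \<alpha>" by (rule star_chainsI) simp
  ultimately show thesis using that linear_op_zero[OF linear_op_bdry, of V] by metis
next
  case True
  let ?m = "n - card \<alpha>"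
  have "rbetti F ?m (link \<alpha> L) = 0" using rbetti_link[OF \<alpha>, of ?m] n True by auto
  from rbetti_zeroD[OF simplicial_complex_link[OF complex \<alpha>] this] to_link_star[OF \<alpha> f]
  obtain h where h: "h \<in> rchains (Suc ?m) (link \<alpha> L)" "to_link \<alpha> f = bdry (vertex_set (link \<alpha> L)) h"
    by (auto simp: rboundaries_def)
  define g where "g = from_link \<alpha> h"
  have tg: "to_link \<alpha> g = h" unfolding g_def by (rule to_link_from_link[OF h(1) complex])
  have "to_link \<alpha> f = bdry V h"
    using h(2) bdry_vertex_set[OF simplicial_complex_link[OF complex \<alpha>] h(1) vertex_set_link finite_V] by simp
  then have "to_link \<alpha> f = to_link \<alpha> (bdry V g)"
    using bdry_to_link[OF finite_V finite_face[OF \<alpha>], of g] tg by simp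
  then have "f \<tau> = bdry V g \<tau>" if "\<alpha> \<subseteq> \<tau>" "finite \<tau>" for \<tau> using to_link_eqD that by blast
  moreover have "g \<in> star_chains (Suc n) \<alpha>"
  proof (rule star_chainsI)
    fix \<tau> assume "g \<tau> \<noteq> 0"
    then have \<tau>: "\<alpha> \<subseteq> \<tau>" "h (\<tau> - \<alpha>) \<noteq> 0" by (auto simp: g_def from_link_def split: if_splits)
    have "\<tau> - \<alpha> \<in> link \<alpha> L" "card (\<tau> - \<alpha>) = Suc ?m" using rchainsD[OF h(1) \<tau>(2)] by auto
    moreover have "\<alpha> \<union> (\<tau> - \<alpha>) = \<tau>" using \<tau>(1) by auto
    ultimately show "\<tau> \<in> L \<and> card \<tau> = Suc n \<and> \<alpha> \<subseteq> \<tau>"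
      using \<tau>(1) True finite_face[OF \<alpha>] card_Diff_subset[of \<alpha> \<tau>] by (auto simp: link_def)
  qed
  ultimately show thesis using that by blast
qed

text \<open>
In the top degree there are no boundaries, so the cycles form a one-dimensional space.
\<close>

lemma star_top:
  assumes \<alpha>: "\<alpha> \<in> L" and f: "f \<in> star_chains d \<alpha>" "star_cycle \<alpha> f" "f \<noteq> 0"
    and g: "g \<in> star_chains d \<alpha>" "star_cycle \<alpha> g"
  obtains a where "g = scale a f"
proof -
  let ?m = "d - card \<alpha>"
  note cl = simplicial_complex_link[OF complex \<alpha>]
  have "faces (Suc ?m) (link \<alpha> L) = {}"
  proof (rule ccontr)
    assume "faces (Suc ?m) (link \<alpha> L) \<noteq> {}"
    then obtain \<gamma> where \<gamma>: "\<gamma> \<in> link \<alpha> L" "card \<gamma> = Suc ?m" by (auto simp: faces_def)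
    then have "card (\<alpha> \<union> \<gamma>) \<le> d" "card (\<alpha> \<union> \<gamma>) = card \<alpha> + card \<gamma>"
      using card_face_le[of "\<alpha> \<union> \<gamma>"] finite_face[OF \<alpha>] simplicial_complexD(3)[OF cl \<gamma>(1)]
      by (auto simp: link_def card_Un_disjoint)
    then show False using \<gamma>(2) by simp
  qed
  then have "rchains (Suc ?m) (link \<alpha> L) = {0 :: 'v set \<Rightarrow> 'f}"
    by (auto simp: supported_on_def fun_eq_iff)
  then have "rboundaries ?m (link \<alpha> L) = {0 :: 'v set \<Rightarrow> 'f}"
    using linear_op_zero[OF linear_op_bdry] by (auto simp: rboundaries_def)
  then have dim: "fdim (rcycles ?m (link \<alpha> L) :: ('v set \<Rightarrow> 'f) set) = 1"
    using rbetti_link[OF \<alpha>, of ?m] card_face_le[OF \<alpha>] by (simp add: rbetti_def fdim_zero)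
  have ne: "to_link \<alpha> f \<noteq> 0"
  proof
    assume "to_link \<alpha> f = 0"
    then have "to_link \<alpha> f = to_link \<alpha> 0" by (auto simp: to_link_def fun_eq_iff)
    then have "f \<tau> = 0" for \<tau>
      using to_link_eqD[of \<alpha> f 0 \<tau>] star_chainsD[OF f(1), of \<tau>] finite_face by fastforce
    then show False using f(3) by (simp add: fun_eq_iff)
  qed
  obtain a where "to_link \<alpha> g = scale a (to_link \<alpha> f)"
    by (rule fdim_one_multiple[OF fd_subspace_rcycles[OF cl] dim to_link_star[OF \<alpha> f(1,2)] ne to_link_star[OF \<alpha> g]])
  then have eq: "to_link \<alpha> g = to_link \<alpha> (scale a f)" by (auto simp: to_link_def fun_eq_iff)
  have "g \<tau> = a * f \<tau>" for \<tau>
    using to_link_eqD[OF eq, of \<tau>] star_chainsD[OF f(1), of \<tau>] star_chainsD[OF g(1), of \<tau>] finite_face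
    by fastforce
  then show thesis using that[of a] by (simp add: fun_eq_iff)
qed

text \<open>
Downward induction on \<open>|\<alpha>|\<close>. Call a vertex good if \<open>f\<close> is nonzero on some facet through it. By
induction, applied to the restriction of \<open>f\<close> to the star of \<open>\<alpha> \<union> {v}\<close>, for a good \<open>v\<close> the function \<open>f\<close>
vanishes on no facet containing \<open>\<alpha> \<union> {v}\<close>; in particular a vertex that spans a face with
\<open>\<alpha> \<union> {v}\<close> is good as well. If \<open>f\<close> vanished on some facet, its vertices outside \<open>\<alpha>\<close> would
be bad. If there were a good vertex \<open>v\<close> and a bad one \<open>w\<close> in the link
of \<open>\<alpha>\<close>, these would lie in different components of it. The relative cycle \<open>e\<close> that represents \<open>v - w\<close>
then contradicts the homology of the link: it would be a multiple of \<open>f\<close> if the link is a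
0-sphere, and the boundary of some \<open>g\<close> otherwise.
\<close>

lemma star_cycle_nonzero_facet:
  assumes "\<alpha> \<in> L" "f \<in> star_chains d \<alpha>" "star_cycle \<alpha> f" "f \<noteq> 0" "G \<in> L" "card G = d" "\<alpha> \<subseteq> G"
  shows "f G \<noteq> 0"
  using assms
proof (induction "d - card \<alpha>" arbitrary: \<alpha> f G rule: less_induct)
  case less
  note \<alpha> = less.prems(1) and f = less.prems(2-4) and G = less.prems(5-7)
  note fin\<alpha> = finite_face[OF \<alpha>]
  obtain \<tau>0 where \<tau>0: "f \<tau>0 \<noteq> 0" using f(3) by (auto simp: fun_eq_iff)
  then have \<tau>0L: "\<tau>0 \<in> L" "card \<tau>0 = d" "\<alpha> \<subseteq> \<tau>0" using star_chainsD[OF f(1)] by auto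
  show ?case
  proof (cases "card \<alpha> = d")
    case True
    then have "\<tau>0 = \<alpha>" "G = \<alpha>"
      using card_subset_eq[OF finite_face] \<tau>0L G by (metis, metis)
    then show ?thesis using \<tau>0 by simp
  next
    case False
    then have less_d: "card \<alpha> < d" using card_face_le[OF \<alpha>] by simp
    define good where "good v \<longleftrightarrow> (\<exists>\<tau>. v \<in> \<tau> \<and> f \<tau> \<noteq> 0)" for v
    have good: "f H \<noteq> 0" if H: "H \<in> L" "card H = d" "insert v \<alpha> \<subseteq> H" and v: "good v" "v \<notin> \<alpha>" for v H
    proof -
      define r where "r = (\<lambda>\<tau>. if v \<in> \<tau> then f \<tau> else 0)"
      have vL: "insert v \<alpha> \<in> L" using face_subset[OF H(1,3)] .
      have "r \<in> star_chains d (insert v \<alpha>)"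
        by (rule star_chainsI) (use star_chainsD[OF f(1)] in \<open>auto simp: r_def split: if_splits\<close>)
      moreover have "star_cycle (insert v \<alpha>) r"
        unfolding star_cycle_def
      proof (intro allI impI)
        fix \<tau> assume \<tau>: "insert v \<alpha> \<subseteq> \<tau>" "finite \<tau>"
        then have "bdry V r \<tau> = bdry V f \<tau>" by (simp add: bdry_def r_def)
        then show "bdry V r \<tau> = 0" using f(2) \<tau> by (simp add: star_cycle_def)
      qed
      moreover have "r \<noteq> 0" using v(1) by (auto simp: good_def r_def fun_eq_iff)
      ultimately have "r H \<noteq> 0"
        using less.hyps[OF _ vL _ _ _ H] less_d v(2) fin\<alpha> by simp
      then show ?thesis by (auto simp: r_def split: if_splits)
    qed
    show ?thesis
    proof
      assume fG: "f G = 0"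
      have "\<alpha> \<noteq> G" "\<alpha> \<noteq> \<tau>0" using less_d G(2) \<tau>0L(2) by auto
      then obtain w v where w: "w \<in> G" "w \<notin> \<alpha>" and v: "v \<in> \<tau>0" "v \<notin> \<alpha>" using G(3) \<tau>0L(3) by blast
      have gv: "good v" using v \<tau>0 by (auto simp: good_def)
      have bw: "\<not> good w" using good[OF G(1,2) _ _ w(2)] fG w G(3) by auto
      have vw: "v \<noteq> w" using gv bw by auto
      have faces: "insert v \<alpha> \<in> L" "insert w \<alpha> \<in> L"
        using face_subset[OF \<tau>0L(1)] face_subset[OF G(1)] v w \<tau>0L(3) G(3) by auto
      have inV: "v \<in> V" "w \<in> V" using faces simplicial_complexD(6)[OF complex] by auto
      have ne: "insert v \<alpha> \<noteq> insert w \<alpha>" using vw v by auto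
      define e where "e = (\<lambda>\<tau>. if \<tau> = insert v \<alpha> then vsign v \<alpha>
        else if \<tau> = insert w \<alpha> then - vsign w \<alpha> else 0 :: 'f)"
      have e_star: "e \<in> star_chains (Suc (card \<alpha>)) \<alpha>"
        by (rule star_chainsI) (use faces fin\<alpha> v w in \<open>auto simp: e_def split: if_splits\<close>)
      have e_insert: "e (insert u \<alpha>) = (if u = v then vsign v \<alpha> else if u = w then - vsign w \<alpha> else 0)"
        if "u \<notin> \<alpha>" for u
        using that v w vw ne by (auto simp: e_def insert_eq_iff dest: insert_ident)
      have "star_cycle \<alpha> e"
        unfolding star_cycle_def
      proof (intro allI impI)
        fix \<tau> assume \<tau>: "\<alpha> \<subseteq> \<tau>" "finite \<tau>"
        show "bdry V e \<tau> = 0"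
        proof (cases "\<tau> = \<alpha>")
          case True
          have "bdry V e \<alpha> = (\<Sum>u\<in>V - \<alpha>. (if u = v then 1 else 0) + (if u = w then - 1 else 0))"
            unfolding bdry_def by (intro sum.cong refl) (use vw in \<open>auto simp: e_insert\<close>)
          also have "\<dots> = 0"
            using finite_V inV v w by (simp add: sum.distrib)
          finally show ?thesis by (simp add: True)
        next
          case False
          have "e (insert u \<tau>) = 0" if "u \<notin> \<tau>" for u
          proof -
            have "card \<alpha> < card \<tau>" using \<tau> False by (simp add: psubset_card_mono psubsetI)
            then have "card (insert u \<tau>) \<noteq> Suc (card \<alpha>)" using that \<tau> by simp
            then show ?thesis using star_chainsD[OF e_star, of "insert u \<tau>"] by blast
          qed
          then show ?thesis by (simp add: bdry_def)
        qed
      qed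
      note e = e_star this
      show False
      proof (cases "Suc (card \<alpha>) = d")
        case True
        obtain a where "e = scale a f"
          using star_top[OF \<alpha> f, of e] e True by auto
        then have "e (insert w \<alpha>) = a * f (insert w \<alpha>)" by simp
        moreover have "f (insert w \<alpha>) = 0" using bw by (auto simp: good_def)
        ultimately show False using vw w by (simp add: e_insert)
      next
        case False
        then obtain g where g: "g \<in> star_chains (Suc (Suc (card \<alpha>))) \<alpha>"
          "\<And>\<tau>. \<alpha> \<subseteq> \<tau> \<Longrightarrow> finite \<tau> \<Longrightarrow> e \<tau> = bdry V g \<tau>"
          using star_exact[OF \<alpha> e] by blast
        \<comment> \<open>Keep the part of \<open>g\<close> on good vertices only. Its boundary is the good part of \<open>e\<close>, which is
           not a cycle.\<close>
        define g' where "g' = (\<lambda>\<tau>. if \<forall>u\<in>\<tau> - \<alpha>. good u then g \<tau> else 0)"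
        have bdg': "bdry V g' (insert u \<alpha>) = (if good u then e (insert u \<alpha>) else 0)" if u: "u \<notin> \<alpha>" for u
        proof (cases "good u")
          case True
          have "g' (insert y (insert u \<alpha>)) = g (insert y (insert u \<alpha>))" for y
          proof (cases "g (insert y (insert u \<alpha>)) = 0")
            case False
            then have "insert y (insert u \<alpha>) \<in> L" using star_chainsD[OF g(1)] by blast
            then obtain H where H: "H \<in> L" "insert y (insert u \<alpha>) \<subseteq> H" "card H = d" by (rule facet_above)
            then have "f H \<noteq> 0" using good[OF H(1,3) _ True u] by auto
            then have "good y" using H(2) by (auto simp: good_def)
            then show ?thesis using True by (auto simp: g'_def)
          qed (auto simp: g'_def)
          moreover have "e (insert u \<alpha>) = bdry V g (insert u \<alpha>)" by (rule g(2)) (use fin\<alpha> in auto)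
          ultimately show ?thesis using True by (simp add: bdry_def)
        next
          case False
          then have "g' (insert y (insert u \<alpha>)) = 0" for y using u by (auto simp: g'_def)
          then show ?thesis using False by (simp add: bdry_def)
        qed
        have "0 = bdry V (bdry V g') \<alpha>" using bdry_bdry[OF finite_V fin\<alpha>] by metis
        also have "\<dots> = (\<Sum>u\<in>V - \<alpha>. if u = v then 1 else 0)"
          unfolding bdry_def[of V "bdry V g'"]
          by (intro sum.cong refl) (use gv bw vw in \<open>auto simp: bdg' e_insert\<close>)
        also have "\<dots> = 1" using finite_V inV v by simp
        finally show False by simp
      qed
    qed
  qed
qed

text \<open>
Since \<open>z\<close> vanishes on no facet, its restriction to each star is nonzero, and hence spans the
one-dimensional space of top relative cycles there. One cycle thus provides compatible generators for all stars.
\<close>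

lemma fundamental_cycle:
  obtains z where "z \<in> rchains d L" "bdry V z = 0" "\<And>G. G \<in> L \<Longrightarrow> card G = d \<Longrightarrow> z G \<noteq> 0"
    "\<And>\<alpha> f. \<alpha> \<in> L \<Longrightarrow> f \<in> star_chains d \<alpha> \<Longrightarrow> star_cycle \<alpha> f
      \<Longrightarrow> \<exists>a. \<forall>\<tau>. \<alpha> \<subseteq> \<tau> \<longrightarrow> f \<tau> = a * z \<tau>"
proof -
  have e: "{} \<in> L" by (rule simplicial_complexD(2)[OF complex])
  have l: "link {} L = L" by (simp add: link_def)
  have "rcycles d L \<noteq> {0 :: 'v set \<Rightarrow> 'f}"
    using rbetti_link[OF e, of d] by (auto simp: l rbetti_def fdim_zero)
  then obtain z :: "'v set \<Rightarrow> 'f" where z: "z \<in> rcycles d L" "z \<noteq> 0"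
    using linear_subspaceD(1)[OF fd_subspace_linear[OF fd_subspace_rcycles[OF complex]]] by blast
  then have zc: "z \<in> rchains d L" "bdry V z = 0" by (auto simp: rcycles_def)
  have zs: "z \<in> star_chains d {}" by (rule star_chainsI) (use rchainsD[OF zc(1)] in auto)
  have nz: "z G \<noteq> 0" if "G \<in> L" "card G = d" for G
    by (rule star_cycle_nonzero_facet[OF e zs _ z(2) that]) (use zc(2) in \<open>auto simp: star_cycle_def\<close>)
  have "\<exists>a. \<forall>\<tau>. \<alpha> \<subseteq> \<tau> \<longrightarrow> f \<tau> = a * z \<tau>"
    if \<alpha>: "\<alpha> \<in> L" and f: "f \<in> star_chains d \<alpha>" "star_cycle \<alpha> f" for \<alpha> f
  proof -
    define r where "r = (\<lambda>\<tau>. if \<alpha> \<subseteq> \<tau> then z \<tau> else 0)"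
    have r: "r \<in> star_chains d \<alpha>"
      by (rule star_chainsI) (use rchainsD[OF zc(1)] in \<open>auto simp: r_def split: if_splits\<close>)
    have "bdry V r \<tau> = 0" if "\<alpha> \<subseteq> \<tau>" for \<tau>
    proof -
      have "bdry V r \<tau> = bdry V z \<tau>" using that by (auto simp: bdry_def r_def intro!: sum.cong)
      then show ?thesis using zc(2) by simp
    qed
    then have rc: "star_cycle \<alpha> r" by (simp add: star_cycle_def)
    obtain G where "G \<in> L" "\<alpha> \<subseteq> G" "card G = d" using facet_above[OF \<alpha>] .
    then have "r G \<noteq> 0" using nz by (simp add: r_def)
    then have "r \<noteq> 0" by auto
    then obtain a where "f = scale a r" using star_top[OF \<alpha> r rc _ f] by blast
    then show ?thesis by (auto simp: r_def)
  qed
  then show thesis using that[OF zc nz] by blast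
qed

end

section \<open>The double complex\<close>

text \<open>
Here \<open>z\<close> is a fundamental cycle, and the duality to be proved is that between \<open>L[B]\<close> and
\<open>L[V - B]\<close>.
\<close>

locale sphere_split = homology_sphere F d L
  for F :: "'f::field itself" and d and L :: "'v set set" +
  fixes B :: "'v set" and z :: "'v set \<Rightarrow> 'f"
  assumes z_chain: "z \<in> rchains d L"
    and bdry_z: "bdry V z = 0"
    and z_facet: "G \<in> L \<Longrightarrow> card G = d \<Longrightarrow> z G \<noteq> 0"
    and z_spans: "\<alpha> \<in> L \<Longrightarrow> f \<in> star_chains d \<alpha> \<Longrightarrow> star_cycle \<alpha> f
      \<Longrightarrow> \<exists>a. \<forall>\<tau>. \<alpha> \<subseteq> \<tau> \<longrightarrow> f \<tau> = a * z \<tau>"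
begin

text \<open>
The total differential. The sign \<open>(-1) ^ |\<tau>|\<close> makes the two partial differentials anticommute. The
coboundary in the first component could leave the pairs with \<open>\<alpha> \<subseteq> \<tau> \<inter> B\<close> and is cut off there.
\<close>

definition D :: "('v set \<times> 'v set \<Rightarrow> 'f) \<Rightarrow> 'v set \<times> 'v set \<Rightarrow> 'f" where
  "D h = (\<lambda>(\<alpha>, \<tau>). if \<alpha> \<subseteq> \<tau> \<inter> B
     then bdry V (\<lambda>\<sigma>. h (\<alpha>, \<sigma>)) \<tau> + (-1) ^ card \<tau> * cobdry (\<lambda>\<beta>. h (\<beta>, \<tau>)) \<alpha> else 0)"

definition double_chains :: "nat \<Rightarrow> ('v set \<times> 'v set \<Rightarrow> 'f) set" where
  "double_chains n = supported_on {(\<alpha>, \<tau>). \<tau> \<in> L \<and> \<alpha> \<subseteq> \<tau> \<inter> B \<and> card \<tau> = n + card \<alpha>}"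

lemma D_apply: "D h (\<alpha>, \<tau>) = (if \<alpha> \<subseteq> \<tau> \<inter> B
     then bdry V (\<lambda>\<sigma>. h (\<alpha>, \<sigma>)) \<tau> + (-1) ^ card \<tau> * cobdry (\<lambda>\<beta>. h (\<beta>, \<tau>)) \<alpha> else 0)"
  by (simp add: D_def)

lemma double_chainsD: "h \<in> double_chains n \<Longrightarrow> h (\<alpha>, \<tau>) \<noteq> 0 \<Longrightarrow>
    \<tau> \<in> L \<and> \<alpha> \<subseteq> \<tau> \<and> \<alpha> \<subseteq> B \<and> card \<tau> = n + card \<alpha> \<and> finite \<tau> \<and> finite \<alpha> \<and> \<alpha> \<in> L"
  using finite_face[of \<tau>] finite_face[of \<alpha>] face_subset[of \<tau> \<alpha>] by (auto simp: double_chains_def supported_on_def)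

lemma double_chainsI: "(\<And>\<alpha> \<tau>. h (\<alpha>, \<tau>) \<noteq> 0 \<Longrightarrow> \<tau> \<in> L \<and> \<alpha> \<subseteq> \<tau> \<inter> B \<and> card \<tau> = n + card \<alpha>) \<Longrightarrow> h \<in> double_chains n"
  by (auto simp: double_chains_def supported_on_def)

lemma fd_subspace_double_chains: "fd_subspace (double_chains n)"
  unfolding double_chains_def
proof (rule fd_subspace_supported_on, rule finite_subset)
  show "{(\<alpha>, \<tau>). \<tau> \<in> L \<and> \<alpha> \<subseteq> \<tau> \<inter> B \<and> card \<tau> = n + card \<alpha>} \<subseteq> L \<times> L"
    using face_subset by auto
qed (use simplicial_complexD(1)[OF complex] in auto)

lemmas linear_double_chains = fd_subspace_linear[OF fd_subspace_double_chains]

lemma linear_op_D: "linear_op D"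
  unfolding linear_op_def
proof (intro conjI allI ext)
  fix u v :: "'v set \<times> 'v set \<Rightarrow> 'f" and a :: 'f and p :: "'v set \<times> 'v set"
  obtain \<alpha> \<tau> where p: "p = (\<alpha>, \<tau>)" by (cases p)
  show "D (u + v) p = (D u + D v) p"
    using linear_opD(1)[OF linear_op_bdry, of V "\<lambda>\<sigma>. u (\<alpha>, \<sigma>)" "\<lambda>\<sigma>. v (\<alpha>, \<sigma>)"]
    by (simp add: p D_apply cobdry_add plus_fun_def algebra_simps)
  show "D (scale a u) p = scale a (D u) p"
    using linear_opD(2)[OF linear_op_bdry, of V a "\<lambda>\<sigma>. u (\<alpha>, \<sigma>)"]
    by (simp add: p D_apply cobdry_scale algebra_simps)
qed

lemma cobdry_0 [simp]: "cobdry (\<lambda>_. 0) \<tau> = 0"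
  by (simp add: cobdry_def)

lemma cobdry_nonzeroD:
  assumes "cobdry c \<tau> \<noteq> 0"
  obtains v where "v \<in> \<tau>" "c (\<tau> - {v}) \<noteq> 0"
proof -
  have "\<exists>v\<in>\<tau>. vsign v (\<tau> - {v}) * c (\<tau> - {v}) \<noteq> 0"
    using assms unfolding cobdry_def by (meson sum.neutral)
  then show thesis using that by auto
qed

lemma D_nonzeroD:
  assumes h: "h \<in> double_chains n" and nz: "D h (\<alpha>, \<tau>) \<noteq> 0"
  shows "\<tau> \<in> L \<and> \<alpha> \<subseteq> \<tau> \<inter> B \<and> n + card \<alpha> = Suc (card \<tau>)"
proof -
  have sub: "\<alpha> \<subseteq> \<tau> \<inter> B" using nz by (auto simp: D_apply split: if_splits)
  consider "bdry V (\<lambda>\<sigma>. h (\<alpha>, \<sigma>)) \<tau> \<noteq> 0" | "cobdry (\<lambda>\<beta>. h (\<beta>, \<tau>)) \<alpha> \<noteq> 0"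
    using nz sub by (metis (no_types, lifting) D_apply add.right_neutral mult_zero_right)
  then show ?thesis
  proof cases
    case 1
    then obtain v where v: "v \<notin> \<tau>" "h (\<alpha>, insert v \<tau>) \<noteq> 0" by (rule bdry_nonzeroD)
    then show ?thesis using double_chainsD[OF h v(2)] face_subset[of "insert v \<tau>" \<tau>] sub by auto
  next
    case 2
    then obtain v where v: "v \<in> \<alpha>" "h (\<alpha> - {v}, \<tau>) \<noteq> 0" by (rule cobdry_nonzeroD)
    have "finite \<alpha>" using double_chainsD[OF h v(2)] by auto
    then have "card \<alpha> = Suc (card (\<alpha> - {v}))" using v(1) by (metis card_Suc_Diff1)
    then show ?thesis using double_chainsD[OF h v(2)] sub by auto
  qed
qed

lemma D_double_chains: "h \<in> double_chains (Suc n) \<Longrightarrow> D h \<in> double_chains n"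
  by (rule double_chainsI) (use D_nonzeroD in fastforce)

lemma D_D:
  assumes h: "h \<in> double_chains n"
  shows "D (D h) = 0"
proof (rule ext)
  fix p :: "'v set \<times> 'v set"
  obtain \<alpha> \<tau> where p: "p = (\<alpha>, \<tau>)" by (cases p)
  show "D (D h) p = 0 p"
  proof (cases "\<alpha> \<subseteq> \<tau> \<inter> B \<and> finite \<tau>")
    case False
    have "D h (\<beta>, \<sigma>) = 0" if "infinite \<sigma>" for \<beta> \<sigma>
      using D_nonzeroD[OF h, of \<beta> \<sigma>] finite_face[of \<sigma>] that by auto
    then have "D (D h) (\<alpha>, \<tau>) = 0" if "infinite \<tau>" 
      using that by (simp add: D_apply[of "D h"] bdry_def[of V "\<lambda>\<sigma>. D h (\<alpha>, \<sigma>)"] cobdry_def[of "\<lambda>\<beta>. D h (\<beta>, \<tau>)"])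
    then show ?thesis using False by (auto simp: p D_apply)
  next
    case True
    then have fin: "finite \<tau>" "finite \<alpha>" "\<alpha> \<subseteq> \<tau> \<inter> B" using finite_subset by auto
    let ?s = "(-1) ^ card \<tau> :: 'f"
    have "bdry V (\<lambda>\<sigma>. D h (\<alpha>, \<sigma>)) \<tau> = (\<Sum>u\<in>V - \<tau>. vsign u \<tau> * bdry V (\<lambda>\<sigma>. h (\<alpha>, \<sigma>)) (insert u \<tau>)
        - ?s * (vsign u \<tau> * cobdry (\<lambda>\<beta>. h (\<beta>, insert u \<tau>)) \<alpha>))"
      unfolding bdry_def[of V "\<lambda>\<sigma>. D h (\<alpha>, \<sigma>)"]
    proof (intro sum.cong refl)
      fix u assume "u \<in> V - \<tau>"
      then have "\<alpha> \<subseteq> insert u \<tau> \<inter> B" "card (insert u \<tau>) = Suc (card \<tau>)" using fin by auto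
      then show "vsign u \<tau> * D h (\<alpha>, insert u \<tau>) = vsign u \<tau> * bdry V (\<lambda>\<sigma>. h (\<alpha>, \<sigma>)) (insert u \<tau>)
        - ?s * (vsign u \<tau> * cobdry (\<lambda>\<beta>. h (\<beta>, insert u \<tau>)) \<alpha>)"
        by (simp add: D_apply algebra_simps)
    qed
    also have "\<dots> = bdry V (bdry V (\<lambda>\<sigma>. h (\<alpha>, \<sigma>))) \<tau>
        - ?s * (\<Sum>u\<in>V - \<tau>. vsign u \<tau> * cobdry (\<lambda>\<beta>. h (\<beta>, insert u \<tau>)) \<alpha>)"
      by (simp add: sum_subtractf sum_distrib_left bdry_def[of V "bdry V (\<lambda>\<sigma>. h (\<alpha>, \<sigma>))"])
    finally have 1: "bdry V (\<lambda>\<sigma>. D h (\<alpha>, \<sigma>)) \<tau>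
        = - ?s * (\<Sum>u\<in>V - \<tau>. vsign u \<tau> * cobdry (\<lambda>\<beta>. h (\<beta>, insert u \<tau>)) \<alpha>)"
      using bdry_bdry[OF finite_V fin(1)] by simp
    have "cobdry (\<lambda>\<beta>. D h (\<beta>, \<tau>)) \<alpha> = (\<Sum>v\<in>\<alpha>. vsign v (\<alpha> - {v}) * bdry V (\<lambda>\<sigma>. h (\<alpha> - {v}, \<sigma>)) \<tau>
        + ?s * (vsign v (\<alpha> - {v}) * cobdry (\<lambda>\<beta>. h (\<beta>, \<tau>)) (\<alpha> - {v})))"
      unfolding cobdry_def[of "\<lambda>\<beta>. D h (\<beta>, \<tau>)"]
    proof (intro sum.cong refl)
      fix v assume "v \<in> \<alpha>"
      have "\<alpha> - {v} \<subseteq> \<tau> \<inter> B" using fin by auto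
      then show "vsign v (\<alpha> - {v}) * D h (\<alpha> - {v}, \<tau>) = vsign v (\<alpha> - {v}) * bdry V (\<lambda>\<sigma>. h (\<alpha> - {v}, \<sigma>)) \<tau>
        + ?s * (vsign v (\<alpha> - {v}) * cobdry (\<lambda>\<beta>. h (\<beta>, \<tau>)) (\<alpha> - {v}))"
        by (simp add: D_apply algebra_simps)
    qed
    also have "\<dots> = (\<Sum>v\<in>\<alpha>. vsign v (\<alpha> - {v}) * bdry V (\<lambda>\<sigma>. h (\<alpha> - {v}, \<sigma>)) \<tau>)
        + ?s * cobdry (cobdry (\<lambda>\<beta>. h (\<beta>, \<tau>))) \<alpha>"
      by (simp add: sum.distrib sum_distrib_left cobdry_def[of "cobdry (\<lambda>\<beta>. h (\<beta>, \<tau>))"])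
    finally have 2: "cobdry (\<lambda>\<beta>. D h (\<beta>, \<tau>)) \<alpha> = (\<Sum>v\<in>\<alpha>. vsign v (\<alpha> - {v}) * bdry V (\<lambda>\<sigma>. h (\<alpha> - {v}, \<sigma>)) \<tau>)"
      using cobdry_cobdry[OF fin(2)] by simp
    have "(\<Sum>u\<in>V - \<tau>. vsign u \<tau> * cobdry (\<lambda>\<beta>. h (\<beta>, insert u \<tau>)) \<alpha>)
        = (\<Sum>u\<in>V - \<tau>. \<Sum>v\<in>\<alpha>. vsign u \<tau> * (vsign v (\<alpha> - {v}) * h (\<alpha> - {v}, insert u \<tau>)))"
      by (simp add: cobdry_def sum_distrib_left)
    also have "\<dots> = (\<Sum>v\<in>\<alpha>. \<Sum>u\<in>V - \<tau>. vsign u \<tau> * (vsign v (\<alpha> - {v}) * h (\<alpha> - {v}, insert u \<tau>)))"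
      by (rule sum.swap)
    also have "\<dots> = (\<Sum>v\<in>\<alpha>. vsign v (\<alpha> - {v}) * bdry V (\<lambda>\<sigma>. h (\<alpha> - {v}, \<sigma>)) \<tau>)"
      by (simp add: bdry_def sum_distrib_left mult.left_commute)
    finally show ?thesis
      using fin(3) by (simp add: p D_apply[of "D h"] 1 2)
  qed
qed

lemma D_minus: "D (h - k) = D h - D k"
  by (rule linear_op_minus[OF linear_op_D])

section \<open>Exactness of the columns\<close>

text \<open>
The cochain complex of the full simplex on \<open>\<tau> \<inter> B\<close> is contracted by removing a chosen vertex \<open>p \<tau>\<close>.
If \<open>t\<close> is the largest size of a \<open>\<tau>\<close> meeting \<open>B\<close> on which \<open>h\<close> lives, the \<open>\<tau>\<close>-boundary contributes
nothing to \<open>D h\<close> in columns of that size, so there \<open>h\<close> is a cocycle of the column.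
\<close>

lemma column_contraction:
  assumes h: "h \<in> double_chains n" and cyc: "\<And>\<alpha> \<tau>. \<tau> \<inter> B \<noteq> {} \<Longrightarrow> D h (\<alpha>, \<tau>) = 0"
    and van: "\<And>\<alpha> \<tau>. \<tau> \<inter> B \<noteq> {} \<Longrightarrow> t < card \<tau> \<Longrightarrow> h (\<alpha>, \<tau>) = 0"
  obtains y where "y \<in> double_chains (Suc n)"
    "\<And>\<alpha> \<tau>. \<tau> \<inter> B \<noteq> {} \<Longrightarrow> t \<le> card \<tau> \<Longrightarrow> h (\<alpha>, \<tau>) = D y (\<alpha>, \<tau>)"
proof -
  define p where "p \<tau> = (SOME v. v \<in> \<tau> \<inter> B)" for \<tau>
  have p: "p \<tau> \<in> \<tau> \<inter> B" if "\<tau> \<inter> B \<noteq> {}" for \<tau>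
    unfolding p_def using that by (metis ex_in_conv someI_ex)
  let ?s = "(-1) ^ t :: 'f"
  define y where "y = (\<lambda>(\<alpha>, \<tau>). if card \<tau> = t \<and> \<tau> \<inter> B \<noteq> {} \<and> \<alpha> \<subseteq> \<tau> \<inter> B \<and> p \<tau> \<notin> \<alpha>
    then ?s * (vsign (p \<tau>) \<alpha> * h (insert (p \<tau>) \<alpha>, \<tau>)) else 0)"
  have y: "y \<in> double_chains (Suc n)"
  proof (rule double_chainsI)
    fix \<alpha> \<tau> assume "y (\<alpha>, \<tau>) \<noteq> 0"
    then have *: "\<alpha> \<subseteq> \<tau> \<inter> B" "p \<tau> \<notin> \<alpha>" "h (insert (p \<tau>) \<alpha>, \<tau>) \<noteq> 0"
      by (auto simp: y_def split: if_splits)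
    then show "\<tau> \<in> L \<and> \<alpha> \<subseteq> \<tau> \<inter> B \<and> card \<tau> = Suc n + card \<alpha>" using double_chainsD[OF h *(3)] by auto
  qed
  have eq: "h (\<alpha>, \<tau>) = D y (\<alpha>, \<tau>)" if \<tau>: "\<tau> \<inter> B \<noteq> {}" "t \<le> card \<tau>" for \<alpha> \<tau>
  proof (cases "\<tau> \<in> L \<and> \<alpha> \<subseteq> \<tau> \<inter> B")
    case False
    then have "h (\<alpha>, \<tau>) = 0" "D y (\<alpha>, \<tau>) = 0"
      using double_chainsD[OF h, of \<alpha> \<tau>] D_nonzeroD[OF y, of \<alpha> \<tau>] by blast+
    then show ?thesis by simp
  next
    case True
    then have sub: "\<alpha> \<subseteq> \<tau> \<inter> B" and "finite \<tau>" using finite_face by auto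
    then have fin: "finite \<tau>" "finite \<alpha>" using finite_subset[of \<alpha> \<tau>] by auto
    have bd0: "bdry V (\<lambda>\<sigma>. y (\<alpha>, \<sigma>)) \<tau> = 0"
    proof -
      have "y (\<alpha>, insert u \<tau>) = 0" if "u \<notin> \<tau>" for u using that fin \<tau> by (simp add: y_def)
      then show ?thesis by (simp add: bdry_def)
    qed
    show ?thesis
    proof (cases "card \<tau> = t")
      case False
      then have "y (\<beta>, \<tau>) = 0" for \<beta> by (simp add: y_def)
      then have "cobdry (\<lambda>\<beta>. y (\<beta>, \<tau>)) \<alpha> = 0" by (simp add: cobdry_def)
      then have "D y (\<alpha>, \<tau>) = 0" using bd0 by (simp add: D_apply)
      then show ?thesis using van[OF \<tau>(1)] \<tau>(2) False by simp
    next
      case t: True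
      define q where "q = p \<tau>"
      have q: "q \<in> \<tau>" "q \<in> B" using p[OF \<tau>(1)] by (auto simp: q_def)
      have y_\<tau>: "y (\<beta>, \<tau>) = (if q \<notin> \<beta> then ?s * (vsign q \<beta> * h (insert q \<beta>, \<tau>)) else 0)"
        if "\<beta> \<subseteq> \<alpha>" for \<beta> using t \<tau>(1) sub that by (auto simp: y_def q_def)
      have Dy: "D y (\<alpha>, \<tau>) = ?s * cobdry (\<lambda>\<beta>. y (\<beta>, \<tau>)) \<alpha>"
        using bd0 sub t by (simp add: D_apply)
      also have "\<dots> = h (\<alpha>, \<tau>)"
      proof (cases "q \<in> \<alpha>")
        case True
        have "cobdry (\<lambda>\<beta>. y (\<beta>, \<tau>)) \<alpha> = (\<Sum>v\<in>\<alpha>. if v = q then ?s * h (\<alpha>, \<tau>) else 0)"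
          unfolding cobdry_def
        proof (intro sum.cong refl)
          fix v assume v: "v \<in> \<alpha>"
          show "vsign v (\<alpha> - {v}) * y (\<alpha> - {v}, \<tau>) = (if v = q then ?s * h (\<alpha>, \<tau>) else 0)"
            using True by (subst y_\<tau>) (auto simp: insert_absorb mult.left_commute)
        qed
        also have "\<dots> = ?s * h (\<alpha>, \<tau>)" using True fin by simp
        finally show ?thesis by (simp flip: mult.assoc power_mult_distrib)
      next
        case False
        let ?\<alpha>' = "insert q \<alpha>"
        \<comment> \<open>The cocycle condition is read off at \<open>\<alpha> \<union> {q}\<close> and solved for the term at \<open>\<alpha>\<close>.\<close>
        have "bdry V (\<lambda>\<sigma>. h (?\<alpha>', \<sigma>)) \<tau> = 0"
        proof -
          have "h (?\<alpha>', insert u \<tau>) = 0" if "u \<notin> \<tau>" for u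
            using that fin \<tau> t by (intro van) auto
          then show ?thesis by (simp add: bdry_def)
        qed
        moreover have "?\<alpha>' \<subseteq> \<tau> \<inter> B" using q sub by auto
        ultimately have "cobdry (\<lambda>\<beta>. h (\<beta>, \<tau>)) ?\<alpha>' = 0"
          using cyc[OF \<tau>(1), of ?\<alpha>'] by (simp add: D_apply)
        moreover have "cobdry (\<lambda>\<beta>. h (\<beta>, \<tau>)) ?\<alpha>' = vsign q \<alpha> * h (\<alpha>, \<tau>)
            + (\<Sum>v\<in>\<alpha>. vsign v (?\<alpha>' - {v}) * h (?\<alpha>' - {v}, \<tau>))"
          unfolding cobdry_def using False fin by simp
        moreover have "(\<Sum>v\<in>\<alpha>. vsign v (?\<alpha>' - {v}) * h (?\<alpha>' - {v}, \<tau>))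
            = - (vsign q \<alpha> * (?s * cobdry (\<lambda>\<beta>. y (\<beta>, \<tau>)) \<alpha>))"
          unfolding cobdry_def sum_distrib_left sum_negf[symmetric]
        proof (intro sum.cong refl)
          fix v assume v: "v \<in> \<alpha>"
          let ?\<sigma> = "\<alpha> - {v}"
          have vq: "v \<noteq> q" and e: "?\<alpha>' - {v} = insert q ?\<sigma>" "insert v ?\<sigma> = \<alpha>" using v False by auto
          have "vsign q ?\<sigma> * vsign v (insert q ?\<sigma>) = - (vsign v ?\<sigma> * vsign q (insert v ?\<sigma>) :: 'f)"
            by (rule vsign_swap) (use fin False vq in auto)
          then have "vsign q ?\<sigma> * (vsign q ?\<sigma> * vsign v (insert q ?\<sigma>))
              = vsign q ?\<sigma> * - (vsign v ?\<sigma> * vsign q \<alpha> :: 'f)" unfolding e by simp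
          then have sw: "vsign v (insert q ?\<sigma>) = - (vsign q \<alpha> * (vsign q ?\<sigma> * vsign v ?\<sigma>) :: 'f)"
            by (simp add: mult_ac)
          have ys: "y (?\<sigma>, \<tau>) = ?s * (vsign q ?\<sigma> * h (insert q ?\<sigma>, \<tau>))"
            using False by (subst y_\<tau>) auto
          have ss: "?s * (?s * a) = a" for a by (simp flip: mult.assoc power_mult_distrib)
          have rearr: "?s * (vsign v ?\<sigma> * (?s * (vsign q ?\<sigma> * h (insert q ?\<sigma>, \<tau>))))
              = vsign q ?\<sigma> * (vsign v ?\<sigma> * h (insert q ?\<sigma>, \<tau>))"
            unfolding mult.left_commute[of "vsign v ?\<sigma>" ?s] ss by (rule mult.left_commute)
          show "vsign v (?\<alpha>' - {v}) * h (?\<alpha>' - {v}, \<tau>)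
              = - (vsign q \<alpha> * (?s * (vsign v ?\<sigma> * y (?\<sigma>, \<tau>))))"
            unfolding e(1) sw ys rearr by (simp only: mult.assoc mult_minus_left)
        qed
        ultimately have "vsign q \<alpha> * h (\<alpha>, \<tau>) = vsign q \<alpha> * (?s * cobdry (\<lambda>\<beta>. y (\<beta>, \<tau>)) \<alpha>)" by simp
        then show ?thesis by simp
      qed
      finally show ?thesis by simp
    qed
  qed
  show thesis by (rule that[OF y eq])
qed

text \<open>
The columns are cleared one size of \<open>\<tau>\<close> after the other, starting with the largest: the correction
made for size \<open>t\<close> changes no larger column.
\<close>

lemma column_exact:
  assumes h: "h \<in> double_chains n" and cyc: "\<And>\<alpha> \<tau>. \<tau> \<inter> B \<noteq> {} \<Longrightarrow> D h (\<alpha>, \<tau>) = 0"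
  shows "\<exists>y\<in>double_chains (Suc n). \<forall>\<alpha> \<tau>. \<tau> \<inter> B \<noteq> {} \<longrightarrow> (h - D y) (\<alpha>, \<tau>) = 0"
proof -
  have "\<exists>y\<in>double_chains (Suc n). \<forall>\<alpha> \<tau>. \<tau> \<inter> B \<noteq> {} \<longrightarrow> (h - D y) (\<alpha>, \<tau>) = 0"
    if "h \<in> double_chains n" "\<forall>\<alpha> \<tau>. \<tau> \<inter> B \<noteq> {} \<longrightarrow> D h (\<alpha>, \<tau>) = 0"
      "\<forall>\<alpha> \<tau>. \<tau> \<inter> B \<noteq> {} \<longrightarrow> t \<le> card \<tau> \<longrightarrow> h (\<alpha>, \<tau>) = 0" for t h
    using that
  proof (induction t arbitrary: h)
    case 0
    then have "h - D 0 = h" using linear_op_zero[OF linear_op_D] by simp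
    then show ?case using 0 linear_subspaceD(1)[OF linear_double_chains, of "Suc n"] by (metis le0)
  next
    case (Suc t)
    obtain y where y: "y \<in> double_chains (Suc n)"
      "\<And>\<alpha> \<tau>. \<tau> \<inter> B \<noteq> {} \<Longrightarrow> t \<le> card \<tau> \<Longrightarrow> h (\<alpha>, \<tau>) = D y (\<alpha>, \<tau>)"
      using column_contraction[OF Suc.prems(1), of t] Suc.prems by (metis Suc_leI)
    have "h - D y \<in> double_chains n" by (rule linear_subspace_minus[OF linear_double_chains Suc.prems(1) D_double_chains[OF y(1)]])
    moreover have "D (h - D y) = D h" by (simp add: D_minus D_D[OF y(1)])
    moreover have "\<forall>\<alpha> \<tau>. \<tau> \<inter> B \<noteq> {} \<longrightarrow> t \<le> card \<tau> \<longrightarrow> (h - D y) (\<alpha>, \<tau>) = 0" using y(2) by simp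
    ultimately obtain y' where y': "y' \<in> double_chains (Suc n)"
      "\<forall>\<alpha> \<tau>. \<tau> \<inter> B \<noteq> {} \<longrightarrow> (h - D y - D y') (\<alpha>, \<tau>) = 0"
      using Suc.IH[of "h - D y"] Suc.prems(2) by metis
    have "h - D (y + y') = h - D y - D y'"
      by (simp add: linear_opD(1)[OF linear_op_D] fun_eq_iff)
    then show ?case using y' linear_subspaceD(2)[OF linear_double_chains y(1) y'(1)] by metis
  qed
  from this[OF h, of "Suc d"] show ?thesis
    using cyc double_chainsD[OF h] card_face_le by (metis not_less_eq_eq)
qed

section \<open>Exactness of the rows\<close>

text \<open>
The cochains of \<open>L[B]\<close> with \<open>d - n\<close> vertices, for \<open>n \<le> d\<close>. Writing the degree as \<open>|\<alpha>| + n = d\<close> gives the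
zero space for \<open>n > d\<close>, as the truncated difference would not.
\<close>

definition top_cochains :: "nat \<Rightarrow> ('v set \<Rightarrow> 'f) set" where
  "top_cochains n = supported_on {\<alpha>\<in>L. \<alpha> \<subseteq> B \<and> card \<alpha> + n = d}"

text \<open>
The cochain \<open>c\<close> placed in the top degree of the rows, as a multiple of the fundamental cycle; this plays the role
of the cap product with \<open>z\<close>.
\<close>

definition cap :: "('v set \<Rightarrow> 'f) \<Rightarrow> 'v set \<times> 'v set \<Rightarrow> 'f" where
  "cap c = (\<lambda>(\<alpha>, \<tau>). if \<alpha> \<subseteq> \<tau> \<inter> B then c \<alpha> * z \<tau> else 0)"

lemma linear_op_cap: "linear_op cap"
  by (auto simp: linear_op_def cap_def fun_eq_iff algebra_simps)

lemma top_cochainsD: "c \<in> top_cochains n \<Longrightarrow> c \<alpha> \<noteq> 0 \<Longrightarrow> \<alpha> \<in> L \<and> \<alpha> \<subseteq> B \<and> card \<alpha> + n = d"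
  by (auto simp: top_cochains_def supported_on_def)

lemma fd_subspace_top_cochains: "fd_subspace (top_cochains n)"
  unfolding top_cochains_def
  by (rule fd_subspace_supported_on) (use simplicial_complexD(1)[OF complex] in auto)

lemma cap_double_chains: "c \<in> top_cochains n \<Longrightarrow> cap c \<in> double_chains n"
  by (rule double_chainsI) (use top_cochainsD rchainsD[OF z_chain] in \<open>fastforce simp: cap_def split: if_splits\<close>)

lemma D_cap: "D (cap c) = cap (scale ((-1) ^ d) (coboundary (induced L B) c))"
proof (rule ext)
  fix p :: "'v set \<times> 'v set"
  obtain \<alpha> \<tau> where p: "p = (\<alpha>, \<tau>)" by (cases p)
  show "D (cap c) p = cap (scale ((-1) ^ d) (coboundary (induced L B) c)) p"
  proof (cases "\<alpha> \<subseteq> \<tau> \<inter> B")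
    case True
    have "bdry V (\<lambda>\<sigma>. cap c (\<alpha>, \<sigma>)) \<tau> = c \<alpha> * bdry V z \<tau>"
      unfolding bdry_def sum_distrib_left
      by (intro sum.cong refl) (use True in \<open>auto simp: cap_def\<close>)
    then have 1: "bdry V (\<lambda>\<sigma>. cap c (\<alpha>, \<sigma>)) \<tau> = 0" by (simp add: bdry_z)
    have 2: "cobdry (\<lambda>\<beta>. cap c (\<beta>, \<tau>)) \<alpha> = z \<tau> * cobdry c \<alpha>"
      unfolding cobdry_def sum_distrib_left
      by (intro sum.cong refl) (use True in \<open>auto simp: cap_def\<close>)
    have "z \<tau> = 0 \<or> card \<tau> = d \<and> \<alpha> \<in> induced L B"
      using rchainsD[OF z_chain, of \<tau>] face_subset[of \<tau> \<alpha>] True by (auto simp: induced_def)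
    moreover have "D (cap c) (\<alpha>, \<tau>) = (-1) ^ card \<tau> * (z \<tau> * cobdry c \<alpha>)"
      using True by (simp add: D_apply 1 2)
    ultimately show ?thesis using True by (auto simp: p cap_def coboundary_def)
  next
    case False
    then have "D (cap c) (\<alpha>, \<tau>) = 0" by (simp only: D_apply if_False)
    moreover have "cap c' (\<alpha>, \<tau>) = 0" for c' using False by (auto simp: cap_def)
    ultimately show ?thesis by (simp add: p)
  qed
qed

lemma cap_inj:
  assumes "cap c = cap c'" "\<And>\<alpha>. \<not> (\<alpha> \<in> L \<and> \<alpha> \<subseteq> B) \<Longrightarrow> c \<alpha> = c' \<alpha>"
  shows "c = c'"
proof (rule ext)
  fix \<alpha>
  show "c \<alpha> = c' \<alpha>"
  proof (cases "\<alpha> \<in> L \<and> \<alpha> \<subseteq> B")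
    case True
    then obtain G where G: "G \<in> L" "\<alpha> \<subseteq> G" "card G = d" using facet_above by blast
    have "c \<alpha> * z G = c' \<alpha> * z G"
      using fun_cong[OF assms(1), of "(\<alpha>, G)"] True G(2) by (simp add: cap_def)
    then show ?thesis using z_facet[OF G(1,3)] by simp
  qed (use assms(2) in auto)
qed

text \<open>
If \<open>t\<close> is the smallest size of an \<open>\<alpha>\<close> on which \<open>h\<close> lives, the coboundary contributes nothing to
\<open>D h\<close> in the rows of that size, so there \<open>h\<close> is a relative cycle in the star of \<open>\<alpha>\<close>. It is a
boundary outside the top degree and a multiple of \<open>z\<close> in the top degree.
\<close>

lemma row_step:
  assumes h: "h \<in> double_chains n" and cyc: "\<And>\<alpha> \<tau>. card \<tau> \<noteq> d \<Longrightarrow> D h (\<alpha>, \<tau>) = 0"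
    and van: "\<And>\<alpha> \<tau>. card \<alpha> < t \<Longrightarrow> h (\<alpha>, \<tau>) = 0"
  obtains y c where "y \<in> double_chains (Suc n)" "c \<in> top_cochains n"
    "\<And>\<alpha> \<tau>. card \<alpha> \<le> t \<Longrightarrow> h (\<alpha>, \<tau>) = D y (\<alpha>, \<tau>) + cap c (\<alpha>, \<tau>)"
proof -
  have star: "(\<lambda>\<tau>. h (\<alpha>, \<tau>)) \<in> star_chains (n + t) \<alpha>" "star_cycle \<alpha> (\<lambda>\<tau>. h (\<alpha>, \<tau>))"
    if \<alpha>: "\<alpha> \<in> L" "\<alpha> \<subseteq> B" "card \<alpha> = t" for \<alpha>
  proof -
    show *: "(\<lambda>\<tau>. h (\<alpha>, \<tau>)) \<in> star_chains (n + t) \<alpha>"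
      by (rule star_chainsI) (use double_chainsD[OF h] \<alpha>(3) in auto)
    show "star_cycle \<alpha> (\<lambda>\<tau>. h (\<alpha>, \<tau>))"
      unfolding star_cycle_def
    proof (intro allI impI)
      fix \<tau> assume \<tau>: "\<alpha> \<subseteq> \<tau>" "finite \<tau>"
      show "bdry V (\<lambda>\<tau>. h (\<alpha>, \<tau>)) \<tau> = 0"
      proof (cases "card \<tau> = d")
        case True
        have "h (\<alpha>, insert u \<tau>) = 0" if "u \<notin> \<tau>" for u
          using double_chainsD[OF h, of \<alpha> "insert u \<tau>"] card_face_le[of "insert u \<tau>"] that \<tau> True by auto
        then show ?thesis by (simp add: bdry_def)
      next
        case False
        have "h (\<alpha> - {v}, \<tau>) = 0" if "v \<in> \<alpha>" for v
          by (rule van) (use that \<alpha> finite_face[OF \<alpha>(1)] in \<open>metis card_Diff1_less\<close>)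
        then have "cobdry (\<lambda>\<beta>. h (\<beta>, \<tau>)) \<alpha> = 0" by (simp add: cobdry_def)
        then show ?thesis using cyc[OF False, of \<alpha>] \<tau> \<alpha>(2) by (auto simp: D_apply split: if_splits)
      qed
    qed
  qed
  show thesis
  proof (cases "n + t = d")
    case True
    have "\<exists>a. \<forall>\<tau>. \<alpha> \<subseteq> \<tau> \<longrightarrow> h (\<alpha>, \<tau>) = a * z \<tau>" if "\<alpha> \<in> L" "\<alpha> \<subseteq> B" "card \<alpha> = t" for \<alpha>
      using z_spans[OF that(1)] star[OF that] True by auto
    then obtain a where a: "\<And>\<alpha> \<tau>. \<alpha> \<in> L \<Longrightarrow> \<alpha> \<subseteq> B \<Longrightarrow> card \<alpha> = t \<Longrightarrow> \<alpha> \<subseteq> \<tau> \<Longrightarrow> h (\<alpha>, \<tau>) = a \<alpha> * z \<tau>"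
      by metis
    define c where "c = (\<lambda>\<alpha>. if \<alpha> \<in> L \<and> \<alpha> \<subseteq> B \<and> card \<alpha> = t then a \<alpha> else 0)"
    have c: "c \<in> top_cochains n" using True by (auto simp: top_cochains_def supported_on_def c_def)
    have "h (\<alpha>, \<tau>) = D 0 (\<alpha>, \<tau>) + cap c (\<alpha>, \<tau>)" if "card \<alpha> \<le> t" for \<alpha> \<tau>
    proof (cases "\<tau> \<in> L \<and> \<alpha> \<subseteq> \<tau> \<inter> B \<and> card \<alpha> = t")
      case True
      then show ?thesis
        using a[of \<alpha> \<tau>] face_subset[of \<tau> \<alpha>] linear_op_zero[OF linear_op_D] by (auto simp: cap_def c_def)
    next
      case False
      then have "h (\<alpha>, \<tau>) = 0" using van[of \<alpha> \<tau>] double_chainsD[OF h, of \<alpha> \<tau>] that by fastforce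
      moreover have "cap c (\<alpha>, \<tau>) = 0"
        using False rchainsD[OF z_chain, of \<tau>] by (auto simp: cap_def c_def)
      ultimately show ?thesis using linear_op_zero[OF linear_op_D] by simp
    qed
    then show thesis using that[OF linear_subspaceD(1)[OF linear_double_chains] c] by blast
  next
    case False
    have "\<exists>g\<in>star_chains (Suc (n + t)) \<alpha>. \<forall>\<tau>. \<alpha> \<subseteq> \<tau> \<longrightarrow> finite \<tau> \<longrightarrow> h (\<alpha>, \<tau>) = bdry V g \<tau>"
      if \<alpha>: "\<alpha> \<in> L" "\<alpha> \<subseteq> B" "card \<alpha> = t" for \<alpha>
      by (rule star_exact[OF \<alpha>(1) star[OF \<alpha>] False]) blast
    then obtain g where g: "\<And>\<alpha>. \<alpha> \<in> L \<Longrightarrow> \<alpha> \<subseteq> B \<Longrightarrow> card \<alpha> = t \<Longrightarrow> g \<alpha> \<in> star_chains (Suc (n + t)) \<alpha>"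
      "\<And>\<alpha> \<tau>. \<alpha> \<in> L \<Longrightarrow> \<alpha> \<subseteq> B \<Longrightarrow> card \<alpha> = t \<Longrightarrow> \<alpha> \<subseteq> \<tau> \<Longrightarrow> finite \<tau> \<Longrightarrow> h (\<alpha>, \<tau>) = bdry V (g \<alpha>) \<tau>"
      by metis
    define y where "y = (\<lambda>(\<alpha>, \<tau>). if \<alpha> \<in> L \<and> \<alpha> \<subseteq> B \<and> card \<alpha> = t then g \<alpha> \<tau> else 0)"
    have y: "y \<in> double_chains (Suc n)"
    proof (rule double_chainsI)
      fix \<alpha> \<tau> assume "y (\<alpha>, \<tau>) \<noteq> 0"
      then have *: "\<alpha> \<in> L" "\<alpha> \<subseteq> B" "card \<alpha> = t" "g \<alpha> \<tau> \<noteq> 0" by (auto simp: y_def split: if_splits)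
      then show "\<tau> \<in> L \<and> \<alpha> \<subseteq> \<tau> \<inter> B \<and> card \<tau> = Suc n + card \<alpha>"
        using star_chainsD[OF g(1)[OF *(1-3)] *(4)] by auto
    qed
    have zero: "cap 0 = 0" by (rule linear_op_zero[OF linear_op_cap])
    have "h (\<alpha>, \<tau>) = D y (\<alpha>, \<tau>) + cap 0 (\<alpha>, \<tau>)" if le: "card \<alpha> \<le> t" for \<alpha> \<tau>
    proof (cases "\<tau> \<in> L \<and> \<alpha> \<subseteq> \<tau> \<inter> B")
      case False
      then have "h (\<alpha>, \<tau>) = 0" "D y (\<alpha>, \<tau>) = 0"
        using double_chainsD[OF h, of \<alpha> \<tau>] D_nonzeroD[OF y, of \<alpha> \<tau>] by blast+
      then show ?thesis by (simp add: zero)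
    next
      case True
      then have "\<tau> \<in> L" and sub: "\<alpha> \<subseteq> B" "\<alpha> \<subseteq> \<tau>" by auto
      then have "\<alpha> \<in> L" by (metis face_subset)
      then have \<alpha>: "\<alpha> \<in> L" "\<alpha> \<subseteq> B" "\<alpha> \<subseteq> \<tau>" "finite \<alpha>" "finite \<tau>"
        using sub finite_face \<open>\<tau> \<in> L\<close> by auto
      have "y (\<alpha> - {v}, \<tau>) = 0" if "v \<in> \<alpha>" for v
        using card_Diff1_less[OF \<alpha>(4) that] le by (simp add: y_def)
      then have "cobdry (\<lambda>\<beta>. y (\<beta>, \<tau>)) \<alpha> = 0" by (simp add: cobdry_def)
      then have Dy: "D y (\<alpha>, \<tau>) = bdry V (\<lambda>\<sigma>. y (\<alpha>, \<sigma>)) \<tau>" using \<alpha> by (simp add: D_apply)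
      show ?thesis
      proof (cases "card \<alpha> = t")
        case t: True
        then have "(\<lambda>\<sigma>. y (\<alpha>, \<sigma>)) = g \<alpha>" using \<alpha> by (simp add: y_def)
        then show ?thesis using g(2)[OF \<alpha>(1,2) t \<alpha>(3,5)] Dy by (simp add: zero)
      next
        case False
        then have "(\<lambda>\<sigma>. y (\<alpha>, \<sigma>)) = 0" by (simp add: y_def fun_eq_iff)
        then have "D y (\<alpha>, \<tau>) = 0" using Dy linear_op_zero[OF linear_op_bdry, of V] by (metis zero_fun_apply)
        then show ?thesis using van[of \<alpha> \<tau>] le False by (simp add: zero)
      qed
    qed
    moreover have "0 \<in> top_cochains n" by (simp add: top_cochains_def supported_on_def)
    ultimately show thesis using that y by blast
  qed
qed

text \<open>
The rows are cleared one size of \<open>\<alpha>\<close> after the other, starting with the smallest: the correction for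
size \<open>t\<close> changes no row of smaller size. No \<open>\<alpha>\<close> has more than \<open>d\<close> vertices.
\<close>

lemma row_exact:
  assumes h: "h \<in> double_chains n" and cyc: "\<And>\<alpha> \<tau>. card \<tau> \<noteq> d \<Longrightarrow> D h (\<alpha>, \<tau>) = 0"
  shows "\<exists>y\<in>double_chains (Suc n). \<exists>c\<in>top_cochains n. h - D y = cap c"
proof -
  have "\<exists>y\<in>double_chains (Suc n). \<exists>c\<in>top_cochains n. h - D y = cap c"
    if "h \<in> double_chains n" "\<forall>\<alpha> \<tau>. card \<tau> \<noteq> d \<longrightarrow> D h (\<alpha>, \<tau>) = 0"
      "\<forall>\<alpha> \<tau>. card \<alpha> < t \<longrightarrow> h (\<alpha>, \<tau>) = 0" "t + k = Suc d" for t k h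
    using that
  proof (induction k arbitrary: t h)
    case 0
    have "h p = 0" for p
    proof (cases p)
      case (Pair \<alpha> \<tau>)
      then show ?thesis
        using double_chainsD[OF 0(1), of \<alpha> \<tau>] card_face_le[of \<alpha>] 0(3,4) by (metis Nat.add_0_right less_Suc_eq_le)
    qed
    then have "h - D 0 = cap 0"
      using linear_op_zero[OF linear_op_cap] linear_op_zero[OF linear_op_D] by (simp add: fun_eq_iff)
    then show ?case
      using linear_subspaceD(1)[OF linear_double_chains]
        linear_subspaceD(1)[OF fd_subspace_linear[OF fd_subspace_top_cochains]] by blast
  next
    case (Suc k)
    obtain y c where yc: "y \<in> double_chains (Suc n)" "c \<in> top_cochains n"
      "\<And>\<alpha> \<tau>. card \<alpha> \<le> t \<Longrightarrow> h (\<alpha>, \<tau>) = D y (\<alpha>, \<tau>) + cap c (\<alpha>, \<tau>)"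
      using row_step[OF Suc.prems(1), of t] Suc.prems(2,3) by metis
    let ?h = "h - D y - cap c"
    have "?h \<in> double_chains n"
      by (intro linear_subspace_minus[OF linear_double_chains] Suc.prems D_double_chains yc cap_double_chains)
    moreover have "D ?h (\<alpha>, \<tau>) = 0" if "card \<tau> \<noteq> d" for \<alpha> \<tau>
    proof -
      have "z \<tau> = 0" using rchainsD[OF z_chain, of \<tau>] that by auto
      then have "cap c' (\<alpha>, \<tau>) = 0" for c' by (simp add: cap_def)
      then show ?thesis using Suc.prems(2) that by (simp add: D_minus D_D[OF yc(1)] D_cap)
    qed
    moreover have "?h (\<alpha>, \<tau>) = 0" if "card \<alpha> < Suc t" for \<alpha> \<tau>
      using yc(3)[of \<alpha> \<tau>] that by simp
    ultimately obtain y' c' where yc': "y' \<in> double_chains (Suc n)" "c' \<in> top_cochains n" "?h - D y' = cap c'"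
      using Suc.IH[of ?h "Suc t"] Suc.prems(4) by (metis add_Suc_shift)
    have "h - D (y + y') = cap (c + c')"
      using yc'(3) linear_opD(1)[OF linear_op_D, of y y'] linear_opD(1)[OF linear_op_cap, of c c']
      by (auto simp: fun_eq_iff algebra_simps)
    then show ?case
      using linear_subspaceD(2)[OF linear_double_chains yc(1) yc'(1)]
        linear_subspaceD(2)[OF fd_subspace_linear[OF fd_subspace_top_cochains] yc(2) yc'(2)] by blast
  qed
  from this[OF h, of 0 "Suc d"] cyc show ?thesis by simp
qed

section \<open>Alexander duality\<close>

abbreviation double_cycles :: "nat \<Rightarrow> ('v set \<times> 'v set \<Rightarrow> 'f) set" where
  "double_cycles n \<equiv> {h \<in> double_chains n. D h = 0}"

lemma linear_double_cycles: "linear_subspace (double_cycles n)"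
  by (rule linear_subspace_kernel[OF linear_op_D linear_double_chains])

lemma D_double_cycles: "D ` double_chains (Suc n) \<subseteq> double_cycles n"
  using D_double_chains D_D by auto

text \<open>
The inclusion of the chains of \<open>L[V - B]\<close> into the double complex.
\<close>

definition column0 :: "('v set \<Rightarrow> 'f) \<Rightarrow> 'v set \<times> 'v set \<Rightarrow> 'f" where
  "column0 c = (\<lambda>(\<alpha>, \<tau>). if \<alpha> = {} then c \<tau> else 0)"

lemma linear_op_column0: "linear_op column0"
  by (auto simp: linear_op_def column0_def fun_eq_iff)

lemma column0_inj: "column0 c = column0 c' \<Longrightarrow> c = c'"
proof (rule ext)
  fix \<tau>
  assume "column0 c = column0 c'"
  then have "column0 c ({}, \<tau>) = column0 c' ({}, \<tau>)" by simp
  then show "c \<tau> = c' \<tau>" by (simp add: column0_def)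
qed

text \<open>
The cycles are hit because \<open>column_exact\<close> moves each of them into the pairs \<open>({}, \<tau>)\<close> with
\<open>\<tau> \<inter> B = {}\<close>. Applied one degree higher, to an element whose differential lies in that subcomplex, it also
shows that no new boundaries arise there.
\<close>

lemma column_comparison:
  defines "A \<equiv> induced L (V - B)"
  shows "int (fdim (double_cycles n)) - int (fdim (D ` double_chains (Suc n))) = rbetti F n A"
proof -
  have A: "simplicial_complex A" unfolding A_def by (rule simplicial_complex_induced[OF complex])
  have VA: "vertex_set A \<subseteq> V" unfolding A_def using vertex_set_induced[OF complex] by auto
  have in_A: "\<tau> \<in> A \<longleftrightarrow> \<tau> \<in> L \<and> \<tau> \<inter> B = {}" for \<tau>
    using simplicial_complexD(6)[OF complex] by (auto simp: A_def induced_def)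
  have bdA: "bdry (vertex_set A) c = bdry V c" if "c \<in> rchains m A" for m and c :: "'v set \<Rightarrow> 'f"
    by (rule bdry_vertex_set[OF A that VA finite_V])
  have tot0: "column0 c \<in> double_chains m" if "c \<in> rchains m A" for m c
    by (rule double_chainsI) (use rchainsD[OF that] in_A in \<open>auto simp: column0_def split: if_splits\<close>)
  have D0: "D (column0 c) = column0 (bdry V c)" if c: "c \<in> rchains m A" for m c
  proof (rule ext)
    fix p :: "'v set \<times> 'v set"
    obtain \<alpha> \<tau> where p: "p = (\<alpha>, \<tau>)" by (cases p)
    show "D (column0 c) p = column0 (bdry V c) p"
    proof (cases "\<alpha> = {}")
      case True
      then show ?thesis by (simp add: p D_apply column0_def cobdry_def bdry_def)
    next
      case False
      have "c \<tau> = 0" if "\<alpha> \<subseteq> \<tau> \<inter> B" using rchainsD[OF c, of \<tau>] in_A[of \<tau>] False that by blast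
      then show ?thesis using False by (auto simp: p D_apply column0_def cobdry_def bdry_def)
    qed
  qed
  have from_double_chains: "\<exists>c\<in>rchains m A. h = column0 c"
    if h: "h \<in> double_chains m" "\<forall>\<alpha> \<tau>. \<tau> \<inter> B \<noteq> {} \<longrightarrow> h (\<alpha>, \<tau>) = 0" for m h
  proof
    let ?c = "\<lambda>\<tau>. h ({}, \<tau>)"
    show "?c \<in> rchains m A"
      by (rule rchainsI) (use double_chainsD[OF h(1)] h(2) in_A in force)
    show "h = column0 ?c"
    proof (rule ext)
      fix p :: "'v set \<times> 'v set"
      obtain \<alpha> \<tau> where p: "p = (\<alpha>, \<tau>)" by (cases p)
      have "h (\<alpha>, \<tau>) = 0" if "\<alpha> \<noteq> {}"
        using double_chainsD[OF h(1), of \<alpha> \<tau>] h(2) that by blast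
      then show "h p = column0 ?c p" by (auto simp: p column0_def)
    qed
  qed
  have van0: "column0 c (\<alpha>, \<tau>) = 0" if "c \<in> rchains m A" "\<tau> \<inter> B \<noteq> {}" for m c \<alpha> \<tau>
    using rchainsD[OF that(1), of \<tau>] that(2) in_A by (auto simp: column0_def)
  have "fdim (rcycles n A :: ('v set \<Rightarrow> 'f) set) + fdim (D ` double_chains (Suc n))
      = fdim (double_cycles n) + fdim {c \<in> rcycles n A. column0 c \<in> D ` double_chains (Suc n)}"
  proof (rule fdim_quotient_eq[OF fd_subspace_rcycles[OF A] fd_subspace_double_chains linear_op_column0 linear_op_D _
        D_double_cycles linear_double_cycles])
    show "column0 ` rcycles n A \<subseteq> double_cycles n"
    proof
      fix h assume "h \<in> column0 ` rcycles n A"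
      then obtain c where c: "c \<in> rchains n A" "bdry V c = 0" "h = column0 c" by (auto simp: rcycles_def bdA)
      then show "h \<in> double_cycles n" using tot0 D0[OF c(1)] linear_op_zero[OF linear_op_column0] by auto
    qed
    fix h assume h: "h \<in> double_cycles n"
    then have "\<exists>y\<in>double_chains (Suc n). \<forall>\<alpha> \<tau>. \<tau> \<inter> B \<noteq> {} \<longrightarrow> (h - D y) (\<alpha>, \<tau>) = 0"
      by (intro column_exact) auto
    then obtain y where y: "y \<in> double_chains (Suc n)" "\<forall>\<alpha> \<tau>. \<tau> \<inter> B \<noteq> {} \<longrightarrow> (h - D y) (\<alpha>, \<tau>) = 0"
      by blast
    have "h - D y \<in> double_chains n" using h y(1) linear_subspace_minus[OF linear_double_chains] D_double_chains by auto
    from from_double_chains[OF this y(2)] obtain c where c: "c \<in> rchains n A" "h - D y = column0 c" by blast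
    have "column0 (bdry V c) = column0 0"
      using D0[OF c(1)] h linear_op_zero[OF linear_op_column0]
      by (simp add: c(2)[symmetric] D_minus D_D[OF y(1)])
    then have "bdry V c = 0" by (rule column0_inj)
    then show "\<exists>y\<in>double_chains (Suc n). \<exists>c\<in>rcycles n A. h - D y = column0 c"
      using y(1) c bdA[OF c(1)] unfolding rcycles_def by (metis (mono_tags, lifting) mem_Collect_eq)
  qed
  moreover have "{c \<in> rcycles n A. column0 c \<in> D ` double_chains (Suc n)} = rboundaries n A"
  proof
    show "rboundaries n A \<subseteq> {c \<in> rcycles n A. column0 c \<in> D ` double_chains (Suc n)}"
    proof
      fix b :: "'v set \<Rightarrow> 'f" assume b: "b \<in> rboundaries n A"
      then obtain c where c: "c \<in> rchains (Suc n) A" "b = bdry V c" by (auto simp: rboundaries_def bdA)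
      have "column0 b = D (column0 c)" using D0[OF c(1)] c(2) by simp
      then show "b \<in> {c \<in> rcycles n A. column0 c \<in> D ` double_chains (Suc n)}"
        using b rboundaries_subset_rcycles[OF A] tot0[OF c(1)] by auto
    qed
    show "{c \<in> rcycles n A. column0 c \<in> D ` double_chains (Suc n)} \<subseteq> rboundaries n A"
    proof
      fix b assume "b \<in> {c \<in> rcycles n A. column0 c \<in> D ` double_chains (Suc n)}"
      then obtain y where b: "b \<in> rchains n A" and y: "y \<in> double_chains (Suc n)" "column0 b = D y"
        by (auto simp: rcycles_def)
      have "D y (\<alpha>, \<tau>) = 0" if "\<tau> \<inter> B \<noteq> {}" for \<alpha> \<tau>
        unfolding y(2)[symmetric] by (rule van0[OF b that])
      from column_exact[OF y(1) this]
      obtain x where x: "x \<in> double_chains (Suc (Suc n))" "\<forall>\<alpha> \<tau>. \<tau> \<inter> B \<noteq> {} \<longrightarrow> (y - D x) (\<alpha>, \<tau>) = 0"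
        by blast
      have "y - D x \<in> double_chains (Suc n)" by (rule linear_subspace_minus[OF linear_double_chains y(1) D_double_chains[OF x(1)]])
      from from_double_chains[OF this x(2)] obtain c where c: "c \<in> rchains (Suc n) A" "y - D x = column0 c" by blast
      have "column0 (bdry V c) = column0 b"
        using D0[OF c(1)] y(2) by (simp add: c(2)[symmetric] D_minus D_D[OF x(1)])
      then have "bdry V c = b" by (rule column0_inj)
      then show "b \<in> rboundaries n A" using c(1) bdA by (auto simp: rboundaries_def)
    qed
  qed
  ultimately show ?thesis by (simp add: rbetti_def)
qed

text \<open>
The same argument with \<open>row_exact\<close> and the subcomplex of the functions \<open>cap c\<close>.
\<close>

lemma row_comparison:
  assumes n: "n \<le> d"
  shows "int (fdim (double_cycles n)) - int (fdim (D ` double_chains (Suc n))) = rbetti F (d - n) (induced L B)"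
proof -
  let ?C = "induced L B" and ?s = "(-1) ^ d :: 'f"
  have C: "simplicial_complex ?C" by (rule simplicial_complex_induced[OF complex])
  have top: "top_cochains n = rchains (d - n) ?C"
    using n by (auto simp: top_cochains_def faces_def induced_def supported_on_def)
  have ss: "?s * (?s * a) = a" for a by (simp flip: mult.assoc power_mult_distrib)
  have coboundary_out: "coboundary ?C c \<alpha> = 0" if "\<not> (\<alpha> \<in> L \<and> \<alpha> \<subseteq> B)" for c \<alpha>
    using that by (auto simp: coboundary_def induced_def)
  define Z where "Z = {c \<in> top_cochains n. coboundary ?C c = 0}"
  have fdZ: "fd_subspace Z"
    unfolding Z_def
    by (rule fd_subspace_subset[OF fd_subspace_top_cochains linear_subspace_kernel[OF linear_op_coboundary
          fd_subspace_linear[OF fd_subspace_top_cochains]]]) auto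
  have "fdim Z + fdim (D ` double_chains (Suc n)) = fdim (double_cycles n) + fdim {c \<in> Z. cap c \<in> D ` double_chains (Suc n)}"
  proof (rule fdim_quotient_eq[OF fdZ fd_subspace_double_chains linear_op_cap linear_op_D _
        D_double_cycles linear_double_cycles])
    show "cap ` Z \<subseteq> double_cycles n"
    proof
      fix h assume "h \<in> cap ` Z"
      then obtain c where c: "c \<in> top_cochains n" "coboundary ?C c = 0" "h = cap c" by (auto simp: Z_def)
      have "D h = 0" by (simp add: c(2,3) D_cap) (simp add: cap_def fun_eq_iff)
      then show "h \<in> double_cycles n" using cap_double_chains[OF c(1)] c(3) by simp
    qed
    fix h assume h: "h \<in> double_cycles n"
    then have "\<exists>y\<in>double_chains (Suc n). \<exists>c\<in>top_cochains n. h - D y = cap c"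
      by (intro row_exact) auto
    then obtain y c where yc: "y \<in> double_chains (Suc n)" "c \<in> top_cochains n" "h - D y = cap c" by blast
    have "cap (scale ?s (coboundary ?C c)) = 0"
      using h by (simp add: D_cap[symmetric] yc(3)[symmetric] D_minus D_D[OF yc(1)])
    then have "scale ?s (coboundary ?C c) = 0"
      by (intro cap_inj) (use coboundary_out linear_op_zero[OF linear_op_cap] in auto)
    then have "coboundary ?C c = 0" by (simp add: fun_eq_iff)
    then show "\<exists>y\<in>double_chains (Suc n). \<exists>c\<in>Z. h - D y = cap c" using yc by (auto simp: Z_def)
  qed
  moreover have "{c \<in> Z. cap c \<in> D ` double_chains (Suc n)} = coboundary ?C ` top_cochains (Suc n)"
  proof
    show "{c \<in> Z. cap c \<in> D ` double_chains (Suc n)} \<subseteq> coboundary ?C ` top_cochains (Suc n)"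
    proof
      fix c assume "c \<in> {c \<in> Z. cap c \<in> D ` double_chains (Suc n)}"
      then obtain y where c: "c \<in> top_cochains n" and y: "y \<in> double_chains (Suc n)" "cap c = D y"
        by (auto simp: Z_def)
      have "D y (\<alpha>, \<tau>) = 0" if "card \<tau> \<noteq> d" for \<alpha> \<tau>
      proof -
        have "z \<tau> = 0" using rchainsD[OF z_chain, of \<tau>] that by auto
        then show ?thesis by (simp add: y(2)[symmetric] cap_def)
      qed
      from row_exact[OF y(1) this]
      obtain x e where xe: "x \<in> double_chains (Suc (Suc n))" "e \<in> top_cochains (Suc n)" "y - D x = cap e" by blast
      have "cap c = cap (scale ?s (coboundary ?C e))"
        by (simp add: D_cap[symmetric] xe(3)[symmetric] D_minus D_D[OF xe(1)] y(2))
      then have "c = scale ?s (coboundary ?C e)"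
      proof (rule cap_inj)
        fix \<alpha> assume "\<not> (\<alpha> \<in> L \<and> \<alpha> \<subseteq> B)"
        then show "c \<alpha> = ?s * coboundary ?C e \<alpha>" using coboundary_out[of \<alpha> e] top_cochainsD[OF c, of \<alpha>] by auto
      qed
      also have "\<dots> = coboundary ?C (scale ?s e)" by (rule linear_opD(2)[OF linear_op_coboundary, symmetric])
      finally show "c \<in> coboundary ?C ` top_cochains (Suc n)"
        using linear_subspaceD(3)[OF fd_subspace_linear[OF fd_subspace_top_cochains] xe(2)] by blast
    qed
    show "coboundary ?C ` top_cochains (Suc n) \<subseteq> {c \<in> Z. cap c \<in> D ` double_chains (Suc n)}"
    proof
      fix c assume "c \<in> coboundary ?C ` top_cochains (Suc n)"
      then obtain e where e: "e \<in> top_cochains (Suc n)" "c = coboundary ?C e" by auto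
      have "c \<in> top_cochains n"
      proof (cases "n = d")
        case True
        then have "e = 0" using top_cochainsD[OF e(1)] by (auto simp: fun_eq_iff)
        then have "c = 0" using e(2) linear_op_zero[OF linear_op_coboundary] by metis
        then show ?thesis by (simp add: top_cochains_def supported_on_def)
      next
        case False
        then have "e \<in> rchains (d - Suc n) ?C" "d - n = Suc (d - Suc n)"
          using e(1) n by (auto simp: top_cochains_def faces_def induced_def supported_on_def)
        then show ?thesis using coboundary_rchains[OF C] by (simp add: top e(2))
      qed
      moreover have "coboundary ?C c \<alpha> = 0" for \<alpha>
      proof (cases "\<alpha> \<in> ?C")
        case True
        have "coboundary ?C c \<alpha> = cobdry (cobdry e) \<alpha>"
        proof -
          have "\<alpha> - {v} \<in> ?C" for v using simplicial_complexD(4)[OF C True] by auto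
          then show ?thesis using True by (simp add: coboundary_def e(2) cobdry_def)
        qed
        then show ?thesis using cobdry_cobdry[OF simplicial_complexD(3)[OF C True]] by simp
      qed (simp add: coboundary_def)
      ultimately have "c \<in> Z" by (simp add: Z_def fun_eq_iff)
      moreover have "cap c = D (cap (scale ?s e))"
        using linear_opD(2)[OF linear_op_coboundary, of ?C ?s e] by (simp add: D_cap e(2) ss)
      moreover have "cap (scale ?s e) \<in> double_chains (Suc n)"
        by (rule cap_double_chains) (rule linear_subspaceD(3)[OF fd_subspace_linear[OF fd_subspace_top_cochains] e(1)])
      ultimately show "c \<in> {c \<in> Z. cap c \<in> D ` double_chains (Suc n)}" by blast
    qed
  qed
  moreover have "fdim (coboundary ?C ` top_cochains (Suc n))
      = (if d - n = 0 then 0 else fdim (coboundary ?C ` rchains (d - n - 1) ?C :: ('v set \<Rightarrow> 'f) set))"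
  proof (cases "n = d")
    case True
    then have "top_cochains (Suc n) = {0}" by (auto simp: top_cochains_def supported_on_def fun_eq_iff)
    then have "coboundary ?C ` top_cochains (Suc n) = {0}"
      using linear_op_zero[OF linear_op_coboundary, of ?C] by simp
    then show ?thesis using True by (simp add: fdim_zero)
  next
    case False
    then have "top_cochains (Suc n) = rchains (d - n - 1) ?C"
      using n by (auto simp: top_cochains_def faces_def induced_def supported_on_def)
    then show ?thesis using False n by simp
  qed
  moreover have "Z = {c \<in> rchains (d - n) ?C. coboundary ?C c = 0}" by (simp add: Z_def top)
  ultimately show ?thesis using cohomology_dim[OF C, of "d - n" F] by simp
qed

end

text \<open>
Both sides are the dimension of the homology of the double complex in degree \<open>n\<close>.
\<close>

theorem (in homology_sphere) alexander_duality:
  assumes "n \<le> d"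
  shows "rbetti F n (induced L (V - B)) = rbetti F (d - n) (induced L B)"
proof -
  obtain z where z: "z \<in> rchains d L" "bdry V z = 0" "\<And>G. G \<in> L \<Longrightarrow> card G = d \<Longrightarrow> z G \<noteq> 0"
    "\<And>\<alpha> f. \<alpha> \<in> L \<Longrightarrow> f \<in> star_chains d \<alpha> \<Longrightarrow> star_cycle \<alpha> f
      \<Longrightarrow> \<exists>a. \<forall>\<tau>. \<alpha> \<subseteq> \<tau> \<longrightarrow> f \<tau> = a * z \<tau>"
    using fundamental_cycle by blast
  interpret sphere_split F d L B z
    by unfold_locales (use z in auto)
  show ?thesis using column_comparison row_comparison[OF assms] by simp
qed

section \<open>Symmetry of the mu-vector\<close>

lemma rbetti_nonneg:
  fixes F :: "'f::field itself"
  assumes "simplicial_complex (X :: 'v set set)"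
  shows "0 \<le> rbetti F n X"
proof -
  have "fdim (rboundaries n X :: ('v set \<Rightarrow> 'f) set) \<le> fdim (rcycles n X :: ('v set \<Rightarrow> 'f) set)"
    by (rule fdim_mono[OF fd_subspace_rcycles linear_subspace_rboundaries rboundaries_subset_rcycles]) (fact assms)+
  then show ?thesis by (simp add: rbetti_def)
qed

text \<open>
The Betti numbers of a sphere are given in unreduced form. In low degrees they determine the reduced ones
only together with the information whether there is a vertex; if there is none, all chains in degree 1
vanish, and if \<open>m = 0\<close> a vertex would make the reduced dimension in degree 1 negative.
\<close>

lemma rbetti_sphere:
  assumes X: "simplicial_complex X" and sph: "has_homology_of_sphere F (int m - 1) X"
  shows "rbetti F n X = (if n = m then 1 else 0)"
proof -
  have b: "int (betti F i X) = (if i = 0 \<and> 0 < m then 1 else 0) + (if Suc i = m then 1 else 0)" for i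
    using sph unfolding has_homology_of_sphere_def by auto
  have rh1: "rbetti F (Suc 0) X = int (betti F 0 X) - 1 + rbetti F 0 X" using rbetti_betti[OF X, of F 0] by simp
  have empty: "vertex_set X = {} \<longleftrightarrow> m = 0"
  proof
    assume e: "vertex_set X = {}"
    then have "faces (Suc 0) X = {}"
      using simplicial_complexD(6)[OF X] by (fastforce simp: faces_def)
    then have "rcycles (Suc 0) X = {0 :: 'a set \<Rightarrow> 'b}"
      using linear_op_zero[OF linear_op_bdry] by (auto simp: rcycles_def supported_on_def fun_eq_iff bdry_def)
    then have "rbetti F (Suc 0) X \<le> 0" by (simp add: rbetti_def fdim_zero)
    then show "m = 0" using rh1 b[of 0] rbetti_0[OF X, of F] e by (auto split: if_splits)
  next
    assume "m = 0"
    then have "rbetti F (Suc 0) X = rbetti F 0 X - 1" using rh1 b[of 0] by simp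
    then show "vertex_set X = {}" using rbetti_nonneg[OF X, of F "Suc 0"] rbetti_0[OF X, of F] by (auto split: if_splits)
  qed
  show ?thesis
  proof (cases n)
    case 0
    then show ?thesis using rbetti_0[OF X, of F] empty by simp
  next
    case (Suc i)
    then show ?thesis using rbetti_betti[OF X, of F i] b[of i] rbetti_0[OF X, of F] empty by auto
  qed
qed

text \<open>
A link in the link of \<open>x\<close> is a link in \<open>M\<close>. Purity bounds \<open>|\<alpha>|\<close> by \<open>d\<close>, so that the degree \<open>d - |\<alpha>|\<close>
of its homology is a natural number.
\<close>

lemma homology_sphere_link:
  fixes F :: "'f::field itself"
  assumes M: "closed_homology_manifold F d M" and x: "x \<in> vertex_set M"
  shows "homology_sphere F d (link {x} M)"
proof
  have cM: "simplicial_complex M" and pure: "pure_of_dim d M"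
    and lk: "\<And>\<alpha>. \<alpha> \<in> M \<Longrightarrow> \<alpha> \<noteq> {} \<Longrightarrow> has_homology_of_sphere F (int d - int (card \<alpha>)) (link \<alpha> M)"
    using M by (auto simp: closed_homology_manifold_def)
  have xM: "{x} \<in> M" using x simplicial_complexD(7)[OF cM] by simp
  show cL: "simplicial_complex (link {x} M)" by (rule simplicial_complex_link[OF cM xM])
  fix \<alpha> n assume \<alpha>: "\<alpha> \<in> link {x} M"
  then have ins: "insert x \<alpha> \<in> M" "x \<notin> \<alpha>" by (auto simp: link_def)
  have fin: "finite \<alpha>" by (rule simplicial_complexD(3)[OF cL \<alpha>])
  obtain G where G: "G \<in> M" "insert x \<alpha> \<subseteq> G" "\<And>\<beta>. \<beta> \<in> M \<Longrightarrow> G \<subseteq> \<beta> \<Longrightarrow> G = \<beta>"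
    using finite_has_maximal2[OF simplicial_complexD(1)[OF cM] ins(1)] by metis
  have "card G = Suc d" using pure G unfolding pure_of_dim_def by metis
  then have le: "card \<alpha> \<le> d"
    using card_mono[OF simplicial_complexD(3)[OF cM G(1)] G(2)] ins(2) fin by simp
  have "link \<alpha> (link {x} M) = link (insert x \<alpha>) M"
    using ins(2) by (auto simp: link_def Un_commute)
  moreover have "has_homology_of_sphere F (int (d - card \<alpha>) - 1) (link (insert x \<alpha>) M)"
    using lk[OF ins(1)] ins(2) fin le by (simp add: of_nat_diff algebra_simps)
  ultimately have "rbetti F n (link \<alpha> (link {x} M)) = (if n = d - card \<alpha> then 1 else 0)"
    using rbetti_sphere[OF simplicial_complex_link[OF cL \<alpha>], of F] by simp
  then show "rbetti F n (link \<alpha> (link {x} M)) = (if n + card \<alpha> = d then 1 else 0)"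
    using le by auto
qed

text \<open>
The sigma-vector formed with reduced homology in the usual convention, in which the empty complex
contributes to degree 0 instead of contributing \<open>-1\<close> in degree 1. The index is that of the mu-vector,
one more than that of the sigma-vector.
\<close>

definition weighted_rbetti :: "'f::field itself \<Rightarrow> nat \<Rightarrow> 'v set set \<Rightarrow> real" where
  "weighted_rbetti F i X =
     (\<Sum>A\<in>Pow (vertex_set X). of_int (rbetti F i (induced X A)) / of_nat (f0 X choose card A))"

lemma weighted_rbetti_0:
  assumes X: "simplicial_complex X"
  shows "weighted_rbetti F 0 X = 1"
proof -
  have "weighted_rbetti F 0 X = (\<Sum>A\<in>Pow (vertex_set X). if A = {} then 1 else 0)"
    unfolding weighted_rbetti_def
  proof (intro sum.cong refl)
    fix A assume "A \<in> Pow (vertex_set X)"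
    then have "vertex_set (induced X A) = A" using vertex_set_induced[OF X, of A] by auto
    then have "rbetti F 0 (induced X A) = (if A = {} then 1 else 0)"
      using rbetti_0[OF simplicial_complex_induced[OF X], of F A] by simp
    then show "of_int (rbetti F 0 (induced X A)) / of_nat (f0 X choose card A) = (if A = {} then 1 else 0 :: real)"
      by simp
  qed
  also have "\<dots> = 1" using simplicial_complexD(5)[OF X] by simp
  finally show ?thesis .
qed

lemma sigma_vec_eq:
  assumes X: "simplicial_complex X"
  shows "sigma_vec F i X = weighted_rbetti F (Suc i) X - (if i = 0 then 1 else 0)"
proof -
  have "red_betti F i (induced X A) = rbetti F (Suc i) (induced X A) - (if i = 0 then rbetti F 0 (induced X A) else 0)" for A
    using rbetti_betti[OF simplicial_complex_induced[OF X], of F i A] by (simp add: red_betti_def)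
  then have "sigma_vec F i X = weighted_rbetti F (Suc i) X - (if i = 0 then weighted_rbetti F 0 X else 0)"
    by (simp add: sigma_vec_def weighted_rbetti_def diff_divide_distrib sum_subtractf)
  then show ?thesis using weighted_rbetti_0[OF X, of F] by simp
qed

text \<open>
For \<open>i = 1\<close> the Kronecker summand cancels the contribution \<open>-1\<close> of the empty set to \<open>\<sigma>\<^sub>0\<close>, and for
\<open>i = 0\<close> the numerator 1 is the contribution of the empty set alone. So one formula covers all \<open>i\<close>.
\<close>

lemma mu_vec_eq:
  assumes M: "simplicial_complex M"
  shows "mu_vec F i M = (\<Sum>x\<in>vertex_set M. weighted_rbetti F i (link {x} M) / (1 + of_nat (f0 (link {x} M))))"
proof -
  have X: "simplicial_complex (link {x} M)" if "x \<in> vertex_set M" for x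
    using simplicial_complex_link[OF M] simplicial_complexD(7)[OF M] that by blast
  show ?thesis
  proof (cases i)
    case 0
    then show ?thesis unfolding mu_vec_def by (auto simp: weighted_rbetti_0[OF X] intro!: sum.cong)
  next
    case (Suc j)
    then show ?thesis unfolding mu_vec_def by (auto simp: sigma_vec_eq[OF X] intro!: sum.cong)
  qed
qed

lemma (in homology_sphere) weighted_rbetti_symmetric:
  assumes "i \<le> d"
  shows "weighted_rbetti F (d - i) L = weighted_rbetti F i L"
proof -
  have "weighted_rbetti F i L = (\<Sum>B\<in>Pow V. of_int (rbetti F i (induced L (V - B))) / of_nat (f0 L choose card (V - B)))"
    unfolding weighted_rbetti_def
    by (rule sum.reindex_bij_witness[where i = "\<lambda>B. V - B" and j = "\<lambda>A. V - A"]) (auto simp: double_diff)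
  also have "\<dots> = weighted_rbetti F (d - i) L"
    unfolding weighted_rbetti_def
  proof (intro sum.cong refl)
    fix B assume B: "B \<in> Pow V"
    have "f0 L choose card (V - B) = f0 L choose card B"
      using B card_mono[OF finite_V, of B] card_Diff_subset[of B V] finite_subset[OF _ finite_V]
      by (simp add: f0_def binomial_symmetric[of "card B" "card V"])
    then show "of_int (rbetti F i (induced L (V - B))) / of_nat (f0 L choose card (V - B))
        = of_int (rbetti F (d - i) (induced L B)) / (of_nat (f0 L choose card B) :: real)"
      by (simp add: alexander_duality[OF assms])
  qed
  finally show ?thesis by simp
qed

theorem theorem1p6:
  fixes M :: "'v set set" and d :: nat
  assumes "closed_homology_manifold TYPE('f::field) d M"
  shows "\<forall>i\<le>d. mu_vec TYPE('f) (d - i) M = mu_vec TYPE('f) i M"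
proof (intro allI impI)
  fix i assume i: "i \<le> d"
  have M: "simplicial_complex M" using assms by (simp add: closed_homology_manifold_def)
  show "mu_vec TYPE('f) (d - i) M = mu_vec TYPE('f) i M"
    unfolding mu_vec_eq[OF M]
    by (intro sum.cong refl)
      (simp add: homology_sphere.weighted_rbetti_symmetric[OF homology_sphere_link[OF assms] i])
qed

end
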